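(* Let $A$ and $B$ be exp-invariant groups with solvable conjugacy problem. Let $a\in A$ and $b\in B$ have the following properties: (i) $\exp(a)\neq 0$ and $\exp(b)\ne 0$; (ii) $a$ and $b$ are conjugate-search-solvable. Let $G$ be the free product of $A$ and $B$ amalgamating the cyclic subgroups generated by $a$ and $b$ (with $a$ identified with $b$). Then $G$ has a solvable conjugacy problem.
   Context: Groups are given by presentations. For a word in the generators, $\exp$ denotes the sum of the exponents of the generators occurring in it. A group (with its presentation) is *exp-invariant* if the exponent sum of each of its defining relations is zero, i.e. applying any of the defining relations to a word does not change the value of $\exp$; thus $\exp$ is a well-defined integer-valued function on the group. An element $h$ of a group $\Gamma$ is *conjugate-search-solvable* if, given any $u,v\in\Gamma$, one can (algorithmically) decide whether there exists an integer $c$ such that $h^c u h^{-c}=v$ and, additionally, one can find all such values of $c$, if they exist. The free product of $A$ and $B$ amalgamating the cyclic subgroups generated by $a$ and $b$ is the group generated by the generators of $A$ and $B$ subject to the relations of $A$, the relations of $B$, and $a=b$. A group has solvable conjugacy problem if there is an algorithm deciding, for two words in the generators, whether they represent conjugate elements. *)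

theory Defs
  imports "HOL-Algebra.Group" "HOL-Library.Nat_Bijection"
begin

section \<open>Computable functions\<close>

text \<open>
  \<open>recursive n f\<close>: the restriction of \<open>f\<close> to lists of length \<open>n\<close>, read as a total function
  of \<open>n\<close> natural-number arguments, is (general) recursive. Minimisation is applied to regular
  functions only, so that all functions in the class are total. Values on lists of any other
  length are irrelevant, by rule \<open>ext\<close>.
\<close>

inductive recursive :: "nat \<Rightarrow> (nat list \<Rightarrow> nat) \<Rightarrow> bool" where
  zero: "recursive n (\<lambda>xs. 0)"
| succ: "recursive 1 (\<lambda>xs. Suc (xs ! 0))"
| proj: "i < n \<Longrightarrow> recursive n (\<lambda>xs. xs ! i)"
| comp: "recursive (length gs) f \<Longrightarrow> (\<And>g. g \<in> set gs \<Longrightarrow> recursive n g)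
    \<Longrightarrow> recursive n (\<lambda>xs. f (map (\<lambda>g. g xs) gs))"
| prim_rec: "recursive n f \<Longrightarrow> recursive (Suc (Suc n)) g
    \<Longrightarrow> recursive (Suc n) (\<lambda>xs. rec_nat (f (tl xs)) (\<lambda>k r. g (k # r # tl xs)) (hd xs))"
| minim: "recursive (Suc n) f \<Longrightarrow> (\<And>xs. length xs = n \<Longrightarrow> \<exists>k. f (k # xs) = 0)
    \<Longrightarrow> recursive n (\<lambda>xs. LEAST k. f (k # xs) = 0)"
| ext: "recursive n f \<Longrightarrow> (\<And>xs. length xs = n \<Longrightarrow> f xs = g xs) \<Longrightarrow> recursive n g"


section \<open>Words\<close>

text \<open>
  Generators are numbered by natural numbers; the letter \<open>(i, True)\<close> is the \<open>i\<close>-th generator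
  and \<open>(i, False)\<close> its inverse.
\<close>

type_synonym letter = "nat \<times> bool"
type_synonym word = "letter list"

definition inv_word :: "word \<Rightarrow> word" where
  "inv_word w = rev (map (apsnd Not) w)"

definition exp_sum :: "word \<Rightarrow> int" where
  "exp_sum w = (\<Sum>(i, s)\<leftarrow>w. if s then 1 else - 1)"

definition letter_code :: "letter \<Rightarrow> nat" where
  "letter_code = (\<lambda>(i, s). 2 * i + of_bool s)"

definition word_code :: "word \<Rightarrow> nat" where
  "word_code w = list_encode (map letter_code w)"


section \<open>Groups given by presentations\<close>

text \<open>A relator \<open>r\<close> stands for the defining relation \<open>r = 1\<close>.\<close>

record presentation =
  gens :: "nat set"
  rels :: "word set"

definition words :: "presentation \<Rightarrow> word set" where
  "words P = lists (gens P \<times> UNIV)"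

definition wf_presentation :: "presentation \<Rightarrow> bool" where
  "wf_presentation P \<longleftrightarrow> rels P \<subseteq> words P"

inductive word_eq :: "presentation \<Rightarrow> word \<Rightarrow> word \<Rightarrow> bool" for P where
  refl: "w \<in> words P \<Longrightarrow> word_eq P w w"
| sym: "word_eq P u v \<Longrightarrow> word_eq P v u"
| trans: "word_eq P u v \<Longrightarrow> word_eq P v w \<Longrightarrow> word_eq P u w"
| cancel: "u \<in> words P \<Longrightarrow> v \<in> words P \<Longrightarrow> i \<in> gens P
    \<Longrightarrow> word_eq P (u @ [(i, s), (i, \<not> s)] @ v) (u @ v)"
| rel: "u \<in> words P \<Longrightarrow> v \<in> words P \<Longrightarrow> r \<in> rels P \<Longrightarrow> word_eq P (u @ r @ v) (u @ v)"

text \<open>The group element represented by a word, and the group itself.\<close>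

definition elt :: "presentation \<Rightarrow> word \<Rightarrow> word set" where
  "elt P w = {v. word_eq P w v}"

definition presented_group :: "presentation \<Rightarrow> word set monoid" where
  "presented_group P =
    \<lparr>carrier = elt P ` words P,
     mult = (\<lambda>x y. {w. \<exists>u\<in>x. \<exists>v\<in>y. word_eq P (u @ v) w}),
     one = elt P []\<rparr>"

definition exp_invariant :: "presentation \<Rightarrow> bool" where
  "exp_invariant P \<longleftrightarrow> (\<forall>r\<in>rels P. exp_sum r = 0)"


section \<open>Decision problems\<close>

definition conjugate_in :: "('g, 'm) monoid_scheme \<Rightarrow> 'g \<Rightarrow> 'g \<Rightarrow> bool" where
  "conjugate_in G x y \<longleftrightarrow> (\<exists>g\<in>carrier G. g \<otimes>\<^bsub>G\<^esub> x \<otimes>\<^bsub>G\<^esub> inv\<^bsub>G\<^esub> g = y)"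

definition solvable_conjugacy_problem :: "presentation \<Rightarrow> bool" where
  "solvable_conjugacy_problem P \<longleftrightarrow>
    (\<exists>D. recursive 2 D \<and>
      (\<forall>u\<in>words P. \<forall>v\<in>words P.
        D [word_code u, word_code v] =
          of_bool (conjugate_in (presented_group P) (elt P u) (elt P v))))"

definition conj_exponents :: "('g, 'm) monoid_scheme \<Rightarrow> 'g \<Rightarrow> 'g \<Rightarrow> 'g \<Rightarrow> int set" where
  "conj_exponents G h x y = {c. h [^]\<^bsub>G\<^esub> c \<otimes>\<^bsub>G\<^esub> x \<otimes>\<^bsub>G\<^esub> h [^]\<^bsub>G\<^esub> (- c) = y}"

text \<open>
  If nonempty, \<^term>\<open>conj_exponents G h x y\<close> is a coset in the integers of the subgroup of those
  exponents \<open>c\<close> for which \<open>h\<close> to the power \<open>c\<close> commutes with \<open>x\<close>. Finding all its elements means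
  computing a representative \<open>C\<close> of the coset and a generator \<open>N \<ge> 0\<close> of the subgroup (\<open>N = 0\<close>
  if the solution is unique).
\<close>

definition conjugate_search_solvable :: "presentation \<Rightarrow> word set \<Rightarrow> bool" where
  "conjugate_search_solvable P h \<longleftrightarrow>
    (\<exists>D C N. recursive 2 D \<and> recursive 2 C \<and> recursive 2 N \<and>
      (\<forall>u\<in>words P. \<forall>v\<in>words P.
        let S = conj_exponents (presented_group P) h (elt P u) (elt P v);
            xs = [word_code u, word_code v]
        in D xs = of_bool (S \<noteq> {}) \<and>
           (S \<noteq> {} \<longrightarrow> S = {int_decode (C xs) + k * int (N xs) | k. True})))"


section \<open>Free products with cyclic amalgamation\<close>

text \<open>The generators of the two factors are made disjoint by renumbering.\<close>

definition left_word :: "word \<Rightarrow> word" where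
  "left_word = map (apfst (\<lambda>i. sum_encode (Inl i)))"

definition right_word :: "word \<Rightarrow> word" where
  "right_word = map (apfst (\<lambda>i. sum_encode (Inr i)))"

definition amalgam :: "presentation \<Rightarrow> presentation \<Rightarrow> word \<Rightarrow> word \<Rightarrow> presentation" where
  "amalgam A B a b =
    \<lparr>gens = (\<lambda>i. sum_encode (Inl i)) ` gens A \<union> (\<lambda>i. sum_encode (Inr i)) ` gens B,
     rels = left_word ` rels A \<union> right_word ` rels B \<union> {left_word a @ inv_word (right_word b)}\<rparr>"


section \<open>Basic facts\<close>

lemma words_simps [simp]:
  "[] \<in> words P"
  "x # w \<in> words P \<longleftrightarrow> fst x \<in> gens P \<and> w \<in> words P"
  "u @ v \<in> words P \<longleftrightarrow> u \<in> words P \<and> v \<in> words P"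
  by (auto simp: words_def lists_eq_set mem_Times_iff)

lemma inv_word_in_words [simp]: "inv_word w \<in> words P \<longleftrightarrow> w \<in> words P"
  by (force simp: words_def lists_eq_set inv_word_def)

lemma exp_sum_simps [simp]:
  "exp_sum [] = 0"
  "exp_sum ((i, s) # w) = (if s then 1 else - 1) + exp_sum w"
  "exp_sum (u @ v) = exp_sum u + exp_sum v"
  by (simp_all add: exp_sum_def)

lemma word_eq_words:
  assumes "wf_presentation P" "word_eq P u v"
  shows "u \<in> words P \<and> v \<in> words P"
  using assms(2,1) by induction (auto simp: wf_presentation_def)

lemma word_eq_append:
  assumes "word_eq P u v" "x \<in> words P" "y \<in> words P"
  shows "word_eq P (x @ u @ y) (x @ v @ y)"
  using assms
proof induction
  case (cancel u v i s)
  then show ?case using word_eq.cancel[of "x @ u" P "v @ y" i s] by simp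
next
  case (rel u v r)
  then show ?case using word_eq.rel[of "x @ u" P "v @ y" r] by simp
qed (auto intro: word_eq.intros)

lemma word_eq_append2:
  assumes "wf_presentation P" "word_eq P u u'" "word_eq P v v'"
  shows "word_eq P (u @ v) (u' @ v')"
proof -
  have "word_eq P (u @ v) (u' @ v)"
    using word_eq_append[OF assms(2), of "[]" v] word_eq_words[OF assms(1,3)] by simp
  moreover have "word_eq P (u' @ v) (u' @ v')"
    using word_eq_append[OF assms(3), of u' "[]"] word_eq_words[OF assms(1,2)] by simp
  ultimately show ?thesis by (rule word_eq.trans)
qed

lemma word_eq_inv_word: "w \<in> words P \<Longrightarrow> word_eq P (inv_word w @ w) []"
proof (induction w)
  case Nil
  then show ?case by (simp add: inv_word_def word_eq.refl)
next
  case (Cons x w)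
  obtain i s where x: "x = (i, s)" by force
  have "word_eq P (inv_word w @ [(i, \<not> s), (i, \<not> \<not> s)] @ w) (inv_word w @ w)"
    using Cons.prems x by (intro word_eq.cancel) auto
  moreover have "inv_word (x # w) @ x # w = inv_word w @ [(i, \<not> s), (i, \<not> \<not> s)] @ w"
    by (simp add: inv_word_def x)
  ultimately show ?case using Cons word_eq.trans by auto
qed

lemma elt_eq_iff: "u \<in> words P \<Longrightarrow> elt P u = elt P v \<longleftrightarrow> word_eq P u v"
  by (auto simp: elt_def set_eq_iff intro: word_eq.intros)

lemma mult_elt:
  assumes "wf_presentation P" "u \<in> words P" "v \<in> words P"
  shows "elt P u \<otimes>\<^bsub>presented_group P\<^esub> elt P v = elt P (u @ v)"
proof -
  have "word_eq P u u" "word_eq P v v"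
    using assms by (auto intro: word_eq.refl)
  moreover have "word_eq P (u @ v) w"
    if "word_eq P u u'" "word_eq P v v'" "word_eq P (u' @ v') w" for u' v' w
    using word_eq_append2[OF assms(1) that(1,2)] that(3) by (rule word_eq.trans)
  ultimately show ?thesis
    by (auto simp: presented_group_def elt_def)
qed

lemma group_presented_group:
  assumes "wf_presentation P"
  shows "group (presented_group P)"
proof (rule groupI)
  fix x assume "x \<in> carrier (presented_group P)"
  then obtain w where w: "w \<in> words P" "x = elt P w"
    by (auto simp: presented_group_def)
  then have "elt P (inv_word w) \<otimes>\<^bsub>presented_group P\<^esub> x = \<one>\<^bsub>presented_group P\<^esub>"
    using mult_elt[OF assms, of "inv_word w" w] word_eq_inv_word[of w P]
    by (simp add: elt_eq_iff presented_group_def)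
  then show "\<exists>y\<in>carrier (presented_group P). y \<otimes>\<^bsub>presented_group P\<^esub> x = \<one>\<^bsub>presented_group P\<^esub>"
    using w by (intro bexI[of _ "elt P (inv_word w)"]) (auto simp: presented_group_def)
next
  have one: "\<one>\<^bsub>presented_group P\<^esub> = elt P []" 
    and carr: "carrier (presented_group P) = elt P ` words P"
    by (simp_all add: presented_group_def)
  show "\<one>\<^bsub>presented_group P\<^esub> \<in> carrier (presented_group P)"
    by (simp add: one carr)
  show "x \<otimes>\<^bsub>presented_group P\<^esub> y \<in> carrier (presented_group P)"
    if "x \<in> carrier (presented_group P)" "y \<in> carrier (presented_group P)" for x y
    using that by (auto simp: carr mult_elt[OF assms])
  show "x \<otimes>\<^bsub>presented_group P\<^esub> y \<otimes>\<^bsub>presented_group P\<^esub> z =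
      x \<otimes>\<^bsub>presented_group P\<^esub> (y \<otimes>\<^bsub>presented_group P\<^esub> z)"
    if "x \<in> carrier (presented_group P)" "y \<in> carrier (presented_group P)"
      "z \<in> carrier (presented_group P)" for x y z
    using that by (auto simp: carr mult_elt[OF assms])
  show "\<one>\<^bsub>presented_group P\<^esub> \<otimes>\<^bsub>presented_group P\<^esub> x = x"
    if "x \<in> carrier (presented_group P)" for x
    using that by (auto simp: one carr mult_elt[OF assms])
qed

lemma exp_sum_well_defined:
  assumes "exp_invariant P" "word_eq P u v"
  shows "exp_sum u = exp_sum v"
  using assms(2,1) by induction (auto simp: exp_invariant_def)

lemma wf_amalgam:
  assumes "wf_presentation A" "wf_presentation B" "a \<in> words A" "b \<in> words B"
  shows "wf_presentation (amalgam A B a b)"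
proof -
  have "left_word w \<in> words (amalgam A B a b)" if "w \<in> words A" for w
    using that by (induction w) (auto simp: left_word_def amalgam_def)
  moreover have "right_word w \<in> words (amalgam A B a b)" if "w \<in> words B" for w
    using that by (induction w) (auto simp: right_word_def amalgam_def)
  ultimately show ?thesis
    using assms by (subst wf_presentation_def) (auto simp: wf_presentation_def amalgam_def)
qed

end

theory Submission
  imports Defs
begin

text \<open>
  An element of the amalgam is a cyclic word of syllables from \<open>A \<union> B\<close>, glued along
  \<open>\<langle>a\<rangle> = \<langle>b\<rangle>\<close>, and conjugate elements are linked by merging neighbouring
  syllables of the same factor. Merging is confluent modulo sliding elements of the amalgamated
  subgroup between neighbours (modulo conjugation in a factor for a single syllable), so conjugate
  elements have reduced cyclic words that agree up to rotations and slides. For single syllables a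
  chain of conjugations through the subgroup is constant there because exponent sums separate its
  elements. For longer words the elements slid between the syllables are powers of \<open>a\<close>
  whose successive differences are again dictated by exponent sums, which leaves a single unknown
  power \<open>a\<^sup>k\<close>; the admissible \<open>k\<close> form an intersection of finitely many cosets, and the
  given representatives and moduli bound the smallest one.

  Since the given deciders return arbitrary values outside the words of their presentation, every
  search has to be bounded; unbounded minimisation would not be applied to a regular function.
\<close>

section \<open>Computable functions between encoded types\<close>

text \<open>Exponent sums are invariants of each factor only: the relator identifying
  \<open>a\<close> with \<open>b\<close> need not have exponent sum 0, so no exponent sum is
  available on the amalgam. Hence each factor keeps its own exponent map, and exponents are compared
  only inside one factor. There a nonzero sum makes membership in the cyclic subgroup decidable: the
  only candidate power has as exponent a quotient of exponent sums, and it is checked with the word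
  problem, which is conjugacy to the identity. The same fact makes both subgroups infinite cyclic,
  so the identification is consistent. Confluence yields the conjugacy criterion directly from the
  presentation. Neither coset representatives nor a normal form theorem for amalgams is presupposed:
  elements of the amalgam are compared with cyclic words over the glued union of the factors, which
  need not be a group. Conjugation inside a factor is a slide for one-syllable words because a
  two-syllable cyclic word can be merged to \<open>x \<cdot> y\<close> as well as to
  \<open>y \<cdot> x\<close>.\<close>

lemma recursive_comp1:
  assumes "recursive 1 f" "recursive n g"
  shows "recursive n (\<lambda>xs. f [g xs])"
  using recursive.comp[of "[g]" f n] assms by simp

lemma recursive_comp2:
  assumes "recursive 2 f" "recursive n g" "recursive n h"
  shows "recursive n (\<lambda>xs. f [g xs, h xs])"
  using recursive.comp[of "[g, h]" f n] assms by (force simp: numeral_2_eq_2)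

lemma recursive_Suc: "recursive n f \<Longrightarrow> recursive n (\<lambda>xs. Suc (f xs))"
  using recursive_comp1[OF recursive.succ] by simp

lemma recursive_const: "recursive n (\<lambda>xs. k)"
  by (induction k) (auto intro: recursive.zero recursive_Suc)

text \<open>A single parameter \<open>x\<close> suffices, because several values can be packed into
  one code by pairing.\<close>

lemma recursive_rec:
  assumes "recursive 1 f" "recursive 3 g" "recursive n h" "recursive n x"
  shows "recursive n (\<lambda>xs. rec_nat (f [x xs]) (\<lambda>k r. g [k, r, x xs]) (h xs))"
proof -
  have "recursive (Suc 1) (\<lambda>xs. rec_nat (f (tl xs)) (\<lambda>k r. g (k # r # tl xs)) (hd xs))"
    using assms(1,2) by (intro recursive.prim_rec) (simp_all add: numeral_3_eq_3)
  from recursive_comp2[OF this[folded Suc_1[symmetric], simplified] assms(3,4)]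
  show ?thesis by simp
qed

lemma recursive_proj_2: "recursive 2 (\<lambda>xs. xs ! 0)" "recursive 2 (\<lambda>xs. xs ! 1)"
  by (intro recursive.proj; simp)+

lemma recursive_proj_3:
  "recursive 3 (\<lambda>xs. xs ! 0)" "recursive 3 (\<lambda>xs. xs ! 1)" "recursive 3 (\<lambda>xs. xs ! 2)"
  by (intro recursive.proj; simp)+

lemma recursive_proj_1: "recursive 1 (\<lambda>xs. xs ! 0)"
  by (intro recursive.proj; simp)

lemma recursive_add:
  assumes "recursive n f" "recursive n g"
  shows "recursive n (\<lambda>xs. f xs + g xs)"
proof -
  have "rec_nat y (\<lambda>k r. Suc r) x = x + y" for x y :: nat
    by (induction x) auto
  then show ?thesis
    using recursive_rec[OF recursive_proj_1 recursive_Suc[OF recursive_proj_3(2)] assms] by simp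
qed

lemma recursive_mult:
  assumes "recursive n f" "recursive n g"
  shows "recursive n (\<lambda>xs. f xs * g xs)"
proof -
  have "rec_nat 0 (\<lambda>k r. r + y) x = x * y" for x y :: nat
    by (induction x) auto
  then show ?thesis
    using recursive_rec[OF recursive.zero
        recursive_add[OF recursive_proj_3(2,3)] assms] by simp
qed

lemma recursive_pred:
  assumes "recursive n f"
  shows "recursive n (\<lambda>xs. f xs - 1)"
proof -
  have "rec_nat 0 (\<lambda>k r. k) x = x - 1" for x :: nat
    by (cases x) auto
  then show ?thesis
    using recursive_rec[OF recursive.zero recursive_proj_3(1) assms assms] by simp
qed

lemma recursive_diff:
  assumes "recursive n f" "recursive n g"
  shows "recursive n (\<lambda>xs. f xs - g xs)"
proof -
  have "rec_nat y (\<lambda>k r. r - 1) x = y - x" for x y :: nat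
    by (induction x) auto
  then show ?thesis
    using recursive_rec[OF recursive_proj_1 recursive_pred[OF recursive_proj_3(2)] assms(2,1)] by simp
qed

lemma recursive_if_zero:
  assumes "recursive n f" "recursive n g" "recursive n h"
  shows "recursive n (\<lambda>xs. if f xs = 0 then g xs else h xs)"
proof -
  have "(1 - x) * y + (1 - (1 - x)) * z = (if x = 0 then y else z)" for x y z :: nat
    by simp
  moreover have "recursive n
      (\<lambda>xs. (1 - f xs) * g xs + (1 - (1 - f xs)) * h xs)"
    by (intro recursive_add recursive_mult recursive_diff recursive_const assms)
  ultimately show ?thesis by simp
qed

lemma recursive_triangle:
  assumes "recursive n f"
  shows "recursive n (\<lambda>xs. triangle (f xs))"
proof -
  have "rec_nat 0 (\<lambda>k r. r + Suc k) x = triangle x" for x :: nat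
    by (induction x) auto
  then show ?thesis
    using recursive_rec[OF recursive.zero
        recursive_add[OF recursive_proj_3(2) recursive_Suc[OF recursive_proj_3(1)]] assms assms]
    by simp
qed

lemma recursive_prod_encode:
  assumes "recursive n f" "recursive n g"
  shows "recursive n (\<lambda>xs. prod_encode (f xs, g xs))"
  unfolding prod_encode_def prod.case
  by (intro recursive_add recursive_triangle assms)

text \<open>The index of the diagonal on which the pair with code \<open>z\<close> lies.\<close>

definition diagonal :: "nat \<Rightarrow> nat" where
  "diagonal z = rec_nat 0 (\<lambda>k r. if triangle (Suc r) - Suc k = 0 then Suc r else r) z"

lemma recursive_diagonal: "recursive n f \<Longrightarrow> recursive n (\<lambda>xs. diagonal (f xs))"
proof -
  assume "recursive n f"
  moreover have "recursive 3 (\<lambda>xs. if triangle (Suc (xs ! 1)) - Suc (xs ! 0) = 0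
      then Suc (xs ! 1) else xs ! 1)"
    by (intro recursive_if_zero recursive_diff recursive_triangle recursive_Suc recursive_proj_3)
  ultimately show ?thesis
    unfolding diagonal_def using recursive_rec[OF recursive.zero, of _ n f f]
    by (fastforce cong: if_cong simp del: diff_is_0_eq triangle_Suc)
qed

lemma triangle_mono: "m \<le> n \<Longrightarrow> triangle m \<le> triangle n"
  by (induction n) (auto simp: le_Suc_eq)

text \<open>From \<open>z\<close> to \<open>z + 1\<close> the index has to grow by at most one,
  namely when the next triangular number is reached. The truncated difference in
  \<open>diagonal\<close> being 0 expresses this comparison.\<close>

lemma diagonal_bounds: "triangle (diagonal z) \<le> z \<and> z < triangle (Suc (diagonal z))"
  by (induction z) (auto simp: diagonal_def)

text \<open>The code of \<open>(m, n)\<close> is the triangular number of \<open>m + n\<close> plus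
  \<open>m\<close>, so recovering the diagonal recovers \<open>m + n\<close>, and then
  \<open>m\<close> by subtraction.\<close>

lemma diagonal_prod_encode: "diagonal (prod_encode (m, n)) = m + n"
proof -
  have "triangle (m + n) \<le> prod_encode (m, n)" "prod_encode (m, n) < triangle (Suc (m + n))"
    by (simp_all add: prod_encode_def)
  moreover have "d < e" if "triangle d < triangle e" for d e
    using that triangle_mono[of e d] by (meson leD not_le)
  ultimately have "diagonal (prod_encode (m, n)) < Suc (m + n)"
    "m + n < Suc (diagonal (prod_encode (m, n)))"
    using diagonal_bounds[of "prod_encode (m, n)"] by (meson le_less_trans)+
  then show ?thesis by linarith
qed

lemma recursive_fst_prod_decode:
  "recursive n f \<Longrightarrow> recursive n (\<lambda>xs. fst (prod_decode (f xs)))"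
proof -
  have "fst (prod_decode z) = z - triangle (diagonal z)" for z
    using diagonal_prod_encode[of "fst (prod_decode z)" "snd (prod_decode z)"]
    using prod_decode_inverse[of z] by (cases "prod_decode z") (auto simp: prod_encode_def)
  then show "recursive n f \<Longrightarrow> ?thesis"
    by (simp add: recursive_diff recursive_triangle recursive_diagonal)
qed

lemma recursive_snd_prod_decode:
  "recursive n f \<Longrightarrow> recursive n (\<lambda>xs. snd (prod_decode (f xs)))"
proof -
  have "snd (prod_decode z) = diagonal z - fst (prod_decode z)" for z
    using diagonal_prod_encode[of "fst (prod_decode z)" "snd (prod_decode z)"] by simp
  then show "recursive n f \<Longrightarrow> ?thesis"
    by (simp add: recursive_diff recursive_fst_prod_decode recursive_diagonal)
qed

lemma recursive_div:
  assumes "recursive n f" "recursive n g"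
  shows "recursive n (\<lambda>xs. f xs div g xs)"
proof -
  let ?r = "\<lambda>d x. rec_nat 0 (\<lambda>k r. if Suc r * d - Suc k = 0 then Suc r else r) x"
  have *: "?r d x * d \<le> x \<and> x < Suc (?r d x) * d" if "d > 0" for d x
    using that by (induction x) auto
  \<comment> \<open>For \<open>d = 0\<close> the counter would grow at every step, whereas division
    by 0 gives 0 in HOL.\<close>
  have div: "(if d = 0 then 0 else ?r d x) = x div d" for d x
  proof (cases "d = 0")
    case False
    then show ?thesis
      using *[of d x] by (auto intro!: div_nat_eqI[symmetric] simp: mult.commute)
  qed simp
  have "recursive 3 (\<lambda>xs. if Suc (xs ! 1) * xs ! 2 - Suc (xs ! 0) = 0 then Suc (xs ! 1) else xs ! 1)"
    by (intro recursive_if_zero recursive_diff recursive_mult recursive_Suc recursive_proj_3)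
  from recursive_rec[OF recursive.zero this assms]
  have "recursive n (\<lambda>xs. ?r (g xs) (f xs))" by (simp del: diff_is_0_eq mult_Suc cong: if_cong)
  from recursive_if_zero[OF assms(2) recursive.zero this] show ?thesis
    by (simp add: div)
qed

section \<open>Codes for structured types and computable functions between them\<close>

class encodable =
  fixes enc :: "'a \<Rightarrow> nat"
  assumes enc_inject: "enc x = enc y \<Longrightarrow> x = y"

instantiation nat :: encodable
begin
definition enc_nat :: "nat \<Rightarrow> nat" where "enc_nat n = n"
instance by standard (simp add: enc_nat_def)
end

instantiation bool :: encodable
begin
definition enc_bool :: "bool \<Rightarrow> nat" where "enc_bool b = of_bool b"
instance by standard (auto simp: enc_bool_def of_bool_eq_iff)
end

instantiation int :: encodable
begin
definition enc_int :: "int \<Rightarrow> nat" where "enc_int = int_encode"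
instance by standard (simp add: enc_int_def int_encode_eq)
end

instantiation prod :: (encodable, encodable) encodable
begin
definition enc_prod :: "'a \<times> 'b \<Rightarrow> nat" where "enc_prod p = prod_encode (enc (fst p), enc (snd p))"
instance by standard (auto simp: enc_prod_def dest: enc_inject intro: prod_eqI)
end

instantiation list :: (encodable) encodable
begin
definition enc_list :: "'a list \<Rightarrow> nat" where "enc_list xs = list_encode (map enc xs)"
instance
proof
  have "inj (enc :: 'a \<Rightarrow> nat)" by (auto intro: injI enc_inject)
  then show "enc xs = enc ys \<Longrightarrow> xs = ys" for xs ys :: "'a list"
    by (simp add: enc_list_def list_encode_eq)
qed
end

lemma enc_inject_iff [simp]: "enc x = enc y \<longleftrightarrow> x = y"
  by (auto dest: enc_inject)

lemma enc_Pair [simp]: "enc (x, y) = prod_encode (enc x, enc y)"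
  by (simp add: enc_prod_def)

lemma enc_Nil [simp]: "enc [] = 0"
  by (simp add: enc_list_def)

lemma enc_Cons [simp]: "enc (x # xs) = Suc (prod_encode (enc x, enc xs))"
  by (simp add: enc_list_def)

text \<open>\<open>F\<close> is constrained on codes only, so its values elsewhere are free.
  Functions of several arguments are read as functions of nested pairs, which explains the
  \<open>fst\<close>/\<open>snd\<close> patterns in the rules below.\<close>

definition computable :: "('a::encodable \<Rightarrow> 'b::encodable) \<Rightarrow> bool" where
  "computable f \<longleftrightarrow> (\<exists>F. recursive 1 F \<and> (\<forall>x. F [enc x] = enc (f x)))"

lemma computableE:
  assumes "computable f"
  obtains F where "recursive 1 F" "\<And>x. F [enc x] = enc (f x)"
  using assms by (auto simp: computable_def)

lemma computableI:
  "recursive 1 F \<Longrightarrow> (\<And>x. F [enc x] = enc (f x)) \<Longrightarrow> computable f"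
  by (auto simp: computable_def)

named_theorems computable_intros

lemma computable_id [computable_intros]: "computable (\<lambda>x. x)"
  by (rule computableI[OF recursive_proj_1]) simp

lemma computable_const [computable_intros]: "computable (\<lambda>x. k)"
  by (rule computableI[OF recursive_const]) simp

lemma computable_comp:
  assumes "computable f" "computable g"
  shows "computable (\<lambda>x. f (g x))"
proof -
  obtain F where F: "recursive 1 F" "\<And>x. F [enc x] = enc (f x)"
    using assms(1) by (rule computableE) blast
  obtain G where G: "recursive 1 G" "\<And>x. G [enc x] = enc (g x)"
    using assms(2) by (rule computableE) blast
  show ?thesis
    by (rule computableI[OF recursive_comp1[OF F(1) G(1)]]) (simp add: F G)
qed

lemma computable_Pair [computable_intros]:
  assumes "computable f" "computable g"
  shows "computable (\<lambda>x. (f x, g x))"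
proof -
  obtain F where F: "recursive 1 F" "\<And>x. F [enc x] = enc (f x)"
    using assms(1) by (rule computableE) blast
  obtain G where G: "recursive 1 G" "\<And>x. G [enc x] = enc (g x)"
    using assms(2) by (rule computableE) blast
  show ?thesis
    by (rule computableI[OF recursive_prod_encode[OF F(1) G(1)]]) (simp add: F G)
qed

lemma computable_fst [computable_intros]: 
  "computable f \<Longrightarrow> computable (\<lambda>x. fst (f x))"
  by (rule computable_comp[of fst], rule computableI[OF recursive_fst_prod_decode[OF recursive_proj_1]])
    (simp_all add: enc_prod_def)

lemma computable_snd [computable_intros]: 
  "computable f \<Longrightarrow> computable (\<lambda>x. snd (f x))"
  by (rule computable_comp[of snd], rule computableI[OF recursive_snd_prod_decode[OF recursive_proj_1]])
    (simp_all add: enc_prod_def)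

lemma computable_comp2:
  assumes "computable (\<lambda>p. f (fst p) (snd p))" "computable g" "computable h"
  shows "computable (\<lambda>x. f (g x) (h x))"
  using computable_comp[OF assms(1) computable_Pair[OF assms(2,3)]] by simp

lemma computable_comp3:
  assumes "computable (\<lambda>p. f (fst p) (fst (snd p)) (snd (snd p)))"
    "computable g" "computable h" "computable k"
  shows "computable (\<lambda>x. f (g x) (h x) (k x))"
  using computable_comp[OF assms(1) computable_Pair[OF assms(2) computable_Pair[OF assms(3,4)]]] by simp

text \<open>Only codes matter: a function may be replaced by one with values in another type as long
  as the codes agree. Integers and list operations are thereby reduced to arithmetic on their
  codes.\<close>

lemma computable_transfer:
  assumes "computable f" "\<And>x. enc (f x) = enc (g x)"
  shows "computable g"
  using assms by (simp add: computable_def)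

lemma computable_enc: "computable (enc :: 'a::encodable \<Rightarrow> nat)"
  by (rule computableI[OF recursive_proj_1]) (simp add: enc_nat_def)

lemma computable_If [computable_intros]:
  assumes "computable p" "computable f" "computable g"
  shows "computable (\<lambda>x. if p x then f x else g x)"
proof -
  obtain P where P: "recursive 1 P" "\<And>x. P [enc x] = enc (p x)"
    using assms(1) by (rule computableE) blast
  obtain F where F: "recursive 1 F" "\<And>x. F [enc x] = enc (f x)"
    using assms(2) by (rule computableE) blast
  obtain G where G: "recursive 1 G" "\<And>x. G [enc x] = enc (g x)"
    using assms(3) by (rule computableE) blast
  show ?thesis
  proof (rule computableI)
    show "recursive 1 (\<lambda>xs. if P [xs ! 0] = 0 then G [xs ! 0] else F [xs ! 0])"
      by (intro recursive_if_zero P G F recursive_comp1[OF _ recursive_proj_1])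
  qed (simp add: P F G enc_bool_def)
qed

lemma computable_not [computable_intros]: "computable p \<Longrightarrow> computable (\<lambda>x. \<not> p x)"
  using computable_If[OF _ computable_const[of False] computable_const[of True]]
  by (simp only: if_False if_True if_bool_eq_disj simp_thms)

lemma computable_conj [computable_intros]:
  "computable p \<Longrightarrow> computable q \<Longrightarrow> computable (\<lambda>x. p x \<and> q x)"
  using computable_If[OF _ _ computable_const[of False], of p q]
  by (simp only: if_bool_eq_disj simp_thms)

lemma computable_disj [computable_intros]:
  "computable p \<Longrightarrow> computable q \<Longrightarrow> computable (\<lambda>x. p x \<or> q x)"
  using computable_not[OF computable_conj[OF computable_not computable_not, of p q]] by simp

text \<open>The surrounding argument \<open>x\<close> becomes the recursion parameter, so the step
  function may depend on the whole context.\<close>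

lemma computable_rec_nat [computable_intros]:
  assumes f: "computable f"
    and g: "computable (\<lambda>p. g (fst p) (fst (snd p)) (snd (snd p)))"
    and n: "computable n"
  shows "computable (\<lambda>x. rec_nat (f x) (g x) (n x))"
proof -
  obtain F where F: "recursive 1 F" "\<And>x. F [enc x] = enc (f x)"
    using f by (rule computableE) blast
  obtain G where G: "recursive 1 G"
    "\<And>p. G [enc p] = enc (g (fst p) (fst (snd p)) (snd (snd p)))"
    using g by (rule computableE) blast
  obtain N where N: "recursive 1 N" "\<And>x. N [enc x] = n x"
    using n by (rule computableE) (simp add: enc_nat_def)
  have "recursive 3 (\<lambda>xs. G [prod_encode (xs ! 2, prod_encode (xs ! 0, xs ! 1))])"
    by (intro recursive_comp1[OF G(1)] recursive_prod_encode recursive_proj_3)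
  from recursive_rec[OF F(1) this recursive_comp1[OF N(1) recursive_proj_1] recursive_proj_1]
  have "recursive 1 (\<lambda>xs. rec_nat (F [xs ! 0])
      (\<lambda>k r. G [prod_encode (xs ! 0, prod_encode (k, r))]) (N [xs ! 0]))"
    by simp
  moreover have "rec_nat (F [enc x]) (\<lambda>k r. G [prod_encode (enc x, prod_encode (k, r))]) m =
      enc (rec_nat (f x) (g x) m)" for x m
  proof (induction m)
    case (Suc m)
    then show ?case using G(2)[of "(x, m, rec_nat (f x) (g x) m)"] by (simp add: enc_nat_def)
  qed (simp add: F)
  ultimately show ?thesis by (intro computableI) (auto simp: N)
qed

lemma computable_nat_recursive:
  assumes "recursive 1 (\<lambda>xs. f (xs ! 0))" "computable g"
  shows "computable (\<lambda>x. (f :: nat \<Rightarrow> nat) (g x))"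
  by (rule computable_comp[OF _ assms(2)], rule computableI[OF assms(1)]) (simp add: enc_nat_def)

lemma computable_nat_recursive2:
  assumes "recursive 2 (\<lambda>xs. f (xs ! 0) (xs ! 1))" "computable g" "computable h"
  shows "computable (\<lambda>x. (f :: nat \<Rightarrow> nat \<Rightarrow> nat) (g x) (h x))"
proof (rule computable_comp2[OF _ assms(2,3)], rule computableI)
  show "recursive 1 (\<lambda>xs. f (fst (prod_decode (xs ! 0))) (snd (prod_decode (xs ! 0))))"
    using recursive_comp2[OF assms(1) recursive_fst_prod_decode[OF recursive_proj_1]
        recursive_snd_prod_decode[OF recursive_proj_1]]
    by simp
qed (simp add: enc_nat_def enc_prod_def)

lemmas computable_Suc [computable_intros] =
  computable_nat_recursive[OF recursive_Suc[OF recursive_proj_1]]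

lemmas computable_nat_arith [computable_intros] =
  computable_nat_recursive2[OF recursive_add[OF recursive_proj_2]]
  computable_nat_recursive2[OF recursive_diff[OF recursive_proj_2]]
  computable_nat_recursive2[OF recursive_mult[OF recursive_proj_2]]
  computable_nat_recursive2[OF recursive_div[OF recursive_proj_2]]

lemma computable_is_zero:
  assumes "computable f"
  shows "computable (\<lambda>x. f x = (0 :: nat))"
proof (rule computable_comp[OF _ assms], rule computableI)
  show "recursive 1 (\<lambda>xs. 1 - xs ! 0)"
    by (intro recursive_diff recursive_const recursive_proj_1)
qed (simp add: enc_nat_def enc_bool_def)

lemma computable_le [computable_intros]:
  assumes "computable f" "computable g"
  shows "computable (\<lambda>x. f x \<le> (g x :: nat))"
  using computable_is_zero[OF computable_nat_arith(2)[OF assms]] by simp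

lemma computable_eq [computable_intros]:
  assumes "computable f" "computable g"
  shows "computable (\<lambda>x. f x = g x)"
proof -
  have "computable (\<lambda>x. enc (f x) \<le> enc (g x) \<and> enc (g x) \<le> enc (f x))"
    by (intro computable_intros computable_comp[OF computable_enc] assms)
  moreover have "enc y \<le> enc z \<and> enc z \<le> enc y \<longleftrightarrow> y = z" for y z :: 'b
    by (auto simp: order.eq_iff[of "enc y", symmetric])
  ultimately show ?thesis by simp
qed

lemma computable_even [computable_intros]:
  assumes "computable f"
  shows "computable (\<lambda>x. even (f x :: nat))"
proof -
  have "even n \<longleftrightarrow> 2 * (n div 2) = n" for n :: nat by presburger
  then show ?thesis by (simp only:, intro computable_intros assms)
qed

text \<open>Under \<open>int_encode\<close> a nonnegative \<open>i\<close> has code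
  \<open>2 * i\<close> and a negative one has code \<open>- 2 * i - 1\<close>. Parity is thus the
  sign, which the next lemmas exploit.\<close>

lemma computable_int [computable_intros]:
  "computable f \<Longrightarrow> computable (\<lambda>x. int (f x))"
  by (rule computable_transfer[of "\<lambda>x. 2 * f x"])
    (intro computable_intros, auto simp: enc_int_def enc_nat_def int_encode_def sum_encode_def)

lemma computable_neg_iff: "computable (\<lambda>i :: int. i < 0)"
  by (rule computable_transfer[of "\<lambda>i. odd (enc i)"])
    (intro computable_intros computable_enc,
      auto simp: enc_int_def enc_bool_def int_encode_def sum_encode_def)

lemma computable_nat_id: "computable nat"
  by (rule computable_transfer[of "\<lambda>i. if i < 0 then 0 else enc i div 2"])
    (intro computable_intros computable_enc computable_neg_iff,
      auto simp: enc_int_def enc_nat_def int_encode_def sum_encode_def)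

lemmas computable_neg [computable_intros] = computable_comp[OF computable_neg_iff]
lemmas computable_nat [computable_intros] = computable_comp[OF computable_nat_id]

lemma computable_uminus_int: "computable (uminus :: int \<Rightarrow> int)"
proof -
  have neg: "computable (\<lambda>n. - int n)"
    by (rule computable_transfer[of "\<lambda>n. 2 * n - 1"])
      (intro computable_intros, auto simp: enc_int_def enc_nat_def int_encode_def sum_encode_def)
  have "computable (\<lambda>i :: int. if i < 0 then int (Suc (enc i div 2)) else - int (nat i))"
    by (intro computable_intros computable_enc computable_comp[OF neg])
  moreover have "(if i < 0 then int (Suc (enc i div 2)) else - int (nat i)) = - i" for i :: int
    by (auto simp: enc_int_def int_encode_def sum_encode_def)
  ultimately show ?thesis by simp
qed

lemmas computable_uminus [computable_intros] = computable_comp[OF computable_uminus_int]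

lemma computable_add_int [computable_intros]:
  assumes "computable f" "computable g"
  shows "computable (\<lambda>x. f x + g x :: int)"
proof (rule computable_comp2[OF _ assms])
  have "i + j = (if nat (- i) + nat (- j) \<le> nat i + nat j
      then int (nat i + nat j - (nat (- i) + nat (- j)))
      else - int (nat (- i) + nat (- j) - (nat i + nat j)))" for i j :: int
    by auto
  then show "computable (\<lambda>p. fst p + snd p :: int)"
    by (simp only:, intro computable_intros)
qed

lemma computable_diff_int [computable_intros]:
  assumes "computable f" "computable g"
  shows "computable (\<lambda>x. f x - g x :: int)"
  using computable_add_int[OF assms(1) computable_uminus[OF assms(2)]] by simp

text \<open>Only exact quotients carry meaning. On other arguments the value is an arbitrary
  candidate, and whatever is built from it is verified afterwards.\<close>

definition int_quot :: "int \<Rightarrow> int \<Rightarrow> int" where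
  "int_quot i j = (let q = int ((nat i + nat (- i)) div (nat j + nat (- j)))
    in if (i < 0) = (j < 0) then q else - q)"

lemma int_quot_mult:
  assumes "j \<noteq> 0"
  shows "int_quot (k * j) j = k"
proof -
  have "nat i + nat (- i) = nat \<bar>i\<bar>" for i by auto
  then have "int ((nat (k * j) + nat (- (k * j))) div (nat j + nat (- j))) = \<bar>k\<bar>"
    using assms by (simp add: abs_mult nat_mult_distrib)
  then show ?thesis
    unfolding int_quot_def Let_def using assms by (auto simp: mult_less_0_iff not_less)
qed

lemma computable_int_quot [computable_intros]:
  assumes "computable f" "computable g"
  shows "computable (\<lambda>x. int_quot (f x) (g x))"
  unfolding int_quot_def Let_def by (intro computable_intros assms)

section \<open>Lists\<close>

lemma computable_Cons [computable_intros]: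
  assumes "computable f" "computable g"
  shows "computable (\<lambda>x. f x # g x)"
  by (rule computable_transfer[of "\<lambda>x. Suc (enc (f x, g x))"])
    (intro computable_intros computable_comp[OF computable_enc] assms, simp add: enc_nat_def)

lemma computable_hd [computable_intros]:
  assumes "computable f"
  shows "computable (\<lambda>x. hd (f x))"
proof (rule computable_comp[OF _ assms], rule computable_transfer)
  \<comment> \<open>\<open>hd []\<close> is one fixed, though unspecified, value, so its code is a
    constant.\<close>
  show "enc (if xs = [] then enc (hd [] :: 'b) else fst (prod_decode (enc xs - 1))) = enc (hd xs)"
    for xs :: "'b list"
    by (cases xs) (auto simp: enc_nat_def)
  show "computable (\<lambda>xs :: 'b list. if xs = [] then enc (hd [] :: 'b)
      else fst (prod_decode (enc xs - 1)))"
    by (intro computable_intros computable_enc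
        computable_nat_recursive[OF recursive_fst_prod_decode[OF recursive_proj_1]])
qed

lemma computable_tl [computable_intros]:
  assumes "computable f"
  shows "computable (\<lambda>x. tl (f x))"
proof (rule computable_comp[OF _ assms], rule computable_transfer)
  show "enc (if xs = [] then 0 else snd (prod_decode (enc xs - 1))) = enc (tl xs)"
    for xs :: "'b list"
    by (cases xs) (auto simp: enc_nat_def)
  show "computable (\<lambda>xs :: 'b list. if xs = [] then 0 else snd (prod_decode (enc xs - 1)))"
    by (intro computable_intros computable_enc
        computable_nat_recursive[OF recursive_snd_prod_decode[OF recursive_proj_1]])
qed

text \<open>This makes the code of a list a computable bound on the number of iterations needed to
  traverse it.\<close>

lemma length_le_enc: "length xs \<le> enc xs"
proof (induction xs)
  case (Cons x xs)
  then show ?case using le_prod_encode_2[of "enc xs" "enc x"] by simp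
qed simp

lemma computable_foldl [computable_intros]:
  assumes g: "computable (\<lambda>p. g (fst p) (fst (snd p)) (snd (snd p)))"
    and f: "computable f" and l: "computable l"
  shows "computable (\<lambda>x. foldl (g x) (f x) (l x))"
proof -
  \<comment> \<open>The state holds the accumulator and the rest of the list. Once the rest is empty
    the step idles, so too many iterations do no harm.\<close>
  define step where "step = (\<lambda>x (k :: nat) p.
    if snd p = [] then p else (g x (fst p) (hd (snd p)), tl (snd p)))"
  have "computable (\<lambda>x. fst (rec_nat (f x, l x) (step x) (enc (l x))))"
    unfolding step_def
    by (intro computable_intros f l computable_comp[OF computable_enc] computable_comp3[OF g])
  moreover have "fst (rec_nat (s, xs) (step x) n) = foldl (g x) s xs" if "length xs \<le> n" for x s xs n
    using that
  proof (induction n arbitrary: s xs)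
    case (Suc n)
    \<comment> \<open>Since \<open>step\<close> ignores the counter, the first iteration can be
      split off instead of the last, which matches the recursion of \<open>foldl\<close>.\<close>
    have "rec_nat (s, xs) (step x) (Suc n) = rec_nat (step x n (s, xs)) (step x) n" for n
      by (induction n) (auto simp: step_def)
    then show ?case using Suc by (cases xs) (auto simp: step_def split: if_splits)
  qed simp
  ultimately show ?thesis by (simp add: length_le_enc)
qed

lemma computable_rev [computable_intros]: "computable f \<Longrightarrow> computable (\<lambda>x. rev (f x))"
proof -
  have "rev xs = foldl (\<lambda>ys y. y # ys) [] xs" for xs :: "'b list"
    by (simp add: foldl_conv_fold rev_conv_fold)
  then show "computable f \<Longrightarrow> ?thesis"
    by (simp only:, intro computable_intros)
qed

lemma computable_foldr [computable_intros]:
  assumes "computable (\<lambda>p. g (fst p) (fst (snd p)) (snd (snd p)))" "computable l" "computable f"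
  shows "computable (\<lambda>x. foldr (g x) (l x) (f x))"
  unfolding foldr_conv_foldl
  by (intro computable_intros computable_comp3[OF assms(1)] assms(2,3))

lemma computable_map [computable_intros]:
  assumes "computable (\<lambda>p. g (fst p) (snd p))" "computable l"
  shows "computable (\<lambda>x. map (g x) (l x))"
proof -
  have "map h xs = foldr (\<lambda>y ys. h y # ys) xs []" for h :: "'b \<Rightarrow> 'c" and xs
    by (induction xs) auto
  then show ?thesis
    by (simp only:, intro computable_intros computable_comp2[OF assms(1)] assms(2))
qed

lemma computable_append [computable_intros]:
  assumes "computable f" "computable g"
  shows "computable (\<lambda>x. f x @ g x)"
proof -
  have "xs @ ys = foldr (#) xs ys" for xs ys :: "'b list"
    by (induction xs) auto
  then show ?thesis by (simp only:, intro computable_intros assms)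
qed

lemma computable_concat [computable_intros]:
  assumes "computable f"
  shows "computable (\<lambda>x. concat (f x))"
  unfolding concat_conv_foldr by (intro computable_intros assms)

lemma computable_length [computable_intros]:
  assumes "computable f"
  shows "computable (\<lambda>x. length (f x))"
proof -
  have "length xs = foldr (\<lambda>_. Suc) xs 0" for xs :: "'b list"
    by (induction xs) auto
  then show ?thesis by (simp only:, intro computable_intros assms)
qed

lemma computable_list_ex [computable_intros]:
  assumes "computable (\<lambda>p. g (fst p) (snd p))" "computable l"
  shows "computable (\<lambda>x. list_ex (g x) (l x))"
proof -
  have "list_ex P xs = foldr (\<lambda>y b. P y \<or> b) xs False" for P :: "'b \<Rightarrow> bool" and xs
    by (induction xs) auto
  then show ?thesis
    by (simp only:, intro computable_intros computable_comp2[OF assms(1)] assms(2))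
qed

lemma computable_list_all [computable_intros]:
  assumes "computable (\<lambda>p. g (fst p) (snd p))" "computable l"
  shows "computable (\<lambda>x. list_all (g x) (l x))"
proof -
  have "list_all P xs = (\<not> list_ex (\<lambda>y. \<not> P y) xs)" for P :: "'b \<Rightarrow> bool" and xs
    by (induction xs) auto
  then show ?thesis
    by (simp only:, intro computable_intros computable_comp2[OF assms(1)] assms(2))
qed

lemma computable_upt [computable_intros]:
  assumes "computable f"
  shows "computable (\<lambda>x. [0..<f x])"
proof -
  have "[0..<n] = rec_nat [] (\<lambda>k r. r @ [k]) n" for n
    by (induction n) auto
  then show ?thesis by (simp only:, intro computable_intros assms)
qed

lemma computable_funpow [computable_intros]:
  fixes f :: "'a::encodable \<Rightarrow> 'b::encodable" and g :: "'a \<Rightarrow> 'b \<Rightarrow> 'b"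
  assumes "computable (\<lambda>p. g (fst p) (snd p))" "computable f" "computable n"
  shows "computable (\<lambda>x. (g x ^^ n x) (f x))"
proof -
  have eq: "(h ^^ m) y = rec_nat y (\<lambda>_ r. h r) m" for h :: "'b \<Rightarrow> 'b" and m y
    by (induction m) auto
  show ?thesis
    unfolding eq by (intro computable_intros computable_comp2[OF assms(1)] assms(2,3))
qed

lemma computable_rotate [computable_intros]:
  fixes f :: "'a::encodable \<Rightarrow> 'b::encodable list"
  assumes "computable n" "computable f"
  shows "computable (\<lambda>x. rotate (n x) (f x))"
proof -
  have "rotate m xs = ((\<lambda>ys. if ys = [] then [] else tl ys @ [hd ys]) ^^ m) xs"
    for m and xs :: "'b list"
    by (auto simp: rotate_def rotate1_hd_tl intro!: arg_cong[of _ _ "\<lambda>h. (h ^^ m) xs"])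
  then show ?thesis by (simp only:, intro computable_intros assms)
qed

lemma computable_zip [computable_intros]:
  fixes f :: "'a::encodable \<Rightarrow> 'b::encodable list" and g :: "'a \<Rightarrow> 'c::encodable list"
  assumes "computable f" "computable g"
  shows "computable (\<lambda>x. zip (f x) (g x))"
proof -
  define zs where "zs xs ys = foldl (\<lambda>p x. if snd p = [] then p else ((x, hd (snd p)) # fst p, tl (snd p)))
    ([], ys) xs" for xs :: "'b list" and ys :: "'c list"
  have "fst (foldl (\<lambda>p (x :: 'b). if snd p = [] then p else ((x, hd (snd p)) # fst p, tl (snd p))) (as, ys) xs)
      = rev (zip xs ys) @ as" for as xs and ys :: "'c list"
  proof (induction xs arbitrary: as ys)
    case (Cons x xs)
    then show ?case by (cases ys) auto
  qed simp
  then have "zip xs ys = rev (fst (zs xs ys))" for xs ys by (simp add: zs_def)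
  then show ?thesis unfolding zs_def by (simp only:, intro computable_intros assms)
qed

section \<open>Rewriting modulo an equivalence\<close>

text \<open>Confluence modulo an equivalence in the manner of Huet. Coherence is required for single
  \<open>S\<close>-steps only; this is enough because \<open>m\<close> drops along \<open>R\<close>
  and is constant along \<open>S\<close>.\<close>

locale rewriting_modulo =
  fixes R S :: "'a \<Rightarrow> 'a \<Rightarrow> bool" and m :: "'a \<Rightarrow> nat"
  assumes decreasing: "R u v \<Longrightarrow> m v < m u"
    and S_measure: "S u v \<Longrightarrow> m u = m v"
    and S_sym: "S u v \<Longrightarrow> S v u"
    and local_confluence:
      "R u v \<Longrightarrow> R u w \<Longrightarrow> \<exists>v' w'. R\<^sup>*\<^sup>* v v' \<and> S\<^sup>*\<^sup>* v' w' \<and> R\<^sup>*\<^sup>* w w'"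
    and local_coherence:
      "R u v \<Longrightarrow> S u w \<Longrightarrow> \<exists>v' w'. R\<^sup>*\<^sup>* v v' \<and> S\<^sup>*\<^sup>* v' w' \<and> R\<^sup>*\<^sup>* w w'"
begin

definition normal :: "'a \<Rightarrow> bool" where
  "normal u \<longleftrightarrow> (\<nexists>v. R u v)"

lemma rtranclp_R_measure: "R\<^sup>*\<^sup>* u v \<Longrightarrow> m v \<le> m u"
  by (induction rule: rtranclp_induct) (auto dest: decreasing)

lemma rtranclp_S_measure: "S\<^sup>*\<^sup>* u v \<Longrightarrow> m v = m u"
  by (induction rule: rtranclp_induct) (auto dest: S_measure)

lemma rtranclp_S_sym: "S\<^sup>*\<^sup>* u v \<Longrightarrow> S\<^sup>*\<^sup>* v u"
  by (induction rule: rtranclp_induct) (auto intro: converse_rtranclp_into_rtranclp S_sym)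

lemma normal_exists: "\<exists>x. R\<^sup>*\<^sup>* u x \<and> normal x"
proof (induction "m u" arbitrary: u rule: less_induct)
  case less
  show ?case
  proof (cases "normal u")
    case False
    then obtain v where "R u v" by (auto simp: normal_def)
    then show ?thesis using less[of v] decreasing converse_rtranclp_into_rtranclp by metis
  qed auto
qed

lemma normal_rtranclp: "normal u \<Longrightarrow> R\<^sup>*\<^sup>* u v \<Longrightarrow> v = u"
  by (metis converse_rtranclpE normal_def)

text \<open>The element where the two sides meet has smaller measure than \<open>w\<close>, so the
  reduction from \<open>w\<close> cannot be empty. Hence \<open>S\<close> preserves
  reducibility.\<close>

lemma coherence_exits:
  assumes "R u v" "S u w"
  obtains v' w' w1 where "R\<^sup>*\<^sup>* v v'" "S\<^sup>*\<^sup>* v' w'" "R w w1" "R\<^sup>*\<^sup>* w1 w'" "m w' < m u"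
proof -
  obtain v' w' where *: "R\<^sup>*\<^sup>* v v'" "S\<^sup>*\<^sup>* v' w'" "R\<^sup>*\<^sup>* w w'"
    using local_coherence[OF assms] by blast
  have "m w' < m u"
    using rtranclp_R_measure[OF *(1)] rtranclp_S_measure[OF *(2)] decreasing[OF assms(1)] by simp
  then have "w \<noteq> w'" using S_measure[OF assms(2)] by auto
  with *(3) obtain w1 where "R w w1" "R\<^sup>*\<^sup>* w1 w'"
    by (metis converse_rtranclpE)
  with * \<open>m w' < m u\<close> that show thesis by blast
qed

lemma S_normal: "S u w \<Longrightarrow> normal u \<Longrightarrow> normal w"
  unfolding normal_def using coherence_exits S_sym by metis

text \<open>The two claims need each other: closing a peak of \<open>R\<close>-steps leaves an
  \<open>S\<close>-chain of smaller measure, and crossing that chain link by link is the second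
  claim, which in turn uses uniqueness on both sides of a link.\<close>

lemma normal_unique_aux:
  "(\<forall>u x y. m u = n \<longrightarrow> R\<^sup>*\<^sup>* u x \<longrightarrow> normal x \<longrightarrow> R\<^sup>*\<^sup>* u y \<longrightarrow> normal y \<longrightarrow> S\<^sup>*\<^sup>* x y) \<and>
   (\<forall>u w x y. m u = n \<longrightarrow> S u w \<longrightarrow> R\<^sup>*\<^sup>* u x \<longrightarrow> normal x \<longrightarrow> R\<^sup>*\<^sup>* w y \<longrightarrow> normal y \<longrightarrow> S\<^sup>*\<^sup>* x y)"
proof (induction n rule: less_induct)
  case (less n)
  have unique: "S\<^sup>*\<^sup>* x y"
    if "m u < n" "R\<^sup>*\<^sup>* u x" "normal x" "R\<^sup>*\<^sup>* u y" "normal y" for u x y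
    using less that by blast
  \<comment> \<open>An arbitrary normal form is inserted at every intermediate element of the
    chain.\<close>
  have chain: "\<forall>x y. R\<^sup>*\<^sup>* u x \<longrightarrow> normal x \<longrightarrow> R\<^sup>*\<^sup>* w y \<longrightarrow> normal y \<longrightarrow> S\<^sup>*\<^sup>* x y"
    if "S\<^sup>*\<^sup>* u w" "m u < n" for u w
    using that
  proof (induction rule: rtranclp_induct)
    case base
    then show ?case using unique by blast
  next
    case (step v w)
    then have "m v < n" using rtranclp_S_measure by metis
    obtain z where "R\<^sup>*\<^sup>* v z" "normal z" using normal_exists by blast
    moreover have "S\<^sup>*\<^sup>* z y" if "R\<^sup>*\<^sup>* w y" "normal y" for y
      using less[OF \<open>m v < n\<close>] step(2) that \<open>R\<^sup>*\<^sup>* v z\<close> \<open>normal z\<close> by blast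
    ultimately show ?case
      using step.IH step.prems by (meson rtranclp_trans)
  qed
  \<comment> \<open>The normal forms of \<open>v\<close> and \<open>w\<close> are connected through
    normal forms of \<open>v'\<close> and \<open>w'\<close>; all elements involved have measure
    below \<open>n\<close>.\<close>
  have joined: "S\<^sup>*\<^sup>* x y"
    if "R\<^sup>*\<^sup>* v v'" "S\<^sup>*\<^sup>* v' w'" "R\<^sup>*\<^sup>* w w'" "m v < n" "m w < n"
      "R\<^sup>*\<^sup>* v x" "normal x" "R\<^sup>*\<^sup>* w y" "normal y" for v v' w w' x y
  proof -
    obtain x' y' where *: "R\<^sup>*\<^sup>* v' x'" "normal x'" "R\<^sup>*\<^sup>* w' y'" "normal y'"
      using normal_exists by metis
    have "S\<^sup>*\<^sup>* x x'" using unique[of v x x'] that * by (meson rtranclp_trans)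
    moreover have "S\<^sup>*\<^sup>* x' y'"
      using chain[OF that(2)] rtranclp_R_measure[OF that(1)] that(4) * by (meson le_less_trans)
    moreover have "S\<^sup>*\<^sup>* y' y" using unique[of w y' y] that * by (meson rtranclp_trans)
    ultimately show ?thesis by (meson rtranclp_trans)
  qed
  have same: "S\<^sup>*\<^sup>* x y"
    if u: "m u = n" and x: "R\<^sup>*\<^sup>* u x" "normal x" and y: "R\<^sup>*\<^sup>* u y" "normal y" for u x y
  proof (cases "normal u")
    case True
    then show ?thesis using normal_rtranclp x y by blast
  next
    case False
    then have "u \<noteq> x" "u \<noteq> y" using x y by auto
    then obtain v w where *: "R u v" "R\<^sup>*\<^sup>* v x" "R u w" "R\<^sup>*\<^sup>* w y"
      using x(1) y(1) by (metis converse_rtranclpE)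
    then have "m v < n" "m w < n" using decreasing u by auto
    moreover obtain v' w' where "R\<^sup>*\<^sup>* v v'" "S\<^sup>*\<^sup>* v' w'" "R\<^sup>*\<^sup>* w w'"
      using local_confluence[OF *(1,3)] by blast
    ultimately show ?thesis using joined * x y by blast
  qed
  have "S\<^sup>*\<^sup>* x y"
    if u: "m u = n" "S u w" and x: "R\<^sup>*\<^sup>* u x" "normal x" and y: "R\<^sup>*\<^sup>* w y" "normal y" for u w x y
  proof (cases "normal u")
    case True
    then show ?thesis using normal_rtranclp S_normal u x y by blast
  next
    case False
    then have "u \<noteq> x" using x by auto
    then obtain v where v: "R u v" "R\<^sup>*\<^sup>* v x"
      using x(1) by (metis converse_rtranclpE)
    obtain v' w' w1 where *: "R\<^sup>*\<^sup>* v v'" "S\<^sup>*\<^sup>* v' w'" "R w w1" "R\<^sup>*\<^sup>* w1 w'" "m w' < m u"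
      using coherence_exits[OF v(1) u(2)] .
    obtain z where z: "R\<^sup>*\<^sup>* w' z" "normal z" using normal_exists by blast
    have "S\<^sup>*\<^sup>* x z"
      using joined[OF *(1,2) rtranclp.rtrancl_refl _ _ v(2) x(2) z] decreasing[OF v(1)] *(5) u(1)
      by simp
    moreover have "R\<^sup>*\<^sup>* w z"
      using * z by (meson converse_rtranclp_into_rtranclp rtranclp_trans)
    \<comment> \<open>\<open>w\<close> has measure \<open>n\<close> itself, so the induction
      hypothesis does not reach it; \<open>same\<close> was proved beforehand for this
      purpose.\<close>
    then have "S\<^sup>*\<^sup>* z y"
      using same[of w z y] u y z S_measure[OF u(2)] by simp
    ultimately show ?thesis by (rule rtranclp_trans)
  qed
  with same show ?case by blast
qed

theorem church_rosser_modulo: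
  assumes "equivclp (\<lambda>u v. R u v \<or> S u v) u v" "normal u" "normal v"
  shows "S\<^sup>*\<^sup>* u v"
proof -
  have unique: "S\<^sup>*\<^sup>* x y" if "R\<^sup>*\<^sup>* u x" "normal x" "R\<^sup>*\<^sup>* u y" "normal y" for u x y
    using normal_unique_aux[of "m u"] that by blast
  have S: "S\<^sup>*\<^sup>* x y" if "S u w" "R\<^sup>*\<^sup>* u x" "normal x" "R\<^sup>*\<^sup>* w y" "normal y" for u w x y
    using normal_unique_aux[of "m u"] that by blast
  have R: "S\<^sup>*\<^sup>* x y" if "R u w" "R\<^sup>*\<^sup>* u x" "normal x" "R\<^sup>*\<^sup>* w y" "normal y" for u w x y
    using unique[of u x y] that by (meson converse_rtranclp_into_rtranclp)
  have "\<forall>x y. R\<^sup>*\<^sup>* u x \<longrightarrow> normal x \<longrightarrow> R\<^sup>*\<^sup>* v y \<longrightarrow> normal y \<longrightarrow> S\<^sup>*\<^sup>* x y"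
    using assms(1)
  proof (induction rule: equivclp_induct)
    case base
    then show ?case using unique by blast
  next
    case (step v w)
    have "S\<^sup>*\<^sup>* x y" if "R\<^sup>*\<^sup>* v x" "normal x" "R\<^sup>*\<^sup>* w y" "normal y" for x y
      using step(2) R S that rtranclp_S_sym by blast
    moreover obtain z where "R\<^sup>*\<^sup>* v z" "normal z" using normal_exists by blast
    ultimately show ?case using step by (meson rtranclp_trans)
  qed
  then show ?thesis using assms by blast
qed

end

section \<open>Cyclic words over two groups glued along a common subgroup\<close>

text \<open>Multiplication is only meaningful for two elements of the same group \<open>X s\<close>.\<close>

locale glued_groups =
  fixes X :: "bool \<Rightarrow> 'x set"
    and mul :: "'x \<Rightarrow> 'x \<Rightarrow> 'x" (infixl "\<cdot>" 70)
    and e :: 'x and iv :: "'x \<Rightarrow> 'x"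
  assumes e_closed [simp]: "e \<in> X s"
    and mul_closed [simp]: "x \<in> X s \<Longrightarrow> y \<in> X s \<Longrightarrow> x \<cdot> y \<in> X s"
    and iv_closed [simp]: "x \<in> X s \<Longrightarrow> iv x \<in> X s"
    and assoc: "x \<in> X s \<Longrightarrow> y \<in> X s \<Longrightarrow> z \<in> X s \<Longrightarrow> x \<cdot> y \<cdot> z = x \<cdot> (y \<cdot> z)"
    and e_left: "x \<in> X s \<Longrightarrow> e \<cdot> x = x"
    and e_right: "x \<in> X s \<Longrightarrow> x \<cdot> e = x"
    and iv_left: "x \<in> X s \<Longrightarrow> iv x \<cdot> x = e"
    and iv_right: "x \<in> X s \<Longrightarrow> x \<cdot> iv x = e"
begin

lemma iv_left_cancel: "x \<in> X s \<Longrightarrow> y \<in> X s \<Longrightarrow> iv x \<cdot> (x \<cdot> y) = y"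
  by (metis assoc e_left iv_closed iv_left)

lemma iv_right_cancel: "x \<in> X s \<Longrightarrow> y \<in> X s \<Longrightarrow> x \<cdot> (iv x \<cdot> y) = y"
  by (metis assoc e_left iv_closed iv_right)

lemma iv_iv: "x \<in> X s \<Longrightarrow> iv (iv x) = x"
  using iv_left_cancel[of "iv x" s x] by (simp add: iv_left e_right[of _ s])

text \<open>The rotation lets the redex sit anywhere, also across the seam of the cyclic word. The
  result is not rotated back, as words count only up to \<open>slide\<close>, which includes
  rotations.\<close>

inductive merge :: "'x list \<Rightarrow> 'x list \<Rightarrow> bool" where
  "rotate n us = x # y # r \<Longrightarrow> x \<in> X s \<Longrightarrow> y \<in> X s \<Longrightarrow> merge us (x \<cdot> y # r)"

text \<open>Acting at the front suffices, because rotations bring any pair there. The case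
  \<open>s = t\<close> is deliberately allowed, so \<open>d\<close> need not lie in both groups when
  the neighbours share one. A single syllable has no neighbour and is conjugated instead.\<close>

inductive slide :: "'x list \<Rightarrow> 'x list \<Rightarrow> bool" where
  rotate: "slide us (rotate n us)"
| slide: "x \<in> X s \<Longrightarrow> d \<in> X s \<Longrightarrow> d \<in> X t \<Longrightarrow> y \<in> X t
    \<Longrightarrow> slide (x # y # r) (x \<cdot> d # iv d \<cdot> y # r)"
| conj: "x \<in> X s \<Longrightarrow> d \<in> X s \<Longrightarrow> slide [x] [iv d \<cdot> x \<cdot> d]"

lemma merge_length: "merge us vs \<Longrightarrow> length vs < length us"
proof (induction rule: merge.induct)
  case (1 n us x y r s)
  then have "length us = Suc (Suc (length r))" by (metis length_Cons length_rotate)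
  then show ?case by simp
qed

lemma slide_length: "slide us vs \<Longrightarrow> length us = length vs"
  by (induction rule: slide.induct) auto

lemma rotate_back: "\<exists>k. rotate k (rotate n us) = us"
proof -
  have "rotate (length us - n mod length us) (rotate n us) = us" if "us \<noteq> []"
  proof -
    have "n mod length us < length us" using that by simp
    then have "length us - n mod length us + n = length us * Suc (n div length us)"
      using mult_div_mod_eq[of "length us" n] by (simp only: mult_Suc_right)
    then show ?thesis by (simp add: rotate_rotate rotate_id)
  qed
  then show ?thesis by (cases "us = []") auto
qed

lemma slide_sym: "slide us vs \<Longrightarrow> slide vs us"
proof (induction rule: slide.induct)
  case (slide x s d t y r)
  then show ?case
    using slide.slide[of "x \<cdot> d" s "iv d" t "iv d \<cdot> y" r]
    by (simp add: assoc[of x s] iv_right e_right iv_iv[of d t] iv_right_cancel[of d t])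
next
  case (conj x s d)
  then have "iv (iv d) \<cdot> (iv d \<cdot> x \<cdot> d) \<cdot> iv d = x"
    by (simp add: assoc[of _ s] iv_iv[of d s] iv_right_cancel[of d s] iv_right e_right)
  with conj show ?case using slide.conj[of "iv d \<cdot> x \<cdot> d" s "iv d"] by simp
next
  case (rotate us n)
  then show ?case using rotate_back[of n us] slide.rotate[of "rotate n us"] by metis
qed

lemma merge_rotate: "merge us vs \<Longrightarrow> merge (rotate k us) vs"
proof (induction rule: merge.induct)
  case (1 n us x y r s)
  obtain k' where "rotate k' (rotate k us) = us" using rotate_back by blast
  then have "rotate (n + k') (rotate k us) = x # y # r" using 1 by (simp flip: rotate_rotate)
  with 1(2,3) show ?case by (intro merge.intros)
qed

lemma merge_append_comm: "merge (q @ p) vs \<Longrightarrow> merge (p @ q) vs"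
  using merge_rotate[of "q @ p" vs "length q"] by (simp add: rotate_append)

lemma slide_append_comm: "slide (p @ q) (q @ p)"
  using slide.rotate[of "p @ q" "length p"] by (simp add: rotate_append)

lemma mergeI: "x \<in> X s \<Longrightarrow> y \<in> X s \<Longrightarrow> merge (p @ x # y # r) (x \<cdot> y # r @ p)"
  using merge.intros[of "length p" "p @ x # y # r" x y "r @ p" s] by (simp add: rotate_append)

lemma mergeE:
  assumes "merge us vs"
  obtains p q x y r s where "us = p @ q" "q @ p = x # y # r" "x \<in> X s" "y \<in> X s" "vs = x \<cdot> y # r"
  using assms
proof cases
  case (1 n x y r s)
  then show ?thesis
    using that[of "take (n mod length us) us" "drop (n mod length us) us"]
    by (metis append_take_drop_id rotate_drop_take)
qed

section \<open>Local confluence and coherence of merging modulo slides\<close>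

definition joinable :: "'x list \<Rightarrow> 'x list \<Rightarrow> bool" where
  "joinable v w \<longleftrightarrow> (\<exists>v' w'. merge\<^sup>*\<^sup>* v v' \<and> slide\<^sup>*\<^sup>* v' w' \<and> merge\<^sup>*\<^sup>* w w')"

lemma joinable_refl: "joinable u u"
  by (auto simp: joinable_def)

lemma joinable_slide: "slide\<^sup>*\<^sup>* u v \<Longrightarrow> joinable u v"
  by (auto simp: joinable_def)

lemma joinable_merge2: "joinable u w \<Longrightarrow> merge v w \<Longrightarrow> joinable u v"
  by (auto simp: joinable_def intro: converse_rtranclp_into_rtranclp)

lemma rtranclp_slide_sym: "slide\<^sup>*\<^sup>* u v \<Longrightarrow> slide\<^sup>*\<^sup>* v u"
  by (induction rule: rtranclp_induct) (auto intro: converse_rtranclp_into_rtranclp slide_sym)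

lemma joinable_sym: "joinable u v \<Longrightarrow> joinable v u"
  by (auto simp: joinable_def dest: rtranclp_slide_sym)

lemma joinable_merge1: "joinable v w \<Longrightarrow> merge u v \<Longrightarrow> joinable u w"
  using joinable_merge2 joinable_sym by blast

text \<open>
  The two ways of multiplying out three consecutive elements differ by sliding the middle one.
\<close>

lemma slide_assoc:
  assumes "x \<in> X s" "y \<in> X s" "y \<in> X t" "z \<in> X t"
  shows "slide (x # y \<cdot> z # r) (x \<cdot> y # z # r)"
  using slide.slide[of x s y t "y \<cdot> z" r] assms by (simp add: iv_left_cancel[of y t])

lemma slide_comm: "x \<in> X s \<Longrightarrow> y \<in> X s \<Longrightarrow> slide [x \<cdot> y] [y \<cdot> x]"
  using slide.conj[of "x \<cdot> y" s x] by (simp add: assoc[of _ s] iv_left_cancel[of x s])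

lemma slide_rotate1: "slide (r @ [x]) (x # r)" "slide (x # r) (r @ [x])"
  using slide_append_comm[of r "[x]"] slide_append_comm[of "[x]" r] by simp_all

text \<open>Possible relative positions of two adjacent pairs on a circle, the first pair having
  been rotated to the front. \<open>both\<close> is the overlap at both ends, possible only on a
  circle of two syllables.\<close>

lemma cyclic_redex_cases:
  assumes "us = p @ q" "us = x # y # r" "q @ p = x' # y' # r'"
  obtains (same) "x' = x" "y' = y" "r' = r"
  | (both) "x' = y" "y' = x" "r = []" "r' = []"
  | (right) w where "x' = y" "r = y' # w" "r' = w @ [x]"
  | (left) w where "y' = x" "r = w @ [x']" "r' = y # w"
  | (disjoint) v w where "r = v @ x' # y' # w" "r' = w @ x # y # v"
\<comment> \<open>This rule splits a list by length 0, 1 or at least 2, and thus the offset between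
  the two pairs.\<close>
proof (cases p rule: remdups_adj.cases)
  case 1
  then show ?thesis using assms same by auto
next
  case (2 a)
  then show ?thesis using assms both right by (cases q rule: remdups_adj.cases) auto
next
  case (3 a b v)
  then show ?thesis using assms same left disjoint by (cases q rule: remdups_adj.cases) auto
qed

lemma merge_locally_confluent:
  assumes "merge us vs" "merge us ws"
  shows "joinable vs ws"
proof -
  obtain n x y r s where 1: "rotate n us = x # y # r" "x \<in> X s" "y \<in> X s" "vs = x \<cdot> y # r"
    using assms(1) by cases blast
  obtain p q x' y' r' t where 2: "rotate n us = p @ q" "q @ p = x' # y' # r'"
    "x' \<in> X t" "y' \<in> X t" "ws = x' \<cdot> y' # r'"
    using merge_rotate[OF assms(2), of n] by (rule mergeE)
  show ?thesis
    using 2(1) 1(1) 2(2)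
  proof (cases rule: cyclic_redex_cases)
    case same
    then show ?thesis using 1 2 by (simp add: joinable_refl)
  next
    case both
    then show ?thesis using 1 2 slide_comm[of x s y] by (auto intro!: joinable_slide)
  next
    case (right w)
    have "slide (x \<cdot> y # y' # w) (x # y \<cdot> y' # w)"
      using slide_sym[OF slide_assoc[of x s y t y' w]] 1 2 right by simp
    then have "slide\<^sup>*\<^sup>* vs ws"
      using slide_rotate1(2)[of x "y \<cdot> y' # w"] 1 2 right
      by (auto intro: converse_rtranclp_into_rtranclp)
    then show ?thesis by (rule joinable_slide)
  next
    case (left w)
    have "slide (x' # x \<cdot> y # w) (x' \<cdot> x # y # w)"
      using slide_assoc[of x' t x s y w] 1 2 left by simp
    then have "slide\<^sup>*\<^sup>* vs ws"
      using slide_rotate1(1)[of "x \<cdot> y # w" x'] 1 2 left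
      by (auto intro: converse_rtranclp_into_rtranclp)
    then show ?thesis by (rule joinable_slide)
  next
    case (disjoint v w)
    have "merge vs (x' \<cdot> y' # w @ x \<cdot> y # v)"
      using mergeI[OF 2(3,4), of "x \<cdot> y # v" w] 1(4) disjoint by simp
    moreover have "merge ws (x \<cdot> y # v @ x' \<cdot> y' # w)"
      using mergeI[OF 1(2,3), of "x' \<cdot> y' # w" v] 2(5) disjoint by simp
    moreover have "joinable (x' \<cdot> y' # w @ x \<cdot> y # v) (x \<cdot> y # v @ x' \<cdot> y' # w)"
      using slide_append_comm[of "x' \<cdot> y' # w" "x \<cdot> y # v"] by (auto intro!: joinable_slide)
    ultimately show ?thesis using joinable_merge1 joinable_merge2 by blast
  qed
qed

lemma merge_slide_front:
  assumes "x \<in> X s" "d \<in> X s" "d \<in> X t" "y \<in> X t" "x \<in> X u" "y \<in> X u"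
  shows "merge (x \<cdot> d # iv d \<cdot> y # r) (x \<cdot> y # r)"
proof -
  \<comment> \<open>Two of the three Booleans \<open>s\<close>, \<open>t\<close>, \<open>u\<close>
    coincide, and each coincidence puts \<open>x\<close>, \<open>d\<close> and \<open>y\<close> into
    one group.\<close>
  have "\<exists>v. x \<in> X v \<and> d \<in> X v \<and> y \<in> X v"
    using assms by (cases "s = t"; cases "s = u"; cases "t = u") auto
  then obtain v where v: "x \<in> X v" "d \<in> X v" "y \<in> X v" by blast
  then have "x \<cdot> d \<cdot> (iv d \<cdot> y) = x \<cdot> y"
    by (simp add: assoc[of _ v] iv_right_cancel[of d v])
  then show ?thesis
    using v mergeI[of "x \<cdot> d" v "iv d \<cdot> y" "[]" r] by simp
qed

lemma merge_slide_coherent: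
  assumes "merge us vs" "slide us ws"
  shows "joinable vs ws"
  using assms(2)
proof cases
  case (rotate n)
  then show ?thesis
    using merge_rotate[OF assms(1), of n] joinable_merge2 joinable_refl by blast
next
  case (conj x s d)
  then show ?thesis using merge_length[OF assms(1)] assms(1) by (auto elim!: mergeE dest: arg_cong[of _ _ length])
next
  case (slide x s d t y r)
  obtain p q x' y' r' u where 2: "us = p @ q" "q @ p = x' # y' # r'"
    "x' \<in> X u" "y' \<in> X u" "vs = x' \<cdot> y' # r'"
    using assms(1) by (rule mergeE)
  show ?thesis
    using 2(1) slide(1) 2(2)
  proof (cases rule: cyclic_redex_cases)
    case same
    then have "merge ws vs" using merge_slide_front[of x s d t y u r] slide 2 by simp
    then show ?thesis using joinable_merge2 joinable_refl by blast
  next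
    case both
    then have "merge ws [x \<cdot> y]" using merge_slide_front[of x s d t y u r] slide 2 by simp
    moreover have "joinable vs [x \<cdot> y]"
      using slide_comm[of y u x] 2 both by (auto intro!: joinable_slide)
    ultimately show ?thesis using joinable_merge2 by blast
  next
    case (right w)
    show ?thesis
    \<comment> \<open>If the redex lies in the group that receives \<open>iv d\<close>, this factor
      is simply carried along. Otherwise \<open>y\<close> belongs to both groups, and merging it to
      the other side undoes the slide.\<close>
    proof (cases "t = u")
      case True
      have "merge ws (iv d \<cdot> (y \<cdot> y') # w @ [x \<cdot> d])"
        using mergeI[of "iv d \<cdot> y" t y' "[x \<cdot> d]" w] slide 2 right True by (simp add: assoc[of _ u])
      moreover have "slide (x # y \<cdot> y' # w) (x \<cdot> d # iv d \<cdot> (y \<cdot> y') # w)"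
        using slide.slide[of x s d t "y \<cdot> y'" w] slide 2 right True by simp
      then have "slide\<^sup>*\<^sup>* vs (iv d \<cdot> (y \<cdot> y') # w @ [x \<cdot> d])"
        using slide_rotate1(1)[of "y \<cdot> y' # w" x] 
          slide_rotate1(2)[of "x \<cdot> d" "iv d \<cdot> (y \<cdot> y') # w"] 2 right
        by (auto intro: converse_rtranclp_into_rtranclp)
      ultimately show ?thesis using joinable_slide joinable_merge2 by blast
    next
      case False
      then have y: "y \<in> X v" for v using slide 2 right by (cases "v = t"; cases "v = u") auto
      have "merge ws (x \<cdot> y # y' # w)"
        using merge_slide_front[of x s d t y s "y' # w"] slide right y by simp
      moreover have "slide (x # y \<cdot> y' # w) (x \<cdot> y # y' # w)"
        using slide_assoc[of x s y u y' w] slide 2 y by simp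
      then have "slide\<^sup>*\<^sup>* vs (x \<cdot> y # y' # w)"
        using slide_rotate1(1)[of "y \<cdot> y' # w" x] 2 right
        by (auto intro: converse_rtranclp_into_rtranclp)
      ultimately show ?thesis using joinable_slide joinable_merge2 by blast
    qed
  next
    case (left w)
    show ?thesis
    proof (cases "s = u")
      case True
      have "merge ws (x' \<cdot> x \<cdot> d # iv d \<cdot> y # w)"
        using mergeI[of x' s "x \<cdot> d" "[]" "iv d \<cdot> y # w"]
          merge_append_comm[of "[x']" "x \<cdot> d # iv d \<cdot> y # w"] slide 2 left True
        by (simp add: assoc[of _ u])
      moreover have "slide vs (x' \<cdot> x \<cdot> d # iv d \<cdot> y # w)"
        using slide.slide[of "x' \<cdot> x" s d t y w] slide 2 left True by simp
      ultimately show ?thesis using joinable_slide joinable_merge2 by blast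
    next
      case False
      then have x: "x \<in> X v" for v using slide 2 left by (cases "v = s"; cases "v = u") auto
      have "merge ws (x \<cdot> y # w @ [x'])"
        using merge_slide_front[of x s d t y t "w @ [x']"] slide left x by simp
      moreover have "slide (x' \<cdot> x # y # w) (x' # x \<cdot> y # w)"
        using slide_sym[OF slide_assoc[of x' u x t y w]] slide 2 left x by simp
      then have "slide\<^sup>*\<^sup>* vs (x \<cdot> y # w @ [x'])"
        using slide_rotate1(2)[of x' "x \<cdot> y # w"] 2 left
        by (auto intro: converse_rtranclp_into_rtranclp)
      ultimately show ?thesis using joinable_slide joinable_merge2 by blast
    qed
  next
    case (disjoint v w)
    have "merge ws (x' \<cdot> y' # w @ x \<cdot> d # iv d \<cdot> y # v)"
      using mergeI[OF 2(3,4), of "x \<cdot> d # iv d \<cdot> y # v" w] slide disjoint by simp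
    moreover have "slide (x # y # v @ x' \<cdot> y' # w) (x \<cdot> d # iv d \<cdot> y # v @ x' \<cdot> y' # w)"
      using slide.slide[of x s d t y "v @ x' \<cdot> y' # w"] slide by simp
    then have "slide\<^sup>*\<^sup>* vs (x' \<cdot> y' # w @ x \<cdot> d # iv d \<cdot> y # v)"
      using slide_append_comm[of "x' \<cdot> y' # w" "x # y # v"]
        slide_append_comm[of "x \<cdot> d # iv d \<cdot> y # v" "x' \<cdot> y' # w"] 2 disjoint
      by (auto intro: converse_rtranclp_into_rtranclp)
    ultimately show ?thesis using joinable_slide joinable_merge2 by blast
  qed
qed

sublocale rewriting_modulo merge slide length
  using merge_length slide_length slide_sym merge_locally_confluent merge_slide_coherent
  by unfold_locales (auto simp: joinable_def)

end

text \<open>\<open>c\<close> enumerates the powers of the identified generator and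
  \<open>\<phi> s\<close> is the exponent sum in factor \<open>s\<close>. \<open>E\<close> depends
  on the factor, since the two generators may have different exponent sums.\<close>

locale cyclic_gluing = glued_groups X mul e iv
  for X :: "bool \<Rightarrow> 'x set" and mul (infixl "\<cdot>" 70) and e and iv +
  fixes c :: "int \<Rightarrow> 'x" and \<phi> :: "bool \<Rightarrow> 'x \<Rightarrow> int" and E :: "bool \<Rightarrow> int"
  assumes common: "X True \<inter> X False = range c"
    and c_0: "c 0 = e"
    and c_add: "c (j + k) = c j \<cdot> c k"
    and \<phi>_mul: "x \<in> X s \<Longrightarrow> y \<in> X s \<Longrightarrow> \<phi> s (x \<cdot> y) = \<phi> s x + \<phi> s y"
    and \<phi>_c: "\<phi> s (c k) = k * E s"
    and E_nonzero: "E s \<noteq> 0"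
begin

lemma c_closed [simp]: "c k \<in> X s"
  using common by (cases s) auto

lemma iv_c: "iv (c k) = c (- k)"
proof -
  have "c k \<cdot> c (- k) = e" by (simp add: c_0 flip: c_add)
  then have "iv (c k) \<cdot> e = c (- k)"
    using iv_left_cancel[of "c k" True "c (- k)"] by simp
  then show ?thesis by (simp add: e_right[of _ True])
qed

lemma common_elem: "x \<in> X s \<Longrightarrow> x \<in> X t \<Longrightarrow> s \<noteq> t \<Longrightarrow> \<exists>k. x = c k"
  using common by (cases s; cases t) auto

text \<open>Every power inserted to the right of one syllable is cancelled on the left of the next,
  so the product changes only by \<open>c k\<close> in front and \<open>c (- l)\<close> at the end.
  For \<open>k = l\<close> this is a conjugation, and the chain closes up to a circle.\<close>

fun twisted :: "int \<Rightarrow> 'x list \<Rightarrow> 'x list \<Rightarrow> int \<Rightarrow> bool" where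
  "twisted k [] [] l \<longleftrightarrow> k = l"
| "twisted k (p # ps) (q # qs) l \<longleftrightarrow>
    (\<exists>m s. p \<in> X s \<and> q = c k \<cdot> p \<cdot> c (- m) \<and> twisted m ps qs l)"
| "twisted k _ _ l \<longleftrightarrow> False"

lemma twisted_refl: "(\<And>x. x \<in> set us \<Longrightarrow> \<exists>s. x \<in> X s) \<Longrightarrow> twisted 0 us us 0"
proof (induction us)
  case (Cons x us)
  then obtain s where "x \<in> X s" by force
  then have "\<exists>s. x \<in> X s \<and> x = c 0 \<cdot> x \<cdot> c (- 0)"
    by (auto simp: c_0 e_left[of _ s] e_right[of _ s])
  then show ?case using Cons by (auto intro: exI[of _ 0])
qed simp

lemma twisted_length: "twisted k us vs l \<Longrightarrow> length us = length vs"
  by (induction k us vs l rule: twisted.induct) auto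

lemma twisted_append:
  "twisted k us vs m \<Longrightarrow> twisted m us' vs' l \<Longrightarrow> twisted k (us @ us') (vs @ vs') l"
  by (induction k us vs m rule: twisted.induct) auto

lemma twisted_rotate:
  assumes "twisted k us vs k"
  shows "\<exists>l. twisted l (rotate n us) (rotate n vs) l"
proof (induction n)
  case (Suc n)
  then obtain l where l: "twisted l (rotate n us) (rotate n vs) l" by blast
  show ?case
  proof (cases "rotate n us")
    case Nil
    then show ?thesis using l twisted_length[OF l] by auto
  next
    case (Cons p ps)
    moreover from this obtain q qs where "rotate n vs = q # qs"
      using twisted_length[OF l] by (cases "rotate n vs") auto
    moreover from calculation l obtain m s where
      "p \<in> X s" "q = c l \<cdot> p \<cdot> c (- m)" "twisted m ps qs l" by auto
    then have "twisted m (ps @ [p]) (qs @ [q]) m"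
      by (intro twisted_append) auto
    ultimately show ?thesis by auto
  qed
qed (use assms in auto)

text \<open>Slides of a cyclic word without redexes only move elements of the common subgroup.\<close>

lemma slides_twisted:
  assumes "slide\<^sup>*\<^sup>* us vs" "normal us" "length us \<ge> 2" "\<And>x. x \<in> set us \<Longrightarrow> \<exists>s. x \<in> X s"
  shows "normal vs \<and> (\<exists>n k. twisted k (rotate n us) vs k)"
  using assms(1)
proof (induction rule: rtranclp_induct)
  case base
  then show ?case using assms twisted_refl[of us] by (auto intro!: exI[of _ 0])
next
  case (step vs ws)
  then have "normal ws" using S_normal by blast
  from step obtain n k where tw: "twisted k (rotate n us) vs k" and "normal vs" by blast
  from step(2) have "\<exists>n k. twisted k (rotate n us) ws k"
  proof cases
    case (rotate j)
    then show ?thesis using twisted_rotate[OF tw, of j] by (metis rotate_rotate)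
  next
    case (slide x s d t y r)
    \<comment> \<open>Two neighbours in the same group would be a redex; hence the slid element lies
      in both groups and is a power.\<close>
    have "s \<noteq> t"
    proof
      assume "s = t"
      then have "merge vs (x \<cdot> y # r)" using mergeI[of x s y "[]" r] slide by simp
      with \<open>normal vs\<close> show False by (simp add: normal_def)
    qed
    then obtain j where d: "d = c j" using common_elem slide by blast
    obtain p q ps where us: "rotate n us = p # q # ps"
      using twisted_length[OF tw] unfolding slide(1) by (auto simp: length_Suc_conv simp del: length_rotate)
    with tw slide obtain l m s' t' where
      *: "p \<in> X s'" "x = c k \<cdot> p \<cdot> c (- l)" "q \<in> X t'" "y = c l \<cdot> q \<cdot> c (- m)" "twisted m ps r k"
      by auto
    \<comment> \<open>Sliding \<open>c j\<close> changes just the exponent between the two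
      syllables, from \<open>l\<close> to \<open>l - j\<close>.\<close>
    have "x \<cdot> d = c k \<cdot> p \<cdot> c (- (l - j))"
      using *(1) assoc[of "c k \<cdot> p" s' "c (- l)" "c j"] by (simp add: *(2) d flip: c_add)
    moreover have "iv d \<cdot> y = c (l - j) \<cdot> q \<cdot> c (- m)"
      using *(3) by (simp add: *(4) d iv_c assoc[of _ t', symmetric] flip: c_add)
    ultimately have "twisted k (rotate n us) ws k"
      unfolding us slide(2) twisted.simps using *(1,3,5) by blast
    then show ?thesis by blast
  next
    case (conj x s d)
    then show ?thesis using twisted_length[OF tw] assms(3) by simp
  qed
  with \<open>normal ws\<close> show ?case by blast
qed

section \<open>Cyclic words of one syllable\<close>

definition conj_by :: "bool \<Rightarrow> 'x \<Rightarrow> 'x \<Rightarrow> bool" where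
  "conj_by s x y \<longleftrightarrow> x \<in> X s \<and> (\<exists>d\<in>X s. y = iv d \<cdot> x \<cdot> d)"

lemma conj_by_closed: "conj_by s x y \<Longrightarrow> x \<in> X s \<and> y \<in> X s"
  by (auto simp: conj_by_def)

lemma conj_by_refl: "x \<in> X s \<Longrightarrow> conj_by s x x"
  by (auto simp: conj_by_def e_right[of _ s] iv_left_cancel[of e s x] assoc[of _ s] intro!: bexI[of _ e])
    (metis e_closed e_left iv_left_cancel)

lemma conj_by_sym:
  assumes "conj_by s x y"
  shows "conj_by s y x"
proof -
  obtain d where d: "x \<in> X s" "d \<in> X s" "y = iv d \<cdot> x \<cdot> d"
    using assms by (auto simp: conj_by_def)
  then have "x = iv (iv d) \<cdot> y \<cdot> iv d"
    by (simp add: assoc[of _ s] iv_iv[of _ s] iv_right_cancel[of _ s] iv_right[of _ s] e_right[of _ s])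
  then show ?thesis using d unfolding conj_by_def by (intro conjI bexI[of _ "iv d"]) simp_all
qed

lemma iv_mul: "x \<in> X s \<Longrightarrow> y \<in> X s \<Longrightarrow> iv (x \<cdot> y) = iv y \<cdot> iv x"
proof -
  assume xy: "x \<in> X s" "y \<in> X s"
  then have "x \<cdot> y \<cdot> (iv y \<cdot> iv x) = e"
    by (simp add: assoc[of _ s] iv_right_cancel[of y s] iv_right[of x s])
  then have "iv (x \<cdot> y) \<cdot> e = iv y \<cdot> iv x"
    using xy iv_left_cancel[of "x \<cdot> y" s "iv y \<cdot> iv x"] by simp
  then show ?thesis using xy by (simp add: e_right[of _ s])
qed

lemma conj_by_trans:
  assumes "conj_by s x y" "conj_by s y z"
  shows "conj_by s x z"
proof -
  obtain d f where d: "x \<in> X s" "d \<in> X s" "y = iv d \<cdot> x \<cdot> d" and f: "f \<in> X s" "z = iv f \<cdot> y \<cdot> f"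
    using assms by (auto simp: conj_by_def)
  then have "z = iv (d \<cdot> f) \<cdot> x \<cdot> (d \<cdot> f)"
    by (simp add: assoc[of _ s] iv_mul[of _ s])
  then show ?thesis using d f unfolding conj_by_def by (intro conjI bexI[of _ "d \<cdot> f"]) simp_all
qed

lemma \<phi>_conj: "conj_by s x y \<Longrightarrow> \<phi> s x = \<phi> s y"
proof -
  assume "conj_by s x y"
  then obtain d where d: "x \<in> X s" "d \<in> X s" "y = iv d \<cdot> x \<cdot> d" by (auto simp: conj_by_def)
  then have "d \<cdot> y = x \<cdot> d"
    by (simp add: assoc[of _ s] iv_right_cancel[of d s])
  moreover have "y \<in> X s" using d by simp
  ultimately show ?thesis using \<phi>_mul[of d s y] \<phi>_mul[of x s d] d by simp
qed

lemma conj_by_c: "conj_by s (c j) (c k) \<Longrightarrow> j = k"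
  using \<phi>_conj[of s "c j" "c k"] E_nonzero by (simp add: \<phi>_c)

text \<open>
  Conjugates in one group of an element of the common subgroup that lie in the other group
  are equal to it, since \<open>\<phi>\<close> is injective on that subgroup.
\<close>

lemma slides_singleton:
  assumes "slide\<^sup>*\<^sup>* us vs" "us = [x]" "x \<in> X s"
  shows "\<exists>y. vs = [y] \<and> ((\<exists>s. conj_by s x y) \<or> (\<exists>k s t. conj_by s x (c k) \<and> conj_by t y (c k)))"
  using assms(1)
proof (induction rule: rtranclp_induct)
  case base
  then show ?case using assms conj_by_refl by auto
next
  case (step vs ws)
  then obtain y where vs: "vs = [y]" and
    y: "(\<exists>s. conj_by s x y) \<or> (\<exists>k s t. conj_by s x (c k) \<and> conj_by t y (c k))" by blast
  from step(2) obtain z where ws: "ws = [z]" and z: "z = y \<or> (\<exists>t. conj_by t y z)"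
    by cases (auto simp: vs conj_by_def)
  show ?case
  proof (cases "z = y")
    case False
    with z obtain t where t: "conj_by t y z" by blast
    from y show ?thesis
    proof
      assume "\<exists>s. conj_by s x y"
      then obtain s where s: "conj_by s x y" by blast
      show ?thesis
      proof (cases "s = t")
        case True
        then show ?thesis using ws conj_by_trans s t by blast
      next
        case False
        then obtain k where "y = c k" using s t conj_by_closed common_elem by metis
        then show ?thesis using ws conj_by_sym s t by blast
      qed
    next
      assume "\<exists>k s t. conj_by s x (c k) \<and> conj_by t y (c k)"
      then obtain k s t' where k: "conj_by s x (c k)" "conj_by t' y (c k)" by blast
      show ?thesis
      proof (cases "t' = t")
        case True
        then show ?thesis using ws conj_by_trans conj_by_sym k t by blast
      next
        case False
        then obtain l where "y = c l" using k t conj_by_closed common_elem by metis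
        then have "y = c k" using k(2) conj_by_c by blast
        then show ?thesis using ws conj_by_sym k t by blast
      qed
    qed
  qed (use y ws in auto)
qed

end

section \<open>Words in the factors and in the amalgam\<close>

lemma exp_sum_inv_word: "exp_sum (inv_word w) = - exp_sum w"
  by (induction w) (auto simp: inv_word_def)

lemma inv_word_append: "inv_word (u @ v) = inv_word v @ inv_word u"
  by (simp add: inv_word_def)

lemma inv_word_inv_word: "inv_word (inv_word w) = w"
  by (induction w) (auto simp: inv_word_def)

lemma word_eq_inv_word_right: "w \<in> words P \<Longrightarrow> word_eq P (w @ inv_word w) []"
  using word_eq_inv_word[of "inv_word w" P] by (simp add: inv_word_inv_word)

lemma word_eq_in_words: "wf_presentation P \<Longrightarrow> word_eq P u v \<Longrightarrow> u \<in> words P"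
  "wf_presentation P \<Longrightarrow> word_eq P u v \<Longrightarrow> v \<in> words P"
  using word_eq_words by auto

lemma elt_carrier: "w \<in> words P \<Longrightarrow> elt P w \<in> carrier (presented_group P)"
  by (simp add: presented_group_def)

lemma elt_inv_word:
  assumes "wf_presentation P" "w \<in> words P"
  shows "elt P (inv_word w) = inv\<^bsub>presented_group P\<^esub> elt P w"
proof -
  interpret group "presented_group P" by (rule group_presented_group[OF assms(1)])
  have "elt P (inv_word w) \<otimes>\<^bsub>presented_group P\<^esub> elt P w = elt P []"
    using assms by (simp add: mult_elt elt_eq_iff word_eq_inv_word)
  also have "\<dots> = \<one>\<^bsub>presented_group P\<^esub>"
    by (simp add: presented_group_def)
  finally show ?thesis using assms by (intro inv_equality[symmetric]) (auto simp: elt_carrier)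
qed

text \<open>Built from \<open>map\<close>, \<open>concat\<close> and \<open>upt\<close> so that the
  computability rules apply to the definition as it stands. \<open>nat k + nat (- k)\<close> is the
  absolute value of \<open>k\<close>.\<close>

definition word_pow :: "word \<Rightarrow> int \<Rightarrow> word" where
  "word_pow w k = concat (map (\<lambda>_. if k < 0 then inv_word w else w) [0..<nat k + nat (- k)])"

lemma word_pow_replicate:
  "word_pow w k = concat (replicate (nat \<bar>k\<bar>) (if k < 0 then inv_word w else w))"
  unfolding word_pow_def map_replicate_const by (auto simp: abs_if)

lemma exp_sum_concat_replicate: "exp_sum (concat (replicate n w)) = int n * exp_sum w"
  by (induction n) (auto simp: algebra_simps)

lemma exp_sum_word_pow: "exp_sum (word_pow w k) = k * exp_sum w"
  by (auto simp: word_pow_replicate exp_sum_concat_replicate exp_sum_inv_word)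

lemma concat_replicate_in_words: "w \<in> words P \<Longrightarrow> concat (replicate n w) \<in> words P"
  by (induction n) auto

lemma word_pow_in_words: "w \<in> words P \<Longrightarrow> word_pow w k \<in> words P"
  by (simp add: word_pow_replicate concat_replicate_in_words)

lemma elt_concat_replicate:
  assumes "wf_presentation P" "w \<in> words P"
  shows "elt P (concat (replicate n w)) = elt P w [^]\<^bsub>presented_group P\<^esub> n"
proof -
  interpret group "presented_group P" by (rule group_presented_group[OF assms(1)])
  show ?thesis
  proof (induction n)
    case 0
    then show ?case by (simp add: presented_group_def)
  next
    case (Suc n)
    then show ?case
      unfolding nat_pow_Suc2[OF elt_carrier[OF assms(2)]]
      using mult_elt[OF assms concat_replicate_in_words[OF assms(2), of n]] by simp
  qed
qed

lemma elt_word_pow: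
  assumes "wf_presentation P" "w \<in> words P"
  shows "elt P (word_pow w k) = elt P w [^]\<^bsub>presented_group P\<^esub> k"
proof -
  interpret group "presented_group P" by (rule group_presented_group[OF assms(1)])
  show ?thesis
  proof (cases "k < 0")
    case True
    then have "elt P (word_pow w k) = elt P (concat (replicate (nat (- k)) (inv_word w)))"
      by (simp add: word_pow_replicate)
    also have "\<dots> = inv\<^bsub>presented_group P\<^esub> (elt P w [^]\<^bsub>presented_group P\<^esub> nat (- k))"
      using assms by (simp only: elt_concat_replicate elt_inv_word nat_pow_inv elt_carrier inv_word_in_words)
    finally show ?thesis using True by (simp only: int_pow_def2 if_True)
  next
    case False
    then have "word_pow w k = concat (replicate (nat k) w)"
      by (simp add: word_pow_replicate)
    then show ?thesis
      using False by (simp only: int_pow_def2 if_False elt_concat_replicate[OF assms])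
  qed
qed

lemma word_pow_add:
  assumes "wf_presentation P" "w \<in> words P"
  shows "word_eq P (word_pow w (j + k)) (word_pow w j @ word_pow w k)"
proof -
  interpret group "presented_group P" by (rule group_presented_group[OF assms(1)])
  have "elt P (word_pow w (j + k)) = elt P (word_pow w j @ word_pow w k)"
    using assms by (simp add: elt_word_pow int_pow_mult elt_carrier word_pow_in_words
        flip: mult_elt)
  then show ?thesis using assms by (simp add: elt_eq_iff word_pow_in_words)
qed

lemma word_eq_cong_inv:
  assumes "wf_presentation P" "word_eq P u v"
  shows "word_eq P (inv_word u) (inv_word v)"
  using elt_inv_word[OF assms(1)] assms word_eq_in_words[OF assms]
  by (metis elt_eq_iff inv_word_in_words)

lemma conj_exponents_iff:
  assumes "wf_presentation P" "h \<in> words P" "u \<in> words P" "v \<in> words P"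
  shows "k \<in> conj_exponents (presented_group P) (elt P h) (elt P u) (elt P v) \<longleftrightarrow>
    word_eq P (word_pow h k @ u @ word_pow h (- k)) v"
  using assms by (simp add: conj_exponents_def mult_elt elt_eq_iff word_pow_in_words flip: elt_word_pow)

definition word_conj :: "presentation \<Rightarrow> word \<Rightarrow> word \<Rightarrow> bool" where
  "word_conj P u v \<longleftrightarrow> (\<exists>g\<in>words P. word_eq P (g @ u @ inv_word g) v)"

lemma conjugate_in_iff:
  assumes "wf_presentation P" "u \<in> words P" "v \<in> words P"
  shows "conjugate_in (presented_group P) (elt P u) (elt P v) \<longleftrightarrow> word_conj P u v"
proof -
  have "carrier (presented_group P) = elt P ` words P" by (simp add: presented_group_def)
  then show ?thesis
    using assms by (auto simp: conjugate_in_def word_conj_def mult_elt elt_eq_iff simp flip: elt_inv_word)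
qed

lemma word_eq_subst:
  assumes "wf_presentation P" "word_eq P u v" "x \<in> words P" "y \<in> words P" "word_eq P (x @ v @ y) w"
  shows "word_eq P (x @ u @ y) w"
  using word_eq.trans[OF word_eq_append[OF assms(2-4)] assms(5)] .

lemma word_conj_word_eq: "wf_presentation P \<Longrightarrow> word_eq P u v \<Longrightarrow> word_conj P u v"
  unfolding word_conj_def by (intro bexI[of _ "[]"]) (simp_all add: inv_word_def)

lemma word_conj_refl: "u \<in> words P \<Longrightarrow> word_conj P u u"
  unfolding word_conj_def by (intro bexI[of _ "[]"]) (simp_all add: inv_word_def word_eq.refl)

lemma word_conj_trans:
  assumes "wf_presentation P" "word_conj P u v" "word_conj P v w"
  shows "word_conj P u w"
proof -
  obtain g f where g: "g \<in> words P" "word_eq P (g @ u @ inv_word g) v"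
    and f: "f \<in> words P" "word_eq P (f @ v @ inv_word f) w"
    using assms by (auto simp: word_conj_def)
  have "word_eq P ((f @ g) @ u @ inv_word (f @ g)) w"
    using word_eq_subst[OF assms(1) g(2) f(1) _ f(2)] f(1) by (simp add: inv_word_append)
  then show ?thesis using f g unfolding word_conj_def by (metis words_simps(3))
qed

lemma word_conj_sym:
  assumes "wf_presentation P" "word_conj P u v"
  shows "word_conj P v u"
proof -
  obtain g where g: "g \<in> words P" "word_eq P (g @ u @ inv_word g) v"
    using assms by (auto simp: word_conj_def)
  then have u: "u \<in> words P" using word_eq_in_words(1)[OF assms(1) g(2)] by simp
  have "word_eq P (inv_word g @ g @ (u @ inv_word g @ g)) u"
    using word_eq_append[OF word_eq_inv_word[OF g(1)], of "[]" "u @ inv_word g @ g"]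
      word_eq_append[OF word_eq_inv_word[OF g(1)], of u "[]"] g u
    by (simp) (metis word_eq.trans)
  moreover have "word_eq P (inv_word g @ v @ g) (inv_word g @ (g @ u @ inv_word g) @ g)"
    using word_eq_append[OF word_eq.sym[OF g(2)]] g by simp
  ultimately have "word_eq P (inv_word g @ v @ inv_word (inv_word g)) u"
    by (simp add: inv_word_inv_word) (metis word_eq.trans)
  then show ?thesis using g(1) unfolding word_conj_def by (intro bexI[of _ "inv_word g"]) auto
qed

lemma word_conj_append_comm:
  assumes "wf_presentation P" "u \<in> words P" "v \<in> words P"
  shows "word_conj P (u @ v) (v @ u)"
  using word_eq_append[OF word_eq_inv_word[OF assms(2)], of "[]" "v @ u"] assms
  unfolding word_conj_def
  by (intro bexI[of _ "inv_word u"]) (simp_all add: inv_word_inv_word)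

lemma word_conj_exp_sum:
  assumes "exp_invariant P" "word_conj P u v"
  shows "exp_sum u = exp_sum v"
proof -
  obtain g where "word_eq P (g @ u @ inv_word g) v" using assms by (auto simp: word_conj_def)
  from exp_sum_well_defined[OF assms(1) this] show ?thesis by (simp add: exp_sum_inv_word)
qed

text \<open>Indexing the factors by truth values lets each argument be given once for both;
  \<open>True\<close> is the left factor.\<close>

locale cyclic_amalgam =
  fixes P :: "bool \<Rightarrow> presentation" and h :: "bool \<Rightarrow> word"
  assumes wf [simp]: "wf_presentation (P s)"
    and exp_inv: "exp_invariant (P s)"
    and h_words [simp]: "h s \<in> words (P s)"
    and exp_h: "exp_sum (h s) \<noteq> 0"
begin

lemma exp_sum_eq: "word_eq (P s) u v \<Longrightarrow> exp_sum u = exp_sum v"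
  using exp_sum_well_defined exp_inv by blast

lemma h_pow_words [simp]: "word_pow (h s) k \<in> words (P s)"
  by (simp add: word_pow_in_words)

lemma h_pow_inject: "word_eq (P s) (word_pow (h s) j) (word_pow (h s) k) \<Longrightarrow> j = k"
  using exp_sum_eq[of s "word_pow (h s) j" "word_pow (h s) k"] exp_h[of s] by (simp add: exp_sum_word_pow)

lemmas in_words = word_eq_in_words[OF wf]

text \<open>
  Words of both factors, tagged with their factor, represent elements of the union of the
  two factors in which the cyclic subgroups are identified.
\<close>

definition same_elem :: "bool \<times> word \<Rightarrow> bool \<times> word \<Rightarrow> bool" where
  "same_elem = (\<lambda>(s, u) (t, v). s = t \<and> word_eq (P s) u v \<or>
    (\<exists>k. word_eq (P s) u (word_pow (h s) k) \<and> word_eq (P t) v (word_pow (h t) k)))"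

lemma same_elem_same [simp]: "same_elem (s, u) (s, v) \<longleftrightarrow> word_eq (P s) u v"
  by (auto simp: same_elem_def intro: word_eq.trans word_eq.sym)

lemma same_elem_other:
  "same_elem (s, u) (\<not> s, v) \<longleftrightarrow>
    (\<exists>k. word_eq (P s) u (word_pow (h s) k) \<and> word_eq (P (\<not> s)) v (word_pow (h (\<not> s)) k))"
  by (auto simp: same_elem_def)

lemma same_elem_powI:
  "word_eq (P s) u (word_pow (h s) k) \<Longrightarrow> word_eq (P t) v (word_pow (h t) k) \<Longrightarrow>
    same_elem (s, u) (t, v)"
  by (auto simp: same_elem_def)

lemma same_elem_cases:
  assumes "same_elem (s, u) (t, v)"
  obtains "s = t" "word_eq (P s) u v"
  | k where "word_eq (P s) u (word_pow (h s) k)" "word_eq (P t) v (word_pow (h t) k)"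
  using assms by (auto simp: same_elem_def)

lemma same_elem_sym: "same_elem p q \<Longrightarrow> same_elem q p"
  by (auto simp: same_elem_def intro: word_eq.sym)

text \<open>Passing through a power twice requires the exponent of the middle word to be unique,
  which \<open>h_pow_inject\<close> provides. For generators of different orders transitivity would
  fail.\<close>

lemma same_elem_trans:
  assumes "same_elem p q" "same_elem q r"
  shows "same_elem p r"
proof -
  obtain s u t v x w where p: "p = (s, u)" "q = (t, v)" "r = (x, w)"
    by (cases p, cases q, cases r)
  from assms(1)[unfolded p] show ?thesis
  proof (cases rule: same_elem_cases)
    case 1
    from assms(2)[unfolded p] show ?thesis
    proof (cases rule: same_elem_cases)
      case eq: 1
      then show ?thesis using 1 p by (auto intro: word_eq.trans)
    next
      case (2 k)
      then show ?thesis using 1 p by (auto intro: same_elem_powI word_eq.trans)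
    qed
  next
    case k: (2 k)
    from assms(2)[unfolded p] show ?thesis
    proof (cases rule: same_elem_cases)
      case 1
      then have "word_eq (P x) w (word_pow (h x) k)"
        using k(2) by (auto intro: word_eq.trans word_eq.sym)
      then show ?thesis using k(1) p same_elem_powI by simp
    next
      case (2 l)
      then have "k = l" using k(2) h_pow_inject[of t k l] by (meson word_eq.sym word_eq.trans)
      then show ?thesis using 2 k(1) p same_elem_powI by simp
    qed
  qed
qed

section \<open>The union of the two factors as glued groups\<close>

definition cls :: "bool \<times> word \<Rightarrow> (bool \<times> word) set" where
  "cls p = {q. same_elem p q}"

lemma cls_eq_iff: "snd p \<in> words (P (fst p)) \<Longrightarrow> cls p = cls q \<longleftrightarrow> same_elem p q"
proof -
  assume "snd p \<in> words (P (fst p))"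
  then have "same_elem p p" by (cases p) (auto intro: word_eq.refl)
  then show ?thesis
    unfolding cls_def using same_elem_sym same_elem_trans by blast
qed

lemma cls_eq: "same_elem p q \<Longrightarrow> cls p = cls q"
  unfolding cls_def using same_elem_sym same_elem_trans by blast

definition factor :: "bool \<Rightarrow> (bool \<times> word) set set" where
  "factor s = (\<lambda>u. cls (s, u)) ` words (P s)"

text \<open>The union over all pairs of representatives with equal tags avoids choosing any. By
  \<open>mul_cls\<close> it is a single class for two elements of one factor.\<close>

definition mul :: "(bool \<times> word) set \<Rightarrow> (bool \<times> word) set \<Rightarrow> (bool \<times> word) set" where
  "mul S T = (\<Union>{cls (s, u @ v) | s u v. (s, u) \<in> S \<and> (s, v) \<in> T})"

definition iv :: "(bool \<times> word) set \<Rightarrow> (bool \<times> word) set" where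
  "iv S = (\<Union>{cls (s, inv_word u) | s u. (s, u) \<in> S})"

definition pw :: "int \<Rightarrow> (bool \<times> word) set" where
  "pw k = cls (True, word_pow (h True) k)"

definition ex :: "bool \<Rightarrow> (bool \<times> word) set \<Rightarrow> int" where
  "ex s S = exp_sum (SOME u. (s, u) \<in> S)"

lemma pw_eq: "pw k = cls (s, word_pow (h s) k)"
  unfolding pw_def by (rule cls_eq) (auto simp: same_elem_def intro!: exI[of _ k] word_eq.refl)

lemma factor_cls [simp]: "u \<in> words (P s) \<Longrightarrow> cls (s, u) \<in> factor s"
  by (auto simp: factor_def)

lemma factorE:
  assumes "x \<in> factor s"
  obtains u where "x = cls (s, u)" "u \<in> words (P s)"
  using assms by (auto simp: factor_def)

lemma mul_cls:
  assumes "u \<in> words (P s)" "v \<in> words (P s)"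
  shows "mul (cls (s, u)) (cls (s, v)) = cls (s, u @ v)"
proof -
  have "cls (t, u' @ v') = cls (s, u @ v)" if "same_elem (s, u) (t, u')" "same_elem (s, v) (t, v')" for t u' v'
  proof (cases "t = s")
    case True
    then show ?thesis using that assms
      by (intro cls_eq[symmetric]) (auto intro: word_eq_append2)
  next
    \<comment> \<open>Only powers have representatives in the other factor, and exponents add up in
      the same way on both sides.\<close>
    case False
    then have t: "t = (\<not> s)" by simp
    from that obtain j k where j: "word_eq (P s) u (word_pow (h s) j)" "word_eq (P t) u' (word_pow (h t) j)"
      and k: "word_eq (P s) v (word_pow (h s) k)" "word_eq (P t) v' (word_pow (h t) k)"
      unfolding t same_elem_other by blast
    have "word_eq (P s) (u @ v) (word_pow (h s) (j + k))"
      "word_eq (P t) (u' @ v') (word_pow (h t) (j + k))"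
      using word_eq_append2[OF wf j(1) k(1)] word_eq_append2[OF wf j(2) k(2)]
        word_pow_add[OF wf h_words] by (meson word_eq.sym word_eq.trans)+
    then show ?thesis by (intro cls_eq[symmetric] same_elem_powI)
  qed
  moreover have "same_elem (s, u) (s, u)" "same_elem (s, v) (s, v)"
    using assms by (auto intro: word_eq.refl)
  ultimately have "{cls (t, u' @ v') | t u' v'. same_elem (s, u) (t, u') \<and> same_elem (s, v) (t, v')}
      = {cls (s, u @ v)}"
    by blast
  then show ?thesis by (simp add: mul_def cls_def[of "(s, u)"] cls_def[of "(s, v)"])
qed

lemma iv_cls:
  assumes "u \<in> words (P s)"
  shows "iv (cls (s, u)) = cls (s, inv_word u)"
proof -
  have inv: "word_eq (P r) (inv_word w) (word_pow (h r) (- k))"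
    if "word_eq (P r) w (word_pow (h r) k)" for r w k
  proof -
    have "word_eq (P r) (word_pow (h r) (- k) @ word_pow (h r) k) []"
      using word_pow_add[OF wf h_words, of r "- k" k]
      by (simp add: word_pow_replicate word_eq.sym)
    have w: "w \<in> words (P r)" using in_words that by blast
    have "word_eq (P r) (word_pow (h r) (- k) @ w) []"
      using word_eq_append[OF that, of "word_pow (h r) (- k)" "[]"] 
        \<open>word_eq (P r) (word_pow (h r) (- k) @ word_pow (h r) k) []\<close>
      by simp (metis word_eq.trans)
    from word_eq_append[OF this, of "[]" "inv_word w"]
    have "word_eq (P r) (word_pow (h r) (- k) @ w @ inv_word w) (inv_word w)"
      using w by simp
    moreover have "word_eq (P r) (word_pow (h r) (- k) @ w @ inv_word w) (word_pow (h r) (- k))"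
      using word_eq_append[OF word_eq_inv_word_right[OF w], of "word_pow (h r) (- k)" "[]"] by simp
    ultimately show ?thesis by (meson word_eq.sym word_eq.trans)
  qed
  have "cls (t, inv_word u') = cls (s, inv_word u)" if "same_elem (s, u) (t, u')" for t u'
  proof (cases "t = s")
    case True
    then show ?thesis using that assms
      by (intro cls_eq[symmetric]) (auto intro: word_eq_cong_inv)
  next
    case False
    then have t: "t = (\<not> s)" by simp
    from that obtain j where j: "word_eq (P s) u (word_pow (h s) j)" "word_eq (P t) u' (word_pow (h t) j)"
      unfolding t same_elem_other by blast
    from inv[OF j(1)] inv[OF j(2)] show ?thesis by (intro cls_eq[symmetric] same_elem_powI)
  qed
  moreover have "same_elem (s, u) (s, u)"
    using assms by (auto intro: word_eq.refl)
  ultimately have "{cls (t, inv_word u') | t u'. same_elem (s, u) (t, u')} = {cls (s, inv_word u)}"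
    by blast
  then show ?thesis by (simp add: iv_def cls_def[of "(s, u)"])
qed

lemma ex_cls:
  assumes "u \<in> words (P s)"
  shows "ex s (cls (s, u)) = exp_sum u"
proof -
  have "word_eq (P s) u (SOME v. (s, v) \<in> cls (s, u))"
    using someI[of "\<lambda>v. (s, v) \<in> cls (s, u)" u] assms by (simp add: cls_def word_eq.refl)
  then show ?thesis unfolding ex_def using exp_sum_eq by metis
qed

lemma pw_0: "pw 0 = cls (s, [])"
  by (simp add: pw_eq[of _ s] word_pow_replicate)

text \<open>This makes the confluence theorem and the analysis of slides available for words of
  classes. The unit \<open>pw 0\<close> is the class of the empty words of both factors.\<close>

sublocale cyclic_gluing factor mul "pw 0" iv pw ex "\<lambda>s. exp_sum (h s)"
proof
  fix s x y z assume x: "x \<in> factor s" and y: "y \<in> factor s" and z: "z \<in> factor s"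
  then obtain u v w where u: "x = cls (s, u)" "u \<in> words (P s)" and v: "y = cls (s, v)" "v \<in> words (P s)"
    and w: "z = cls (s, w)" "w \<in> words (P s)"
    by (metis factorE)
  show "mul x y \<in> factor s" "mul (mul x y) z = mul x (mul y z)" "ex s (mul x y) = ex s x + ex s y"
    using u v w by (simp_all add: mul_cls ex_cls)
next
  fix s x assume "x \<in> factor s"
  then obtain u where u: "x = cls (s, u)" "u \<in> words (P s)" by (metis factorE)
  show "iv x \<in> factor s" "mul (pw 0) x = x" "mul x (pw 0) = x"
    using u by (simp_all add: mul_cls iv_cls pw_0[of s])
  show "mul (iv x) x = pw 0" "mul x (iv x) = pw 0"
    using u by (auto simp: mul_cls iv_cls pw_0[of s] cls_eq_iff word_eq_inv_word word_eq_inv_word_right)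
next
  show "factor True \<inter> factor False = range pw"
  proof
    show "range pw \<subseteq> factor True \<inter> factor False"
      using pw_eq by (metis Int_iff factor_cls h_pow_words image_subsetI)
    show "factor True \<inter> factor False \<subseteq> range pw"
    proof
      fix x assume "x \<in> factor True \<inter> factor False"
      then obtain u v where "x = cls (True, u)" "x = cls (False, v)" "u \<in> words (P True)"
        by (metis IntE factorE)
      then obtain k where "word_eq (P True) u (word_pow (h True) k)"
        using cls_eq_iff[of "(True, u)" "(False, v)"] same_elem_other[of True u v] by auto
      then have "x = pw k"
        using \<open>x = cls (True, u)\<close> unfolding pw_def by (simp, intro cls_eq) simp
      then show "x \<in> range pw" by blast
    qed
  qed
next
  fix s j k
  show "pw 0 \<in> factor s" by (simp add: pw_0[of s])
  show "pw (j + k) = mul (pw j) (pw k)"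
    by (simp add: pw_def mul_cls cls_eq_iff word_pow_add)
  show "ex s (pw k) = k * exp_sum (h s)"
    by (simp add: pw_eq[of _ s] ex_cls exp_sum_word_pow)
  show "exp_sum (h s) \<noteq> 0" by (rule exp_h)
qed simp_all

section \<open>The factors inside the presentation of the amalgam\<close>

definition emb :: "bool \<Rightarrow> word \<Rightarrow> word" where
  "emb s = (if s then left_word else right_word)"

definition G :: presentation where
  "G = amalgam (P True) (P False) (h True) (h False)"

text \<open>The parity of a generator number records its factor; \<open>letters\<close> reads it off
  again.\<close>

lemma emb_map: "emb s = map (apfst (\<lambda>i. 2 * i + of_bool (\<not> s)))"
  by (auto simp: emb_def left_word_def right_word_def sum_encode_def)

lemma emb_simps [simp]:
  "emb s [] = []" "emb s (u @ v) = emb s u @ emb s v"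
  by (simp_all add: emb_map)

lemma emb_inv_word: "emb s (inv_word w) = inv_word (emb s w)"
  by (simp add: emb_map inv_word_def rev_map o_def apfst_def apsnd_def map_prod_def case_prod_unfold)

lemma emb_word_pow: "emb s (word_pow w k) = word_pow (emb s w) k"
  unfolding emb_inv_word[symmetric] word_pow_def
  by (simp add: emb_map map_concat o_def flip: emb_inv_word)

lemma wf_G [simp]: "wf_presentation G"
  by (simp add: G_def wf_amalgam)

lemma gens_G: "gens G = {2 * i + of_bool (\<not> s) | i s. i \<in> gens (P s)}"
  by (auto simp: G_def amalgam_def sum_encode_def ex_bool_eq)

lemma gens_G_iff: "2 * i + of_bool (\<not> s) \<in> gens G \<longleftrightarrow> i \<in> gens (P s)"
  by (cases s) (auto simp: gens_G ex_bool_eq, presburger+)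

lemma emb_words [simp]: "emb s w \<in> words G \<longleftrightarrow> w \<in> words (P s)"
  by (induction w) (auto simp: emb_map gens_G_iff)

lemma rels_G: "rels G = (\<Union>s. emb s ` rels (P s)) \<union>
    {emb True (h True) @ emb False (inv_word (h False))}"
  unfolding emb_inv_word by (auto simp: G_def amalgam_def emb_def UNIV_bool)

lemma emb_rel: "r \<in> rels (P s) \<Longrightarrow> emb s r \<in> rels G"
  by (auto simp: rels_G)

lemma emb_word_eq:
  assumes "word_eq (P s) u v"
  shows "word_eq G (emb s u) (emb s v)"
  using assms
proof (induction rule: word_eq.induct)
  case (cancel u v i b)
  then show ?case
    using word_eq.cancel[of "emb s u" G "emb s v" "2 * i + of_bool (\<not> s)" b]
    by (simp add: gens_G_iff) (simp add: emb_map)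
next
  case (rel u v r)
  then show ?case using word_eq.rel[of "emb s u" G "emb s v" "emb s r"] by (simp add: emb_rel)
qed (auto intro: word_eq.refl word_eq.sym word_eq.trans)

lemma emb_h: "word_eq G (emb True (h True)) (emb False (h False))"
proof -
  have "word_eq G ([] @ (emb True (h True) @ inv_word (emb False (h False))) @ emb False (h False))
      ([] @ emb False (h False))"
    by (rule word_eq.rel) (simp_all add: rels_G emb_inv_word)
  moreover have "word_eq G (emb True (h True) @ (inv_word (emb False (h False)) @ emb False (h False)) @ [])
      (emb True (h True) @ [] @ [])"
    by (rule word_eq_append) (auto intro: word_eq_inv_word)
  ultimately show ?thesis by simp (meson word_eq.sym word_eq.trans)
qed

lemma emb_h_pow: "word_eq G (emb s (word_pow (h s) k)) (emb t (word_pow (h t) k))"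
proof -
  have "elt G (emb s (h s)) = elt G (emb t (h t))"
    using emb_h by (cases s; cases t) (auto simp: elt_eq_iff intro: word_eq.refl word_eq.sym)
  then have "elt G (word_pow (emb s (h s)) k) = elt G (word_pow (emb t (h t)) k)"
    by (simp add: elt_word_pow)
  then show ?thesis by (simp add: emb_word_pow elt_eq_iff word_pow_in_words)
qed

lemma emb_word_conj: "word_conj (P s) u v \<Longrightarrow> word_conj G (emb s u) (emb s v)"
  unfolding word_conj_def using emb_word_eq emb_inv_word emb_words
  by (metis emb_simps(2))

definition valid :: "(bool \<times> word) list \<Rightarrow> bool" where
  "valid ws \<longleftrightarrow> ws \<noteq> [] \<and> (\<forall>p\<in>set ws. snd p \<in> words (P (fst p)))"

definition val :: "(bool \<times> word) list \<Rightarrow> word" where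
  "val ws = concat (map (\<lambda>p. emb (fst p) (snd p)) ws)"

lemma val_simps [simp]:
  "val [] = []" "val (p # ws) = emb (fst p) (snd p) @ val ws" "val (us @ vs) = val us @ val vs"
  by (simp_all add: val_def)

end

definition letters :: "word \<Rightarrow> (bool \<times> word) list" where
  "letters w = map (\<lambda>l. (even (fst l), [(fst l div 2, snd l)])) w"

text \<open>The leading trivial syllable keeps the list nonempty even for the empty word, so there
  is always a syllable that can absorb a unit.\<close>

definition syllables :: "word \<Rightarrow> (bool \<times> word) list" where
  "syllables w = (True, []) # letters w"

context cyclic_amalgam
begin

lemma letters_append [simp]: "letters (u @ v) = letters u @ letters v"
  by (simp add: letters_def)

lemma letters_emb: "letters (emb s w) = map (\<lambda>l. (s, [l])) w"
  by (auto simp: letters_def emb_map)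

lemma val_syllables: "val (syllables w) = w"
proof -
  have "val (letters w) = w"
    by (induction w) (auto simp: letters_def emb_map)
  then show ?thesis by (simp add: syllables_def)
qed

lemma val_words: "valid ws \<Longrightarrow> val ws \<in> words G"
proof -
  have "\<forall>p\<in>set ws. snd p \<in> words (P (fst p)) \<Longrightarrow> val ws \<in> words G"
    by (induction ws) auto
  then show "valid ws \<Longrightarrow> ?thesis" by (simp add: valid_def)
qed

lemma valid_syllables: "w \<in> words G \<Longrightarrow> valid (syllables w)"
proof -
  have "\<forall>p\<in>set (letters w). snd p \<in> words (P (fst p))" if "w \<in> words G"
    using that by (induction w) (auto simp: letters_def gens_G)
  then show "w \<in> words G \<Longrightarrow> ?thesis" by (simp add: valid_def syllables_def)
qed

section \<open>Conjugate words of the amalgam give equivalent cyclic words\<close>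

definition ceq :: "(bool \<times> word) set list \<Rightarrow> (bool \<times> word) set list \<Rightarrow> bool" where
  "ceq = equivclp (\<lambda>u v. merge u v \<or> slide u v)"

lemma ceq_refl: "ceq u u"
  and ceq_sym: "ceq u v \<Longrightarrow> ceq v u"
  and ceq_trans [trans]: "ceq u v \<Longrightarrow> ceq v w \<Longrightarrow> ceq u w"
  unfolding ceq_def by (auto intro: equivclp_sym equivclp_trans)

lemma ceq_rotate: "ceq (p @ q) (q @ p)"
  unfolding ceq_def using slide_append_comm by (intro r_into_equivclp) simp

lemma ceq_merge:
  assumes "x \<in> factor s" "y \<in> factor s"
  shows "ceq (p @ x # y # q) (p @ mul x y # q)"
proof -
  have "ceq (p @ x # y # q) (mul x y # q @ p)"
    unfolding ceq_def using mergeI[OF assms] by (intro r_into_equivclp) simp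
  also have "ceq (mul x y # q @ p) (p @ mul x y # q)"
    using ceq_rotate[of "mul x y # q" p] by simp
  finally show ?thesis .
qed

definition proper :: "(bool \<times> word) set list \<Rightarrow> bool" where
  "proper p \<longleftrightarrow> p \<noteq> [] \<and> (\<forall>x\<in>set p. \<exists>s. x \<in> factor s)"

text \<open>The unit lies in both factors and is absorbed by its left neighbour, whichever factor
  that belongs to; hence the nonempty prefix.\<close>

lemma ceq_insert_one:
  assumes "proper p"
  shows "ceq (p @ pw 0 # q) (p @ q)"
proof -
  obtain p' z where p: "p = p' @ [z]" using assms by (cases p rule: rev_cases) (auto simp: proper_def)
  then obtain s where "z \<in> factor s" using assms by (auto simp: proper_def)
  then show ?thesis using ceq_merge[of z s "pw 0" p' q] p by (simp add: e_right)
qed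

text \<open>The letters merge one after another into a growing syllable. The empty word starts it as
  an inserted unit, which uses the nonempty prefix.\<close>

lemma ceq_word:
  assumes "proper p" "w \<in> words (P s)"
  shows "ceq (p @ map cls (letters (emb s w)) @ q) (p @ cls (s, w) # q)"
  using assms(2)
proof (induction w arbitrary: q rule: rev_induct)
  case Nil
  show ?case using ceq_insert_one[OF assms(1), of q] by (simp add: letters_def pw_0[of s] ceq_sym)
next
  case (snoc l w)
  have "ceq (p @ map cls (letters (emb s (w @ [l]))) @ q) (p @ cls (s, w) # cls (s, [l]) # q)"
    using snoc.IH[of "cls (s, [l]) # q"] snoc.prems by (simp add: letters_emb del: emb_simps)
  also have "ceq \<dots> (p @ cls (s, w @ [l]) # q)"
    using ceq_merge[of "cls (s, w)" s "cls (s, [l])" p q] snoc.prems by (simp add: mul_cls)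
  finally show ?case .
qed

definition cyc :: "word \<Rightarrow> (bool \<times> word) set list" where
  "cyc w = map cls (syllables w)"

lemma proper_cls: "valid ws \<Longrightarrow> proper (map cls ws)"
  unfolding valid_def proper_def by (force intro: factor_cls)

lemma proper_cyc: "w \<in> words G \<Longrightarrow> proper (cyc w)"
  by (simp add: cyc_def proper_cls valid_syllables)

lemma cyc_append: "cyc (u @ v) = cyc u @ map cls (letters v)"
  by (simp add: cyc_def syllables_def)

lemma cyc_insert:
  assumes "u \<in> words G" "word_eq (P s) w []"
  shows "ceq (cyc (u @ emb s w @ v)) (cyc (u @ v))"
proof -
  have w: "w \<in> words (P s)" using assms in_words by blast
  have "ceq (cyc (u @ emb s w @ v)) (cyc u @ cls (s, w) # map cls (letters v))"
    using ceq_word[OF proper_cyc[OF assms(1)] w] by (simp add: cyc_append)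
  also have "cls (s, w) = pw 0"
    unfolding pw_0[of s] by (rule cls_eq) (simp add: assms(2))
  also have "ceq (cyc u @ pw 0 # map cls (letters v)) (cyc (u @ v))"
    using ceq_insert_one[OF proper_cyc[OF assms(1)]] by (simp add: cyc_append)
  finally show ?thesis .
qed

lemma word_eq_ceq: "word_eq G u v \<Longrightarrow> ceq (cyc u) (cyc v)"
proof (induction rule: word_eq.induct)
  case (refl w)
  show ?case by (rule ceq_refl)
next
  case (sym u v)
  then show ?case by (blast intro: ceq_sym)
next
  case (trans u v w)
  then show ?case by (blast intro: ceq_trans)
next
  case (cancel u v i b)
  then obtain j s where i: "i = 2 * j + of_bool (\<not> s)" "j \<in> gens (P s)"
    by (auto simp: gens_G)
  then have "word_eq (P s) [(j, b), (j, \<not> b)] []"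
    using word_eq.cancel[of "[]" "P s" "[]" j b] by simp
  from cyc_insert[OF cancel(1) this, of v] show ?case by (simp add: i emb_map)
next
  case (rel u v r)
  have *: "ceq (cyc (u @ r @ v)) (cyc (u @ v))" if "r = emb s w" "w \<in> rels (P s)" for s w
  proof -
    have "w \<in> words (P s)" using that wf[of s] by (auto simp: wf_presentation_def)
    then have "word_eq (P s) w []" using word_eq.rel[of "[]" "P s" "[]" w] that by simp
    from cyc_insert[OF rel(1) this, of v] that show ?thesis by simp
  qed
  consider s w where "r = emb s w" "w \<in> rels (P s)"
    | "r = emb True (h True) @ emb False (inv_word (h False))"
    using rel(3) unfolding rels_G by blast
  then show ?case
  proof cases
    case 2
    let ?a = "cls (False, h False)" and ?b = "cls (False, inv_word (h False))"
    have "ceq (cyc (u @ r @ v)) (cyc u @ cls (True, h True) # map cls (letters (emb False (inv_word (h False)) @ v)))"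
      using ceq_word[OF proper_cyc[OF rel(1)] h_words, of True] by (simp add: cyc_append 2)
    \<comment> \<open>Here the amalgamation enters: the two generators are one class, so this
      syllable can be read in the second factor and merged with the inverse that follows.\<close>
    also have "cls (True, h True) = ?a"
      by (rule cls_eq) (rule same_elem_powI[of _ _ 1]; simp add: word_pow_def word_eq.refl)
    also have "proper (cyc u @ [?a])"
      using proper_cyc[OF rel(1)] factor_cls[OF h_words[of False]] unfolding proper_def
      by (auto simp del: factor_cls)
    then have "ceq (cyc u @ ?a # map cls (letters (emb False (inv_word (h False)) @ v)))
        (cyc u @ ?a # ?b # map cls (letters v))"
      using ceq_word[of "cyc u @ [?a]" "inv_word (h False)" False "map cls (letters v)"] by simp
    also have "ceq \<dots> (cyc u @ mul ?a ?b # map cls (letters v))"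
      by (rule ceq_merge[of _ False]) simp_all
    also have "mul ?a ?b = pw 0"
      by (simp add: mul_cls pw_0[of False] cls_eq_iff word_eq_inv_word_right)
    also have "ceq (cyc u @ pw 0 # map cls (letters v)) (cyc (u @ v))"
      using ceq_insert_one[OF proper_cyc[OF rel(1)]] by (simp add: cyc_append)
    finally show ?thesis .
  qed (rule *)
qed

text \<open>Conjugation turns into rotation: \<open>u\<close> equals
  \<open>u @ inv_word g @ g\<close>, and rotating the block of \<open>g\<close> to the front gives
  the conjugate. Units are inserted and removed because each \<open>cyc\<close> begins with
  one.\<close>

theorem word_conj_ceq:
  assumes "word_conj G u v"
  shows "ceq (cyc u) (cyc v)"
proof -
  obtain g where g: "g \<in> words G" "word_eq G (g @ u @ inv_word g) v"
    using assms by (auto simp: word_conj_def)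
  then have u: "u \<in> words G" using word_eq_in_words(1)[OF wf_G g(2)] by simp
  let ?l = "\<lambda>w. map cls (letters w)"
  have one: "cyc w = pw 0 # ?l w" for w by (simp add: cyc_def syllables_def pw_0[of True])
  have "ceq (cyc u) (cyc (u @ inv_word g @ g))"
    using word_eq_ceq[OF word_eq_append[OF word_eq_inv_word[OF g(1)] u, of "[]"]] by (simp add: ceq_sym)
  also have "ceq \<dots> (cyc (u @ inv_word g) @ cyc g)"
    using ceq_insert_one[OF proper_cyc, of "u @ inv_word g" "?l g"] u g(1)
    by (simp add: one[of g] cyc_append ceq_sym)
  also have "ceq \<dots> (cyc g @ cyc (u @ inv_word g))"
    by (rule ceq_rotate)
  also have "ceq \<dots> (cyc (g @ u @ inv_word g))"
    using ceq_insert_one[OF proper_cyc[OF g(1)], of "?l u @ ?l (inv_word g)"]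
    by (simp add: one[of u] cyc_append)
  also have "ceq \<dots> (cyc v)"
    by (rule word_eq_ceq[OF g(2)])
  finally show ?thesis .
qed

end

section \<open>The decision procedure\<close>

context cyclic_gluing
begin

lemma common_from_twist:
  assumes "x \<in> X s" "c j \<cdot> x \<cdot> c k = c l"
  shows "x = c (l - j - k)"
proof -
  have "c (- j) \<cdot> (c j \<cdot> x \<cdot> c k) \<cdot> c (- k) = x"
    using assms(1) iv_left_cancel[of "c j" s "x \<cdot> (c k \<cdot> c (- k))"]
    by (simp add: assoc[of _ s] iv_c e_right[of _ s] c_0 flip: c_add)
  then show ?thesis using assms(2) by (simp add: algebra_simps flip: c_add)
qed

end

locale amalgam_decision = cyclic_amalgam +
  fixes cj :: "bool \<Rightarrow> word \<Rightarrow> word \<Rightarrow> bool"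
    and C :: "bool \<Rightarrow> word \<Rightarrow> word \<Rightarrow> int"
    and N :: "bool \<Rightarrow> word \<Rightarrow> word \<Rightarrow> nat"
  assumes cj: "u \<in> words (P s) \<Longrightarrow> v \<in> words (P s) \<Longrightarrow> cj s u v \<longleftrightarrow> word_conj (P s) u v"
    and exponents: "u \<in> words (P s) \<Longrightarrow> v \<in> words (P s)
      \<Longrightarrow> word_eq (P s) (word_pow (h s) k @ u @ word_pow (h s) (- k)) v
      \<Longrightarrow> {k. word_eq (P s) (word_pow (h s) k @ u @ word_pow (h s) (- k)) v} =
        {C s u v + k * int (N s u v) | k. True}"
    and computable_cj: "computable (\<lambda>p. cj (fst p) (fst (snd p)) (snd (snd p)))"
    and computable_C: "computable (\<lambda>p. C (fst p) (fst (snd p)) (snd (snd p)))"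
    and computable_N: "computable (\<lambda>p. N (fst p) (fst (snd p)) (snd (snd p)))"
begin

text \<open>Only the identity is conjugate to the identity, so the conjugacy decider also solves the
  word problem of a factor.\<close>

definition eqw :: "bool \<Rightarrow> word \<Rightarrow> word \<Rightarrow> bool" where
  "eqw s u v \<longleftrightarrow> cj s (u @ inv_word v) []"

lemma eqw_iff:
  assumes "u \<in> words (P s)" "v \<in> words (P s)"
  shows "eqw s u v \<longleftrightarrow> word_eq (P s) u v"
proof -
  have "word_eq (P s) w []" if "g \<in> words (P s)" "w \<in> words (P s)" "word_eq (P s) (g @ w @ inv_word g) []" for g w
  proof -
    have "word_conj (P s) [] w"
      by (rule word_conj_sym[OF wf]) (use that in \<open>auto simp: word_conj_def\<close>)
    then obtain f where "f \<in> words (P s)" "word_eq (P s) (f @ inv_word f) w"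
      by (auto simp: word_conj_def)
    then show ?thesis using word_eq_inv_word_right by (meson word_eq.sym word_eq.trans)
  qed
  moreover have uv: "u @ inv_word v \<in> words (P s)" using assms by simp
  ultimately have "word_conj (P s) (u @ inv_word v) [] \<longleftrightarrow> word_eq (P s) (u @ inv_word v) []"
    using word_conj_word_eq[OF wf, of s] unfolding word_conj_def by blast
  then have "eqw s u v \<longleftrightarrow> word_eq (P s) (u @ inv_word v) []"
    using cj[OF uv] by (simp add: eqw_def)
  also have "\<dots> \<longleftrightarrow> word_eq (P s) u v"
  proof
    assume "word_eq (P s) (u @ inv_word v) []"
    from word_eq_append[OF this, of "[]" v] have "word_eq (P s) (u @ inv_word v @ v) v"
      using assms by simp
    moreover have "word_eq (P s) (u @ inv_word v @ v) u"
      using word_eq_append[OF word_eq_inv_word[OF assms(2)], of u "[]"] assms by simp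
    ultimately show "word_eq (P s) u v" by (meson word_eq.sym word_eq.trans)
  next
    assume "word_eq (P s) u v"
    from word_eq_append[OF this, of "[]" "inv_word v"]
    show "word_eq (P s) (u @ inv_word v) []"
      using assms word_eq_inv_word_right[OF assms(2)] by (auto intro: word_eq.trans)
  qed
  finally show ?thesis .
qed

text \<open>Exponent sums leave this as the only exponent for which \<open>w\<close> can be a power
  of the generator. If \<open>w\<close> is no power, the value is meaningless and the test in
  \<open>in_common\<close> rejects it.\<close>

definition root :: "bool \<Rightarrow> word \<Rightarrow> int" where
  "root s w = int_quot (exp_sum w) (exp_sum (h s))"

lemma root_eqI: "exp_sum w = k * exp_sum (h s) \<Longrightarrow> root s w = k"
  by (simp add: root_def int_quot_mult exp_h)

lemma root_eq: "word_eq (P s) w (word_pow (h s) k) \<Longrightarrow> root s w = k"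
  using exp_sum_eq by (intro root_eqI) (metis exp_sum_word_pow)

definition in_common :: "bool \<Rightarrow> word \<Rightarrow> bool" where
  "in_common s w \<longleftrightarrow> eqw s w (word_pow (h s) (root s w))"

lemma in_common_iff:
  "w \<in> words (P s) \<Longrightarrow> in_common s w \<longleftrightarrow> word_eq (P s) w (word_pow (h s) (root s w))"
  by (simp add: in_common_def eqw_iff)

lemma in_commonI: "word_eq (P s) w (word_pow (h s) k) \<Longrightarrow> in_common s w"
  using root_eq in_common_iff in_words by metis

text \<open>Only the first syllable is tested for being a power; a second syllable of that kind is
  detected after one more rotation.\<close>

definition reducible :: "(bool \<times> word) list \<Rightarrow> bool" where
  "reducible ws \<longleftrightarrow> 2 \<le> length ws \<and>
    (fst (hd ws) = fst (hd (tl ws)) \<or> in_common (fst (hd ws)) (snd (hd ws)))"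

definition contract :: "(bool \<times> word) list \<Rightarrow> (bool \<times> word) list" where
  "contract ws = (fst (hd (tl ws)),
    (if fst (hd ws) = fst (hd (tl ws)) then snd (hd ws)
     else word_pow (h (fst (hd (tl ws)))) (root (fst (hd ws)) (snd (hd ws))))
    @ snd (hd (tl ws))) # tl (tl ws)"

definition reduce_step :: "(bool \<times> word) list \<Rightarrow> (bool \<times> word) list" where
  "reduce_step ws = foldr (\<lambda>i vs. if reducible (rotate i ws) then contract (rotate i ws) else vs)
    [0..<length ws] ws"

text \<open>Every effective step shortens the list, so as many steps as there are syllables suffice
  and no unbounded search is needed.\<close>

definition reduce :: "(bool \<times> word) list \<Rightarrow> (bool \<times> word) list" where
  "reduce ws = (reduce_step ^^ length ws) ws"

text \<open>Two invariants of the reduction are kept together: \<open>word_conj\<close> serves the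
  soundness of the test and \<open>ceq\<close> its completeness.\<close>

definition equivalent :: "(bool \<times> word) list \<Rightarrow> (bool \<times> word) list \<Rightarrow> bool" where
  "equivalent us vs \<longleftrightarrow> valid us \<and> valid vs \<and> ceq (map cls us) (map cls vs) \<and> word_conj G (val us) (val vs)"

lemma equivalent_refl: "valid us \<Longrightarrow> equivalent us us"
  by (simp add: equivalent_def ceq_refl word_conj_refl val_words)

lemma equivalent_trans: "equivalent us vs \<Longrightarrow> equivalent vs ws \<Longrightarrow> equivalent us ws"
  unfolding equivalent_def using ceq_trans word_conj_trans[OF wf_G] by blast

lemma equivalent_rotate:
  assumes "valid us"
  shows "equivalent us (rotate n us)"
proof -
  let ?p = "take (n mod length us) us" and ?q = "drop (n mod length us) us"
  have us: "us = ?p @ ?q" "rotate n us = ?q @ ?p" by (simp_all add: rotate_drop_take)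
  have "valid (rotate n us)" using assms by (simp add: valid_def)
  moreover have "ceq (map cls us) (map cls (rotate n us))"
    using ceq_rotate[of "map cls ?p" "map cls ?q"] us by (metis map_append)
  moreover have "val us = val ?p @ val ?q" "val (rotate n us) = val ?q @ val ?p"
    using us by (metis val_simps(3))+
  then have "word_conj G (val us) (val (rotate n us))"
    using val_words[OF assms] word_conj_append_comm[OF wf_G, of "val ?p" "val ?q"] by simp
  ultimately show ?thesis using assms by (simp add: equivalent_def)
qed

lemma contract_equivalent:
  assumes "valid ws" "reducible ws"
  shows "equivalent ws (contract ws) \<and> length (contract ws) < length ws"
proof -
  obtain s u t v r where ws: "ws = (s, u) # (t, v) # r"
    using assms(2) by (cases ws rule: remdups_adj.cases) (auto simp: reducible_def)
  then have u: "u \<in> words (P s)" and v: "v \<in> words (P t)" using assms(1) by (auto simp: valid_def)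
  define w where "w = (if s = t then u else word_pow (h t) (root s u))"
  have c: "contract ws = (t, w @ v) # r" by (simp add: ws contract_def w_def)
  have w: "w \<in> words (P t)" using u by (cases "s = t") (simp_all add: w_def)
  have same: "same_elem (s, u) (t, w)"
  proof (cases "s = t")
    case False
    then have "word_eq (P s) u (word_pow (h s) (root s u))"
      using assms(2) u by (simp add: ws reducible_def in_common_iff)
    then show ?thesis using False by (auto simp: w_def intro!: same_elem_powI word_eq.refl)
  qed (use u in \<open>simp add: w_def word_eq.refl\<close>)
  then have "cls (s, u) = cls (t, w)" by (rule cls_eq)
  then have "ceq (map cls ws) (map cls (contract ws))"
    using ceq_merge[of "cls (t, w)" t "cls (t, v)" "[]" "map cls r"] w v by (simp add: c mul_cls)(simp add: ws)
  moreover have valid: "valid (contract ws)" using assms(1) w v unfolding c by (simp add: valid_def ws)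
  moreover have "word_eq G (emb s u) (emb t w)"
    using same
  proof (cases rule: same_elem_cases)
    case 1
    then show ?thesis using emb_word_eq by simp
  next
    case (2 k)
    then show ?thesis using emb_word_eq emb_h_pow by (meson word_eq.sym word_eq.trans)
  qed
  then have "word_eq G (val ws) (val (contract ws))"
    using word_eq_append[of G "emb s u" "emb t w" "[]" "emb t v @ val r"] val_words[OF valid]
    unfolding c by (simp add: ws)
  then have "word_conj G (val ws) (val (contract ws))" by (rule word_conj_word_eq[OF wf_G])
  moreover have "length (contract ws) < length ws" unfolding c by (simp add: ws)
  ultimately show ?thesis using assms(1) unfolding equivalent_def by blast
qed

lemma reduce_step_cases:
  obtains "reduce_step ws = ws" "\<And>i. \<not> reducible (rotate i ws)"
  | i where "reducible (rotate i ws)" "reduce_step ws = contract (rotate i ws)"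
proof -
  have "(\<forall>i\<in>set is. \<not> reducible (rotate i ws)) \<and> foldr (\<lambda>i vs. if reducible (rotate i ws)
      then contract (rotate i ws) else vs) is ws = ws \<or>
    (\<exists>i. reducible (rotate i ws) \<and> foldr (\<lambda>i vs. if reducible (rotate i ws)
      then contract (rotate i ws) else vs) is ws = contract (rotate i ws))" for "is"
    by (induction "is") auto
  from this[of "[0..<length ws]"] consider
    "\<forall>i<length ws. \<not> reducible (rotate i ws)" "reduce_step ws = ws"
    | i where "reducible (rotate i ws)" "reduce_step ws = contract (rotate i ws)"
    unfolding reduce_step_def by auto
  then show thesis
  proof cases
    case 1
    have "\<not> reducible (rotate i ws)" for i
    proof (cases "ws = []")
      case False
      then show ?thesis using 1(1) mod_less_divisor[of "length ws" i] by (simp add: rotate_conv_mod[of i ws])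
    qed (simp add: reducible_def)
    then show ?thesis using that(1) 1 by blast
  qed (rule that(2))
qed

lemma reduce_step_iterate:
  assumes "valid ws"
  shows "equivalent ws ((reduce_step ^^ n) ws) \<and>
    (length ((reduce_step ^^ n) ws) + n \<le> length ws \<or>
     (\<forall>i. \<not> reducible (rotate i ((reduce_step ^^ n) ws))))"
proof (induction n)
  case 0
  show ?case using equivalent_refl[OF assms] by simp
next
  case (Suc n)
  let ?vs = "(reduce_step ^^ n) ws"
  show ?case
  proof (cases rule: reduce_step_cases[of ?vs])
    case 1
    then show ?thesis using Suc by simp
  next
    case (2 i)
    have "equivalent ?vs (rotate i ?vs)"
      using Suc equivalent_rotate by (simp add: equivalent_def)
    then have "equivalent ws (rotate i ?vs)" using Suc equivalent_trans by blast
    moreover from this have c: "equivalent (rotate i ?vs) (contract (rotate i ?vs))"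
      "length (contract (rotate i ?vs)) < length ?vs"
      using contract_equivalent[OF _ 2(1)] by (auto simp: equivalent_def)
    ultimately have "equivalent ws (contract (rotate i ?vs))" using equivalent_trans by blast
    moreover have "length ?vs + n \<le> length ws" using Suc 2(1)
      by (metis rotate_back)
    ultimately show ?thesis using c(2) 2(2) by simp
  qed
qed

lemma cls_in_factor:
  assumes "cls (t, u) \<in> factor s" "s \<noteq> t" "u \<in> words (P t)"
  shows "in_common t u"
proof -
  obtain v where "cls (t, u) = cls (s, v)" using assms(1) by (rule factorE)
  then have "same_elem (t, u) (s, v)" using cls_eq_iff[of "(t, u)"] assms(3) by simp
  then show ?thesis using assms(2) by (cases rule: same_elem_cases) (auto intro: in_commonI)
qed

lemma normal_if_irreducible:
  assumes "valid ws" "\<And>i. \<not> reducible (rotate i ws)"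
  shows "normal (map cls ws)"
  unfolding normal_def
proof
  assume "\<exists>vs. merge (map cls ws) vs"
  then obtain n x y r s where *: "rotate n (map cls ws) = x # y # r" "x \<in> factor s" "y \<in> factor s"
    by (auto elim: merge.cases)
  then obtain t u t' v r' where ws: "rotate n ws = (t, u) # (t', v) # r'"
    and xy: "x = cls (t, u)" "y = cls (t', v)"
    by (auto simp: rotate_map Cons_eq_map_conv map_eq_Cons_conv)
  have "valid (rotate n ws)" using assms(1) by (simp add: valid_def)
  then have uv: "u \<in> words (P t)" "v \<in> words (P t')" by (auto simp: ws valid_def)
  have t: "t \<noteq> t'" "\<not> in_common t u"
    using assms(2)[of n] by (auto simp: ws reducible_def)
  \<comment> \<open>A merge of classes may happen in a factor other than the tags suggest. As
    \<open>u\<close> is no power, its tag is the right one; then \<open>v\<close> is read in the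
    wrong factor, hence is a power, and rotating it to the front exposes a redex.\<close>
  then have "s = t" using cls_in_factor[of t u s] * xy uv by blast
  then have "in_common t' v" using cls_in_factor[of t' v s] * xy uv t by blast
  moreover have "rotate (Suc n) ws = (t', v) # r' @ [(t, u)]" by (simp add: ws)
  ultimately show False using assms(2)[of "Suc n"] by (auto simp: reducible_def simp del: rotate_Suc)
qed

lemma reduce_correct:
  assumes "valid ws"
  shows "equivalent ws (reduce ws)" "normal (map cls (reduce ws))"
proof -
  show e: "equivalent ws (reduce ws)"
    using reduce_step_iterate[OF assms] by (simp add: reduce_def)
  then have v: "valid (reduce ws)" by (simp add: equivalent_def)
  \<comment> \<open>After \<open>length ws\<close> shortening steps nothing would be left, so
    nonemptiness rules out that alternative.\<close>
  then have "reduce ws \<noteq> []" by (simp add: valid_def)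
  then have "\<not> reducible (rotate i (reduce ws))" for i
    using reduce_step_iterate[OF assms, of "length ws"] by (auto simp: reduce_def)
  then show "normal (map cls (reduce ws))" using normal_if_irreducible[OF v] by blast
qed

text \<open>If \<open>q\<close> is \<open>p\<close> multiplied by the power \<open>e\<close> on the
  left and the power \<open>- f\<close> on the right, comparing exponent sums gives
  \<open>f - e\<close> as this quotient.\<close>

definition shift :: "(bool \<times> word) \<times> (bool \<times> word) \<Rightarrow> int" where
  "shift z = int_quot (exp_sum (snd (fst z)) - exp_sum (snd (snd z))) (exp_sum (h (fst (fst z))))"

text \<open>
  If conjugation by the \<open>k\<close>-th power turns one cyclic word into another syllable by syllable,
  the powers by which the syllables are twisted on both sides are determined by \<open>k\<close> and exponent
  sums. \<open>align\<close> moves these powers, up to \<open>k\<close>, into the syllables.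
\<close>

fun align :: "int \<Rightarrow> ((bool \<times> word) \<times> (bool \<times> word)) list \<Rightarrow> (bool \<times> word \<times> word) list" where
  "align e [] = []"
| "align e (z # zs) = (fst (fst z),
    word_pow (h (fst (fst z))) e @ snd (fst z) @ word_pow (h (fst (fst z))) (- (e + shift z)),
    snd (snd z)) # align (e + shift z) zs"

fun total_shift :: "int \<Rightarrow> ((bool \<times> word) \<times> (bool \<times> word)) list \<Rightarrow> int" where
  "total_shift e [] = e"
| "total_shift e (z # zs) = total_shift (e + shift z) zs"

definition conj_pow :: "int \<Rightarrow> bool \<times> word \<times> word \<Rightarrow> word" where
  "conj_pow k t = word_pow (h (fst t)) k @ fst (snd t) @ word_pow (h (fst t)) (- k)"

definition twist_eq :: "int \<Rightarrow> bool \<times> word \<times> word \<Rightarrow> bool" where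
  "twist_eq k t \<longleftrightarrow> word_eq (P (fst t)) (conj_pow k t) (snd (snd t))"

text \<open>If some modulus is 0, the exponent must be the corresponding representative, which the
  first sum bounds. Otherwise the common solutions are periodic modulo the product of the moduli, so
  one lies below it. Replacing 0 by 1 keeps the product positive.\<close>

definition bound :: "(bool \<times> word \<times> word) list \<Rightarrow> nat" where
  "bound ts = foldr (\<lambda>t m. nat (C (fst t) (fst (snd t)) (snd (snd t))) +
      nat (- C (fst t) (fst (snd t)) (snd (snd t))) + m) ts 0 +
    foldr (\<lambda>t m. (if N (fst t) (fst (snd t)) (snd (snd t)) = 0 then 1
      else N (fst t) (fst (snd t)) (snd (snd t))) * m) ts 1"

definition int_range :: "nat \<Rightarrow> int list" where
  "int_range n = concat (map (\<lambda>k. [int k, - int k]) [0..<Suc n])"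

definition twist_test :: "((bool \<times> word) \<times> (bool \<times> word)) list \<Rightarrow> bool" where
  "twist_test zs \<longleftrightarrow> list_all (\<lambda>z. fst (fst z) = fst (snd z)) zs \<and> total_shift 0 zs = 0 \<and>
    list_ex (\<lambda>k. list_all (\<lambda>t. eqw (fst t) (conj_pow k t) (snd (snd t))) (align 0 zs))
      (int_range (bound (align 0 zs)))"

text \<open>Elements of different factors can be conjugate only through a power of the common
  generator. Conjugation preserves exponent sums, so \<open>root\<close> gives the only possible
  exponent.\<close>

definition single_test :: "bool \<times> word \<Rightarrow> bool \<times> word \<Rightarrow> bool" where
  "single_test p q \<longleftrightarrow> (if fst p = fst q then cj (fst p) (snd p) (snd q)
    else cj (fst p) (snd p) (word_pow (h (fst p)) (root (fst p) (snd p))) \<and>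
      cj (fst q) (snd q) (word_pow (h (fst q)) (root (fst p) (snd p))))"

definition test :: "(bool \<times> word) list \<Rightarrow> (bool \<times> word) list \<Rightarrow> bool" where
  "test us vs \<longleftrightarrow> length us = length vs \<and>
    (if length us = 1 then single_test (hd us) (hd vs)
     else list_ex (\<lambda>i. twist_test (zip (rotate i us) vs)) [0..<length us])"

lemma align_words:
  assumes "\<forall>z\<in>set zs. fst (fst z) = fst (snd z) \<and> snd (fst z) \<in> words (P (fst (fst z))) \<and>
    snd (snd z) \<in> words (P (fst (snd z)))" "t \<in> set (align e zs)"
  shows "fst (snd t) \<in> words (P (fst t)) \<and> snd (snd t) \<in> words (P (fst t))"
  using assms
proof (induction zs arbitrary: e)
  case (Cons z zs)
  have IH: "t \<in> set (align (e + shift z) zs) \<Longrightarrow> ?case"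
    by (rule Cons.IH) (use Cons.prems in auto)
  have z: "fst (fst z) = fst (snd z)" "snd (fst z) \<in> words (P (fst (fst z)))"
    "snd (snd z) \<in> words (P (fst (snd z)))"
    using bspec[OF Cons.prems(1) list.set_intros(1)] by blast+
  from z(2,3) have "snd (fst z) \<in> words (P (fst (fst z)))" "snd (snd z) \<in> words (P (fst (fst z)))"
    unfolding z(1) .
  then show ?case using Cons.prems(2) IH by auto
qed simp

text \<open>Written as divisibility, membership in the coset also covers modulus 0, since 0 divides
  only 0.\<close>

lemma dvd_exponents:
  assumes "twist_eq k t" "fst (snd t) \<in> words (P (fst t))" "snd (snd t) \<in> words (P (fst t))"
  shows "twist_eq j t \<longleftrightarrow> int (N (fst t) (fst (snd t)) (snd (snd t))) dvd
    j - C (fst t) (fst (snd t)) (snd (snd t))"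
proof -
  have "j \<in> {j. twist_eq j t} \<longleftrightarrow> (\<exists>i. j = C (fst t) (fst (snd t)) (snd (snd t)) +
      i * int (N (fst t) (fst (snd t)) (snd (snd t))))"
    using exponents[OF assms(2,3) assms(1)[unfolded twist_eq_def conj_pow_def]]
    unfolding twist_eq_def conj_pow_def by auto
  then show ?thesis by (auto simp: dvd_def algebra_simps)
qed

lemma bound_correct:
  assumes "\<forall>t\<in>set ts. twist_eq k t \<and> fst (snd t) \<in> words (P (fst t)) \<and> snd (snd t) \<in> words (P (fst t))"
  shows "\<exists>j. nat \<bar>j\<bar> \<le> bound ts \<and> (\<forall>t\<in>set ts. twist_eq j t)"
proof -
  let ?C = "\<lambda>t. C (fst t) (fst (snd t)) (snd (snd t))"
  let ?N = "\<lambda>t. N (fst t) (fst (snd t)) (snd (snd t))"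
  let ?S = "\<lambda>ts. foldr (\<lambda>t m. nat (?C t) + nat (- ?C t) + m) ts 0"
  let ?M = "\<lambda>ts. foldr (\<lambda>t m. (if ?N t = 0 then 1 else ?N t) * m) ts 1"
  have S: "nat \<bar>?C t\<bar> \<le> ?S ts" if "t \<in> set ts" for t ts
    using that by (induction ts) (auto simp: abs_if)
  have M: "?N t dvd ?M ts" if "t \<in> set ts" "?N t \<noteq> 0" for t ts
    using that by (induction ts) (auto simp: dvd_mult2)
  have M_pos: "?M ts > 0" for ts by (induction ts) auto
  show ?thesis
  proof (cases "\<exists>t\<in>set ts. ?N t = 0")
    case True
    then obtain t where t: "t \<in> set ts" "?N t = 0" by blast
    then have "k = ?C t" using dvd_exponents[of k t k] assms by simp
    then have "nat \<bar>k\<bar> \<le> bound ts" using S[OF t(1)] by (simp add: bound_def)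
    then show ?thesis using assms by blast
  next
    case False
    \<comment> \<open>Each modulus divides the product, so reducing \<open>k\<close> modulo the
      product does not leave any of the cosets.\<close>
    define j where "j = k mod int (?M ts)"
    have "twist_eq j t" if t: "t \<in> set ts" for t
    proof -
      have "int (?N t) dvd int (?M ts)" using M t False by (simp only: int_dvd_int_iff) blast
      moreover have "int (?M ts) dvd j - k" unfolding mod_eq_dvd_iff[symmetric] j_def by simp
      moreover have "int (?N t) dvd k - ?C t" using dvd_exponents[of k t k] assms t by simp
      ultimately have "int (?N t) dvd (j - k) + (k - ?C t)" by (meson dvd_add dvd_trans)
      then show ?thesis using dvd_exponents[of k t j] assms t by simp
    qed
    moreover have "0 \<le> j" "j < int (?M ts)" using M_pos[of ts] by (simp_all add: j_def)
    then have "nat \<bar>j\<bar> \<le> bound ts" by (simp add: bound_def)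
    ultimately show ?thesis by blast
  qed
qed

lemma int_range_iff: "j \<in> set (int_range n) \<longleftrightarrow> nat \<bar>j\<bar> \<le> n"
proof
  assume *: "nat \<bar>j\<bar> \<le> n"
  then have "nat \<bar>j\<bar> \<in> set [0..<Suc n]" "j \<in> set [int (nat \<bar>j\<bar>), - int (nat \<bar>j\<bar>)]" by auto
  then show "j \<in> set (int_range n)" unfolding int_range_def by (simp only: set_concat set_map) blast
qed (auto simp: int_range_def)

lemma twist_test_iff:
  assumes "\<forall>z\<in>set zs. snd (fst z) \<in> words (P (fst (fst z))) \<and> snd (snd z) \<in> words (P (fst (snd z)))"
  shows "twist_test zs \<longleftrightarrow> (\<forall>z\<in>set zs. fst (fst z) = fst (snd z)) \<and> total_shift 0 zs = 0 \<and>
    (\<exists>k. \<forall>t\<in>set (align 0 zs). twist_eq k t)"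
proof (cases "\<forall>z\<in>set zs. fst (fst z) = fst (snd z)")
  case True
  then have words: "fst (snd t) \<in> words (P (fst t)) \<and> snd (snd t) \<in> words (P (fst t))"
    if "t \<in> set (align 0 zs)" for t
    using align_words[of zs t 0] assms that by blast
  then have "eqw (fst t) (conj_pow k t) (snd (snd t)) \<longleftrightarrow> twist_eq k t" if "t \<in> set (align 0 zs)" for k t
    using that by (simp add: twist_eq_def eqw_iff conj_pow_def)
  then have "list_ex (\<lambda>k. list_all (\<lambda>t. eqw (fst t) (conj_pow k t) (snd (snd t))) (align 0 zs))
      (int_range (bound (align 0 zs))) \<longleftrightarrow> (\<exists>k. \<forall>t\<in>set (align 0 zs). twist_eq k t)"
    using bound_correct[of "align 0 zs"] words by (simp add: list_ex_iff list_all_iff int_range_iff Bex_def) blast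
  then show ?thesis using True by (simp add: twist_test_def list_all_iff)
qed (auto simp: twist_test_def list_all_iff)

section \<open>Soundness of the test\<close>

definition H :: "int \<Rightarrow> word set" where
  "H k = elt G (emb True (h True)) [^]\<^bsub>presented_group G\<^esub> k"

lemma elt_emb_pow: "elt G (emb s (word_pow (h s) k)) = H k"
proof -
  have "elt G (emb s (word_pow (h s) k)) = elt G (emb True (word_pow (h True) k))"
    using emb_h_pow by (simp add: elt_eq_iff)
  then show ?thesis by (simp add: H_def emb_word_pow elt_word_pow)
qed

lemma group_G: "group (presented_group G)"
  by (rule group_presented_group) simp

lemma H_closed: "H k \<in> carrier (presented_group G)"
  using elt_emb_pow[of True k] elt_carrier[of "emb True (word_pow (h True) k)" G] by simp

lemma H_add: "H j \<otimes>\<^bsub>presented_group G\<^esub> H k = H (j + k)"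
  using group.int_pow_mult[OF group_G elt_carrier[of "emb True (h True)"]] by (simp add: H_def)

lemma H_0: "H 0 = \<one>\<^bsub>presented_group G\<^esub>"
  by (simp add: H_def)

text \<open>The powers between neighbouring syllables cancel in the product. Nothing is assumed
  about the values of \<open>shift\<close>, so inexact quotients cannot harm soundness.\<close>

lemma twisted_val:
  assumes "\<forall>z\<in>set zs. fst (fst z) = fst (snd z)"
    "\<forall>z\<in>set zs. snd (fst z) \<in> words (P (fst (fst z))) \<and> snd (snd z) \<in> words (P (fst (snd z)))"
    "\<forall>t\<in>set (align e zs). twist_eq k t"
  shows "val (map fst zs) \<in> words G \<and> val (map snd zs) \<in> words G \<and>
    H (k + e) \<otimes>\<^bsub>presented_group G\<^esub> elt G (val (map fst zs)) \<otimes>\<^bsub>presented_group G\<^esub> H (- (k + total_shift e zs))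
    = elt G (val (map snd zs))"
  using assms
proof (induction zs arbitrary: e)
  case Nil
  interpret group "presented_group G" by (rule group_G)
  have "elt G [] = \<one>\<^bsub>presented_group G\<^esub>" by (simp add: presented_group_def)
  then show ?case using H_closed by (simp add: H_add H_0)
next
  case (Cons z zs)
  interpret group "presented_group G" by (rule group_G)
  obtain s u t v where z: "z = ((s, u), (t, v))" by (metis prod.collapse)
  with Cons.prems(1) have t: "t = s" by simp
  have u: "u \<in> words (P s)" and v: "v \<in> words (P s)" using Cons.prems(2) by (simp_all add: z t)
  define e' where "e' = e + shift z"
  have IH: "val (map fst zs) \<in> words G" "val (map snd zs) \<in> words G"
    "H (k + e') \<otimes>\<^bsub>presented_group G\<^esub> elt G (val (map fst zs)) \<otimes>\<^bsub>presented_group G\<^esub> H (- (k + total_shift e' zs))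
    = elt G (val (map snd zs))"
    using Cons.IH[of e'] Cons.prems by (simp_all add: e'_def)
  have "word_eq (P s) (word_pow (h s) k @ (word_pow (h s) e @ u @ word_pow (h s) (- e')) @ word_pow (h s) (- k)) v"
    using Cons.prems(3) by (simp add: twist_eq_def conj_pow_def e'_def z t)
  from emb_word_eq[OF this]
  have "elt G (emb s v) = elt G (emb s (word_pow (h s) k) @ emb s (word_pow (h s) e) @ emb s u @
      emb s (word_pow (h s) (- e')) @ emb s (word_pow (h s) (- k)))"
    using u v by (simp add: elt_eq_iff word_eq.sym)
  also have "\<dots> = H k \<otimes>\<^bsub>presented_group G\<^esub> (H e \<otimes>\<^bsub>presented_group G\<^esub> (elt G (emb s u) \<otimes>\<^bsub>presented_group G\<^esub>
      (H (- e') \<otimes>\<^bsub>presented_group G\<^esub> H (- k))))"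
    unfolding elt_emb_pow[of s, symmetric] using u by (simp add: mult_elt)
  also have "H (- e') \<otimes>\<^bsub>presented_group G\<^esub> H (- k) = H (- (k + e'))"
    by (simp add: H_add add.commute)
  finally have V: "elt G (emb s v) = H (k + e) \<otimes>\<^bsub>presented_group G\<^esub> elt G (emb s u) \<otimes>\<^bsub>presented_group G\<^esub> H (- (k + e'))"
    using H_closed elt_carrier[of "emb s u" G] u
    by (simp add: m_assoc flip: H_add)
  let ?U = "elt G (emb s u)" and ?W = "elt G (val (map fst zs))" and ?T = "H (- (k + total_shift e' zs))"
  have c: "?U \<in> carrier (presented_group G)" "?W \<in> carrier (presented_group G)"
    using u IH(1) by (simp_all add: elt_carrier)
  have "H (- (k + e')) \<otimes>\<^bsub>presented_group G\<^esub> (H (k + e') \<otimes>\<^bsub>presented_group G\<^esub> (?W \<otimes>\<^bsub>presented_group G\<^esub> ?T))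
      = ?W \<otimes>\<^bsub>presented_group G\<^esub> ?T"
    using c H_closed by (simp add: m_assoc[symmetric] H_add H_0)
  then have "elt G (emb s v) \<otimes>\<^bsub>presented_group G\<^esub> elt G (val (map snd zs)) =
      H (k + e) \<otimes>\<^bsub>presented_group G\<^esub> (?U \<otimes>\<^bsub>presented_group G\<^esub> ?W) \<otimes>\<^bsub>presented_group G\<^esub> ?T"
    unfolding V IH(3)[symmetric] using c H_closed by (simp add: m_assoc)
  then show ?case using u v IH(1,2) by (simp add: z t e'_def mult_elt)
qed

lemma zip_valid:
  assumes "valid us" "valid vs" "z \<in> set (zip us vs)"
  shows "snd (fst z) \<in> words (P (fst (fst z))) \<and> snd (snd z) \<in> words (P (fst (snd z)))"
proof -
  have "(fst z, snd z) \<in> set (zip us vs)" using assms(3) by simp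
  then have "fst z \<in> set us" "snd z \<in> set vs" by (rule set_zip_leftD, rule set_zip_rightD)
  then show ?thesis using assms(1,2) by (simp add: valid_def)
qed

theorem test_sound:
  assumes "valid us" "valid vs" "test us vs"
  shows "word_conj G (val us) (val vs)"
proof (cases "length us = 1")
  case True
  moreover from this have "length vs = 1" using assms(3) by (simp add: test_def)
  ultimately obtain p q where "us = [p]" "vs = [q]" by (auto simp: length_Suc_conv)
  then obtain s u t v where us: "us = [(s, u)]" and vs: "vs = [(t, v)]" by (metis prod.collapse)
  then have uv: "u \<in> words (P s)" "v \<in> words (P t)" using assms by (simp_all add: valid_def)
  have *: "single_test (s, u) (t, v)" using assms(3) us vs by (simp add: test_def)
  show ?thesis
  proof (cases "s = t")
    case True
    then have "word_conj (P s) u v" using * uv cj by (simp add: single_test_def)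
    then show ?thesis using emb_word_conj us vs True by simp
  next
    case False
    define k where "k = root s u"
    have "word_conj (P s) u (word_pow (h s) k)" "word_conj (P t) v (word_pow (h t) k)"
      using * False uv cj by (simp_all add: single_test_def k_def)
    then have uk: "word_conj G (emb s u) (emb s (word_pow (h s) k))"
      and vk: "word_conj G (emb t v) (emb t (word_pow (h t) k))"
      by (simp_all add: emb_word_conj)
    have k: "word_conj G (emb s (word_pow (h s) k)) (emb t (word_pow (h t) k))"
      by (intro word_conj_word_eq emb_h_pow) simp
    show ?thesis
      using word_conj_trans[OF wf_G word_conj_trans[OF wf_G uk k] word_conj_sym[OF wf_G vk]] us vs by simp
  qed
next
  case False
  then obtain i where i: "twist_test (zip (rotate i us) vs)" and len: "length us = length vs"
    using assms(3) by (auto simp: test_def list_ex_iff)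
  let ?ps = "rotate i us" and ?zs = "zip (rotate i us) vs"
  have valid: "valid ?ps" using assms(1) by (simp add: valid_def)
  have words: "\<forall>z\<in>set ?zs. snd (fst z) \<in> words (P (fst (fst z))) \<and> snd (snd z) \<in> words (P (fst (snd z)))"
    using zip_valid[OF valid assms(2)] by blast
  obtain k where k: "\<forall>z\<in>set ?zs. fst (fst z) = fst (snd z)" "total_shift 0 ?zs = 0"
    "\<forall>t\<in>set (align 0 ?zs). twist_eq k t"
    using i twist_test_iff[OF words] by blast
  let ?g = "emb True (word_pow (h True) k)"
  have "H k \<otimes>\<^bsub>presented_group G\<^esub> elt G (val ?ps) \<otimes>\<^bsub>presented_group G\<^esub> H (- k) = elt G (val vs)"
    using twisted_val[OF k(1) words k(3)] k(2) len by simp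
  moreover have "H (- k) = elt G (inv_word ?g)"
    using elt_inv_word[of G ?g] group.int_pow_neg[OF group_G elt_carrier[of "emb True (h True)"], of k]
    by (simp add: elt_emb_pow) (simp add: H_def)
  ultimately have "elt G (?g @ val ?ps @ inv_word ?g) = elt G (val vs)"
    using val_words[OF valid] elt_emb_pow[of True k]
      mult_elt[of G ?g "val ?ps"] mult_elt[of G "?g @ val ?ps" "inv_word ?g"] by simp
  then have "word_conj G (val ?ps) (val vs)"
    unfolding word_conj_def using val_words[OF valid] by (intro bexI[of _ ?g]) (simp_all add: elt_eq_iff)
  moreover have "word_conj G (val us) (val ?ps)"
    using equivalent_rotate[OF assms(1)] by (simp add: equivalent_def)
  ultimately show ?thesis using word_conj_trans[OF wf_G] by blast
qed

section \<open>Completeness of the test\<close>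

lemma conj_by_word_conj:
  assumes "u \<in> words (P s)" "v \<in> words (P s)" "conj_by s (cls (s, u)) (cls (s, v))"
  shows "word_conj (P s) u v"
proof -
  obtain w where w: "w \<in> words (P s)" "cls (s, v) = mul (mul (iv (cls (s, w))) (cls (s, u))) (cls (s, w))"
    using assms(3) by (auto simp: conj_by_def factor_def)
  then have "word_eq (P s) v (inv_word w @ u @ w)"
    using assms by (simp add: iv_cls mul_cls cls_eq_iff)
  then show ?thesis using w(1) unfolding word_conj_def
    by (intro bexI[of _ "inv_word w"]) (simp_all add: inv_word_inv_word word_eq.sym)
qed

text \<open>If the conjugation happens in the other factor, \<open>x\<close> lies in both and is
  itself a power; powers conjugate in one factor are equal, so \<open>x\<close> is
  \<open>pw k\<close>.\<close>

lemma conj_by_pw: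
  assumes "x \<in> factor s" "conj_by t x (pw k)"
  shows "conj_by s x (pw k)"
proof (cases "s = t")
  case False
  then obtain j where "x = pw j" using assms conj_by_closed common_elem by metis
  then show ?thesis using assms conj_by_c conj_by_refl c_closed by metis
qed (use assms in simp)

text \<open>The factor in which \<open>slides_singleton\<close> finds a conjugation may differ from
  the tags. A syllable with the wrong tag then lies in both factors, and the conjugation can be
  routed through a power instead.\<close>

lemma single_test_complete:
  assumes "u \<in> words (P s)" "v \<in> words (P t)" "slide\<^sup>*\<^sup>* [cls (s, u)] [cls (t, v)]"
  shows "single_test (s, u) (t, v)"
proof -
  let ?x = "cls (s, u)" and ?y = "cls (t, v)"
  have xy: "?x \<in> factor s" "?y \<in> factor t" using assms by auto
  have "(s = t \<and> conj_by s ?x ?y) \<or> (\<exists>k s t. conj_by s ?x (pw k) \<and> conj_by t ?y (pw k))"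
  proof -
    have pw: "conj_by r (pw k) (pw k)" for r k by (simp add: conj_by_refl)
    consider r where "conj_by r ?x ?y" | "\<exists>k s t. conj_by s ?x (pw k) \<and> conj_by t ?y (pw k)"
      using slides_singleton[OF assms(3) _ xy(1)] by auto
    then show ?thesis
    proof cases
      case 1
      show ?thesis
      proof (cases "r = s")
        case True
        show ?thesis
        proof (cases "s = t")
          case st: False
          have "?y \<in> factor s" using conj_by_closed[OF 1] True by simp
          then obtain k where "?y = pw k" using common_elem[OF _ xy(2) st] by blast
          then have "conj_by s ?x (pw k)" "conj_by s ?y (pw k)" using 1 True pw by simp_all
          then show ?thesis by blast
        qed (use 1 True in simp)
      next
        case False
        then obtain k where "?x = pw k" using conj_by_closed[OF 1] common_elem[OF _ xy(1)] by blast
        then have "conj_by s ?x (pw k)" "conj_by r ?y (pw k)"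
          using pw conj_by_sym[OF 1] by simp_all
        then show ?thesis by blast
      qed
    qed blast
  qed
  then consider "s = t" "conj_by s ?x ?y" | k where "conj_by s ?x (pw k)" "conj_by t ?y (pw k)"
    using conj_by_pw xy by blast
  then show ?thesis
  proof cases
    case 1
    then have "word_conj (P s) u v" using conj_by_word_conj[of u s v] assms by simp
    then show ?thesis using 1 assms by (simp add: single_test_def cj)
  next
    case (2 k)
    have *: "word_conj (P s) u (word_pow (h s) k)" "word_conj (P t) v (word_pow (h t) k)"
      using conj_by_word_conj[of u s "word_pow (h s) k"] conj_by_word_conj[of v t "word_pow (h t) k"]
        2 assms by (simp_all flip: pw_eq)
    have k: "root s u = k"
      using word_conj_exp_sum[OF exp_inv *(1)] by (intro root_eqI) (simp add: exp_sum_word_pow)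
    have "cj s u (word_pow (h s) (root s u))" "cj t v (word_pow (h t) (root s u))"
      unfolding k using cj[OF assms(1) h_pow_words] cj[OF assms(2) h_pow_words] * by simp_all
    \<comment> \<open>With equal tags both words are conjugate to the same power in one factor,
      hence to each other.\<close>
    moreover have "cj s u v" if "s = t"
    proof -
      have v: "v \<in> words (P s)" and vk: "word_conj (P s) v (word_pow (h s) k)"
        using assms(2) *(2) unfolding that by simp_all
      show ?thesis
        using word_conj_trans[OF wf *(1) word_conj_sym[OF wf vk]] cj[OF assms(1) v] by simp
    qed
    ultimately show ?thesis unfolding single_test_def fst_conv snd_conv by (cases "s = t") simp_all
  qed
qed

lemma word_pow_twist:
  assumes "u \<in> words (P s)"
  shows "word_eq (P s) (word_pow (h s) (k + e) @ u @ word_pow (h s) (- (k + f)))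
    (word_pow (h s) k @ (word_pow (h s) e @ u @ word_pow (h s) (- f)) @ word_pow (h s) (- k))"
proof -
  have "word_eq (P s) (word_pow (h s) (- (k + f))) (word_pow (h s) (- f) @ word_pow (h s) (- k))"
    using word_pow_add[OF wf h_words, of s "- f" "- k"] by (simp add: algebra_simps)
  from word_eq_append2[OF wf word_pow_add[OF wf h_words] word_eq_append2[OF wf word_eq.refl[OF assms] this]]
  show ?thesis by simp
qed

text \<open>A syllable that is no power keeps its factor under twisting, so the tags agree and the
  equation holds in that factor. Its exponent sums then determine the next exponent, and the
  induction proceeds along the chain.\<close>

lemma twisted_align:
  assumes "length ps = length qs"
    "\<forall>p\<in>set ps. snd p \<in> words (P (fst p)) \<and> (\<forall>k. cls p \<noteq> pw k)"
    "\<forall>q\<in>set qs. snd q \<in> words (P (fst q))"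
    "twisted (k + e) (map cls ps) (map cls qs) l"
  shows "(\<forall>z\<in>set (zip ps qs). fst (fst z) = fst (snd z)) \<and> l = k + total_shift e (zip ps qs) \<and>
    (\<forall>t\<in>set (align e (zip ps qs)). twist_eq k t)"
  using assms
proof (induction ps qs arbitrary: e rule: list_induct2)
  case (Cons p ps q qs)
  obtain s u t v where p: "p = (s, u)" and q: "q = (t, v)" by (cases p, cases q)
  have u: "u \<in> words (P s)" and v: "v \<in> words (P t)" and ncommon: "\<And>k. cls (s, u) \<noteq> pw k"
    using Cons.prems by (auto simp: p q)
  obtain m where m: "cls q = mul (mul (pw (k + e)) (cls p)) (pw (- m))"
    and tw: "twisted m (map cls ps) (map cls qs) l"
    using Cons.prems(3) by auto
  let ?w = "word_pow (h s) (k + e) @ u @ word_pow (h s) (- m)"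
  have w: "?w \<in> words (P s)" using u by simp
  have cls: "cls (t, v) = cls (s, ?w)"
    using m u by (simp add: p q pw_eq[of _ s] mul_cls)
  have st: "s = t \<and> word_eq (P s) v ?w"
  proof -
    have "same_elem (t, v) (s, ?w)" using cls cls_eq_iff[of "(t, v)"] v by simp
    then show ?thesis
    proof (cases rule: same_elem_cases)
      \<comment> \<open>Representatives linked through a power would make the twisted syllable a
        power, and therefore \<open>p\<close> as well.\<close>
      case (2 j)
      then have "cls (t, v) = pw j" unfolding pw_eq[of j t] by (intro cls_eq) simp
      then have "mul (mul (pw (k + e)) (cls (s, u))) (pw (- m)) = pw j" using m by (simp add: p q)
      then show ?thesis using common_from_twist[OF factor_cls[OF u]] ncommon by blast
    qed simp
  qed
  have "exp_sum v = exp_sum ?w" using st exp_sum_eq by blast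
  \<comment> \<open>This equation makes the quotient in \<open>shift\<close> exact and fixes
    \<open>m\<close> in terms of \<open>k\<close>, \<open>e\<close> and the two words.\<close>
  then have "exp_sum u - exp_sum v = (m - (k + e)) * exp_sum (h s)"
    by (simp add: exp_sum_word_pow algebra_simps)
  then have "shift (p, q) = m - (k + e)"
    by (simp add: shift_def p q int_quot_mult exp_h)
  then have m_eq: "m = k + (e + shift (p, q))" by simp
  have "word_eq (P s) (word_pow (h s) k @ (word_pow (h s) e @ u @ word_pow (h s) (- (e + shift (p, q)))) @ word_pow (h s) (- k)) v"
    using word_pow_twist[OF u, of k e "e + shift (p, q)"] st unfolding m_eq
    by (meson word_eq.sym word_eq.trans)
  then have "twist_eq k (s, word_pow (h s) e @ u @ word_pow (h s) (- (e + shift (p, q))), v)"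
    by (simp add: twist_eq_def conj_pow_def)
  moreover have "twisted (k + (e + shift (p, q))) (map cls ps) (map cls qs) l"
    using tw m_eq by simp
  then have "(\<forall>z\<in>set (zip ps qs). fst (fst z) = fst (snd z)) \<and>
    l = k + total_shift (e + shift (p, q)) (zip ps qs) \<and>
    (\<forall>t\<in>set (align (e + shift (p, q)) (zip ps qs)). twist_eq k t)"
    using Cons.IH Cons.prems by simp
  ultimately show ?case using st by (simp add: p q)
qed simp

text \<open>A power lies in both factors and so merges with whatever follows it on the circle; two
  syllables are needed for a neighbour to exist.\<close>

lemma normal_not_common:
  assumes "normal us" "2 \<le> length us" "proper us" "x \<in> set us"
  shows "x \<noteq> pw k"
proof
  assume x: "x = pw k"
  obtain p q where us: "us = p @ x # q" using assms(4) by (meson split_list)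
  then obtain y r where y: "q @ p = y # r"
    using assms(2) by (cases "q @ p") auto
  then have "y \<in> set us" using us by (metis Un_iff list.set_intros(1) set_append set_ConsD insert_iff list.simps(15))
  then obtain t where "y \<in> factor t" using assms(3) by (auto simp: proper_def)
  then have "merge (x # y # r) (mul x y # r)" using mergeI[of x t y "[]" r] x by simp
  then have "merge ((x # q) @ p) (mul x y # r)" using y by simp
  then have "merge us (mul x y # r)" using us merge_append_comm[of "x # q" p] by simp
  then show False using assms(1) by (auto simp: normal_def)
qed

theorem test_complete:
  assumes "valid us" "valid vs" "normal (map cls us)" "normal (map cls vs)"
    "ceq (map cls us) (map cls vs)"
  shows "test us vs"
proof -
  have slide: "slide\<^sup>*\<^sup>* (map cls us) (map cls vs)"
    using church_rosser_modulo assms(3-5) unfolding ceq_def by blast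
  then have len: "length us = length vs" using rtranclp_S_measure by fastforce
  show ?thesis
  proof (cases "length us = 1")
    case True
    then obtain s u t v where us: "us = [(s, u)]" and vs: "vs = [(t, v)]"
      using len by (auto simp: length_Suc_conv)
    then have "single_test (s, u) (t, v)"
      using single_test_complete slide assms(1,2) by (simp add: valid_def)
    then show ?thesis by (simp add: test_def us vs)
  next
    case False
    moreover have "us \<noteq> []" using assms(1) by (simp add: valid_def)
    ultimately have len2: "2 \<le> length us" by (cases us rule: remdups_adj.cases) auto
    have proper: "proper (map cls us)" by (rule proper_cls[OF assms(1)])
    then obtain n k where "twisted k (rotate n (map cls us)) (map cls vs) k"
      using slides_twisted[OF slide assms(3)] len2 by (auto simp: proper_def)
    then have tw: "twisted (k + 0) (map cls (rotate n us)) (map cls vs) k" by (simp add: rotate_map)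
    have "\<forall>p\<in>set (rotate n us). snd p \<in> words (P (fst p)) \<and> (\<forall>k. cls p \<noteq> pw k)"
      using normal_not_common[OF assms(3) _ proper] len2 assms(1) by (auto simp: valid_def)
    from twisted_align[OF _ this _ tw] assms(2) len
    have *: "\<forall>z\<in>set (zip (rotate n us) vs). fst (fst z) = fst (snd z)"
      "k = k + total_shift 0 (zip (rotate n us) vs)"
      "\<forall>t\<in>set (align 0 (zip (rotate n us) vs)). twist_eq k t"
      by (simp_all add: valid_def)
    have "valid (rotate n us)" using assms(1) by (simp add: valid_def)
    then have "twist_test (zip (rotate n us) vs)"
      using * by (subst twist_test_iff) (use zip_valid[OF _ assms(2)] in blast, simp, blast)
    \<comment> \<open>Rotations repeat with period \<open>length us\<close>, so the rotation that
      was found is among the finitely many that \<open>test\<close> tries.\<close>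
    then have "twist_test (zip (rotate (n mod length us) us) vs)" by (simp flip: rotate_conv_mod)
    moreover have "n mod length us < length us" using \<open>us \<noteq> []\<close> by simp
    ultimately show ?thesis using len False unfolding test_def
      by (auto simp: list_ex_iff intro!: bexI[of _ "n mod length us"])
  qed
qed

theorem conj_decision:
  assumes "u \<in> words G" "v \<in> words G"
  shows "test (reduce (syllables u)) (reduce (syllables v)) \<longleftrightarrow> word_conj G u v"
proof -
  let ?u = "reduce (syllables u)" and ?v = "reduce (syllables v)"
  note u = reduce_correct[OF valid_syllables[OF assms(1)]]
  note v = reduce_correct[OF valid_syllables[OF assms(2)]]
  have valid: "valid ?u" "valid ?v" using u(1) v(1) by (simp_all add: equivalent_def)
  have conj: "word_conj G u (val ?u)" "word_conj G v (val ?v)"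
    using u(1) v(1) by (simp_all add: equivalent_def val_syllables)
  have ceq: "ceq (cyc u) (map cls ?u)" "ceq (cyc v) (map cls ?v)"
    using u(1) v(1) by (simp_all add: equivalent_def cyc_def)
  show ?thesis
  proof
    assume "test ?u ?v"
    from test_sound[OF valid this] conj show "word_conj G u v"
      using word_conj_trans[OF wf_G] word_conj_sym[OF wf_G] by blast
  next
    assume "word_conj G u v"
    then have "ceq (map cls ?u) (map cls ?v)"
      using word_conj_ceq ceq ceq_trans ceq_sym by blast
    then show "test ?u ?v" by (rule test_complete[OF valid u(2) v(2)])
  qed
qed

end

section \<open>Computability of the decision procedure\<close>

text \<open>A function on truth values has two values, so any dependence on the tag is computable,
  in particular that of the fixed words \<open>h\<close>.\<close>

lemma computable_bool_fun:
  fixes g :: "bool \<Rightarrow> 'b::encodable"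
  assumes "computable f"
  shows "computable (\<lambda>x. g (f x))"
proof -
  have "g (f x) = (if f x then g True else g False)" for x by simp
  then show ?thesis by (simp only:, intro computable_intros assms)
qed

lemma computable_inv_word [computable_intros]:
  assumes "computable f"
  shows "computable (\<lambda>x. inv_word (f x))"
proof -
  have "inv_word w = rev (map (\<lambda>l. (fst l, \<not> snd l)) w)" for w
    by (simp add: inv_word_def apsnd_def map_prod_def case_prod_unfold)
  then show ?thesis by (simp only:, intro computable_intros assms)
qed

lemma computable_exp_sum [computable_intros]:
  assumes "computable f"
  shows "computable (\<lambda>x. exp_sum (f x))"
proof -
  have "exp_sum w = foldr (\<lambda>l e. (if snd l then 1 else - 1) + e) w 0" for w
    by (induction w) auto
  then show ?thesis by (simp only:, intro computable_intros assms)
qed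

lemma computable_word_pow [computable_intros]:
  assumes "computable f" "computable g"
  shows "computable (\<lambda>x. word_pow (f x) (g x))"
  unfolding word_pow_def by (intro computable_intros assms[THEN computable_comp])

lemma computable_letters: "computable letters"
  unfolding letters_def by (intro computable_intros)

lemma computable_syllables [computable_intros]:
  assumes "computable f"
  shows "computable (\<lambda>x. syllables (f x))"
  unfolding syllables_def by (intro computable_intros computable_comp[OF computable_letters] assms)

context amalgam_decision
begin

lemmas [computable_intros] = computable_comp3[OF computable_cj]
  computable_comp3[OF computable_C] computable_comp3[OF computable_N]

lemma computable_h [computable_intros]: "computable f \<Longrightarrow> computable (\<lambda>x. h (f x))"
  by (rule computable_bool_fun)

lemma computable_eqw [computable_intros]:
  assumes "computable f" "computable g" "computable k"
  shows "computable (\<lambda>x. eqw (f x) (g x) (k x))"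
  unfolding eqw_def by (intro computable_intros assms)

lemma computable_root [computable_intros]:
  assumes "computable f" "computable g"
  shows "computable (\<lambda>x. root (f x) (g x))"
  unfolding root_def by (intro computable_intros assms)

lemma computable_reducible [computable_intros]:
  assumes "computable f"
  shows "computable (\<lambda>x. reducible (f x))"
  unfolding reducible_def in_common_def by (intro computable_intros assms)

lemma computable_contract [computable_intros]:
  assumes "computable f"
  shows "computable (\<lambda>x. contract (f x))"
  unfolding contract_def by (intro computable_intros assms)

lemma computable_reduce_step [computable_intros]:
  assumes "computable f"
  shows "computable (\<lambda>x. reduce_step (f x))"
  unfolding reduce_step_def by (intro computable_intros assms[THEN computable_comp])

lemma computable_reduce [computable_intros]:
  assumes "computable f"
  shows "computable (\<lambda>x. reduce (f x))"
  unfolding reduce_def by (intro computable_intros assms)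

lemma computable_shift [computable_intros]:
  assumes "computable f"
  shows "computable (\<lambda>x. shift (f x))"
  unfolding shift_def by (intro computable_intros assms)

text \<open>Both functions recurse with a changing exponent; they are the two components of one left
  fold whose state carries the running exponent.\<close>

lemma computable_align_total:
  "computable (\<lambda>zs. align 0 zs)" "computable (\<lambda>zs. total_shift 0 zs)"
proof -
  define step where "step = (\<lambda>p z. (fst p + shift z, snd p @ [(fst (fst z),
    word_pow (h (fst (fst z))) (fst p) @ snd (fst z) @
      word_pow (h (fst (fst z))) (- (fst p + shift z)), snd (snd z))]))"
  have eq: "foldl step (e, ts) zs = (total_shift e zs, ts @ align e zs)" for e ts zs
    by (induction zs arbitrary: e ts) (auto simp: step_def)
  have "computable (\<lambda>zs. foldl step (0, []) zs)"
    unfolding step_def by (intro computable_intros)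
  then show "computable (\<lambda>zs. align 0 zs)" "computable (\<lambda>zs. total_shift 0 zs)"
    using computable_snd computable_fst unfolding eq by fastforce+
qed

lemma computable_conj_pow [computable_intros]:
  assumes "computable f" "computable g"
  shows "computable (\<lambda>x. conj_pow (f x) (g x))"
  unfolding conj_pow_def by (intro computable_intros assms)

lemma computable_bound [computable_intros]:
  assumes "computable f"
  shows "computable (\<lambda>x. bound (f x))"
  unfolding bound_def by (intro computable_intros assms[THEN computable_comp])

lemma computable_int_range [computable_intros]:
  assumes "computable f"
  shows "computable (\<lambda>x. int_range (f x))"
  unfolding int_range_def by (intro computable_intros assms[THEN computable_comp])

lemma computable_twist_test [computable_intros]:
  assumes "computable f"
  shows "computable (\<lambda>x. twist_test (f x))"
  unfolding twist_test_def
  by (intro computable_intros computable_align_total[THEN computable_comp] assms[THEN computable_comp])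

lemma computable_test [computable_intros]:
  assumes "computable f" "computable g"
  shows "computable (\<lambda>x. test (f x) (g x))"
  unfolding test_def single_test_def by (intro computable_intros assms[THEN computable_comp])

end

text \<open>\<open>word_code\<close> numbers letters differently from \<open>enc\<close> on pairs,
  so inputs have to be translated. The translation is defined on every natural number.\<close>

definition decode_word :: "nat \<Rightarrow> word" where
  "decode_word n = map (\<lambda>m. (m div 2, odd m)) (list_decode n)"

lemma decode_word_code: "decode_word (word_code w) = w"
  by (induction w) (auto simp: decode_word_def word_code_def letter_code_def)

lemma computable_decode_word: "computable decode_word"
proof -
  have "enc (list_decode n) = n" for n
    by (simp add: enc_list_def enc_nat_def[abs_def])
  then have "computable list_decode"
    by (intro computable_transfer[OF computable_id]) (simp add: enc_nat_def)
  then show ?thesis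
    unfolding decode_word_def by (intro computable_intros)
qed

lemma computable_word_code [computable_intros]:
  assumes "computable f"
  shows "computable (\<lambda>x. word_code (f x))"
proof -
  have "word_code w = enc (map (\<lambda>l. if snd l then Suc (2 * fst l) else 2 * fst l) w)" for w
    by (simp add: word_code_def enc_list_def enc_nat_def[abs_def] letter_code_def case_prod_unfold)
      (auto intro!: arg_cong[of _ _ list_encode])
  then show ?thesis
    by (simp only:, intro computable_intros computable_comp[OF computable_enc] assms)
qed

lemma computable_word_oracle:
  assumes "recursive 2 D" "computable f" "computable g"
  shows "computable (\<lambda>x. D [word_code (f x), word_code (g x)])"
proof -
  have "recursive 2 (\<lambda>xs. D [xs ! 0, xs ! 1])"
    by (rule recursive_comp2[OF assms(1) recursive_proj_2])
  from computable_nat_recursive2[OF this computable_word_code[OF assms(2)] computable_word_code[OF assms(3)]]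
  show ?thesis .
qed

lemma computable_int_decode:
  assumes "computable f"
  shows "computable (\<lambda>x. int_decode (f x))"
  by (rule computable_transfer[OF assms]) (simp add: enc_int_def enc_nat_def)

lemma recursive_word_relation:
  assumes "computable (\<lambda>p. R (fst p) (snd p))"
  shows "\<exists>D. recursive 2 D \<and> (\<forall>u v. D [word_code u, word_code v] = of_bool (R u v))"
proof -
  have "computable (\<lambda>p. R (decode_word (fst p)) (decode_word (snd p)))"
    by (intro computable_comp2[OF assms] computable_comp[OF computable_decode_word] computable_intros)
  then obtain F where F: "recursive 1 F"
    "\<And>p. F [enc p] = enc (R (decode_word (fst p)) (decode_word (snd p)))"
    by (rule computableE) blast
  have "recursive 2 (\<lambda>xs. F [prod_encode (xs ! 0, xs ! 1)])"
    by (intro recursive_comp1[OF F(1)] recursive_prod_encode recursive_proj_2)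
  moreover have "F [prod_encode (word_code u, word_code v)] = of_bool (R u v)" for u v
    using F(2)[of "(word_code u, word_code v)"] by (simp add: decode_word_code enc_nat_def enc_bool_def)
  ultimately show ?thesis by (intro exI[of _ "\<lambda>xs. F [prod_encode (xs ! 0, xs ! 1)]"]) simp
qed

lemma computable_if_bool:
  assumes "computable (\<lambda>p. f (fst p) (snd p))" "computable (\<lambda>p. g (fst p) (snd p))"
  shows "computable (\<lambda>p. (if fst p then f else g) (fst (snd p)) (snd (snd p)))"
proof -
  have "(if s then f else g) u v = (if s then f u v else g u v)" for s u v by simp
  then show ?thesis
    by (simp only:, intro computable_intros computable_comp2[OF assms(1)] computable_comp2[OF assms(2)])
qed

lemma solvable_conjugacy_problem_computable:
  assumes "wf_presentation P" "solvable_conjugacy_problem P"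
  shows "\<exists>cj. computable (\<lambda>p. cj (fst p) (snd p)) \<and>
    (\<forall>u\<in>words P. \<forall>v\<in>words P. cj u v \<longleftrightarrow> word_conj P u v)"
proof -
  obtain D where D: "recursive 2 D" "\<forall>u\<in>words P. \<forall>v\<in>words P.
      D [word_code u, word_code v] = of_bool (conjugate_in (presented_group P) (elt P u) (elt P v))"
    using assms(2) by (auto simp: solvable_conjugacy_problem_def)
  have "computable (\<lambda>p. D [word_code (fst p), word_code (snd p)] = 1)"
    by (intro computable_intros computable_word_oracle D)
  then show ?thesis
    using D(2) conjugate_in_iff[OF assms(1)]
    by (intro exI[of _ "\<lambda>u v. D [word_code u, word_code v] = 1"]) simp
qed

lemma conjugate_search_solvable_computable:
  assumes "wf_presentation P" "h \<in> words P" "conjugate_search_solvable P (elt P h)"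
  shows "\<exists>C N. computable (\<lambda>p. C (fst p) (snd p)) \<and> computable (\<lambda>p. N (fst p) (snd p)) \<and>
    (\<forall>u\<in>words P. \<forall>v\<in>words P. \<forall>k. word_eq P (word_pow h k @ u @ word_pow h (- k)) v \<longrightarrow>
      {k. word_eq P (word_pow h k @ u @ word_pow h (- k)) v} = {C u v + k * int (N u v) | k. True})"
proof -
  obtain D C N where *: "recursive 2 D \<and> recursive 2 C \<and> recursive 2 N \<and> (\<forall>u\<in>words P. \<forall>v\<in>words P.
        let S = conj_exponents (presented_group P) (elt P h) (elt P u) (elt P v);
            xs = [word_code u, word_code v]
        in D xs = of_bool (S \<noteq> {}) \<and>
           (S \<noteq> {} \<longrightarrow> S = {int_decode (C xs) + k * int (N xs) | k. True}))"
    using assms(3) unfolding conjugate_search_solvable_def by (elim exE) (rule that)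
  note D = *[THEN conjunct2, THEN conjunct1] *[THEN conjunct2, THEN conjunct2, THEN conjunct1]
    *[THEN conjunct2, THEN conjunct2, THEN conjunct2, rule_format, unfolded Let_def]
  have "{k. word_eq P (word_pow h k @ u @ word_pow h (- k)) v} =
      {int_decode (C [word_code u, word_code v]) + k * int (N [word_code u, word_code v]) | k. True}"
    if "u \<in> words P" "v \<in> words P" "word_eq P (word_pow h k @ u @ word_pow h (- k)) v" for u v k
  proof -
    have "conj_exponents (presented_group P) (elt P h) (elt P u) (elt P v) =
        {k. word_eq P (word_pow h k @ u @ word_pow h (- k)) v}"
      using conj_exponents_iff[OF assms(1,2) that(1,2)] by blast
    then show ?thesis using D(3)[OF that(1,2)] that(3) by auto
  qed
  moreover have "computable (\<lambda>p. int_decode (C [word_code (fst p), word_code (snd p)]))"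
    "computable (\<lambda>p. N [word_code (fst p), word_code (snd p)])"
    by (intro computable_int_decode computable_word_oracle D computable_intros)+
  ultimately show ?thesis
    by (intro exI[of _ "\<lambda>u v. int_decode (C [word_code u, word_code v])"]
        exI[of _ "\<lambda>u v. N [word_code u, word_code v]"]) simp
qed

theorem theorem7:
  fixes A B :: presentation and a b :: word
  assumes "wf_presentation A" and "wf_presentation B"
    and "exp_invariant A" and "exp_invariant B"
    and "solvable_conjugacy_problem A" and "solvable_conjugacy_problem B"
    and "a \<in> words A" and "b \<in> words B"
    and "exp_sum a \<noteq> 0" and "exp_sum b \<noteq> 0"
    and "conjugate_search_solvable A (elt A a)"
    and "conjugate_search_solvable B (elt B b)"
  shows "solvable_conjugacy_problem (amalgam A B a b)"
proof -
  obtain cjA where cjA: "computable (\<lambda>p. cjA (fst p) (snd p))"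
    "\<forall>u\<in>words A. \<forall>v\<in>words A. cjA u v \<longleftrightarrow> word_conj A u v"
    using solvable_conjugacy_problem_computable[OF assms(1,5)] by blast
  obtain cjB where cjB: "computable (\<lambda>p. cjB (fst p) (snd p))"
    "\<forall>u\<in>words B. \<forall>v\<in>words B. cjB u v \<longleftrightarrow> word_conj B u v"
    using solvable_conjugacy_problem_computable[OF assms(2,6)] by blast
  obtain CA NA where CA: "computable (\<lambda>p. CA (fst p) (snd p))" "computable (\<lambda>p. NA (fst p) (snd p))"
    "\<forall>u\<in>words A. \<forall>v\<in>words A. \<forall>k. word_eq A (word_pow a k @ u @ word_pow a (- k)) v \<longrightarrow>
      {k. word_eq A (word_pow a k @ u @ word_pow a (- k)) v} = {CA u v + k * int (NA u v) | k. True}"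
    using conjugate_search_solvable_computable[OF assms(1,7,11)] by blast
  obtain CB NB where CB: "computable (\<lambda>p. CB (fst p) (snd p))" "computable (\<lambda>p. NB (fst p) (snd p))"
    "\<forall>u\<in>words B. \<forall>v\<in>words B. \<forall>k. word_eq B (word_pow b k @ u @ word_pow b (- k)) v \<longrightarrow>
      {k. word_eq B (word_pow b k @ u @ word_pow b (- k)) v} = {CB u v + k * int (NB u v) | k. True}"
    using conjugate_search_solvable_computable[OF assms(2,8,12)] by blast
  \<comment> \<open>\<open>True\<close> stands for \<open>A\<close> and \<open>False\<close> for
    \<open>B\<close>, in accordance with \<open>emb\<close>, so \<open>G\<close> is the given
    amalgam.\<close>
  interpret amalgam_decision "\<lambda>s. if s then A else B" "\<lambda>s. if s then a else b"
    "\<lambda>s. if s then cjA else cjB" "\<lambda>s. if s then CA else CB" "\<lambda>s. if s then NA else NB"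
  proof
    fix s :: bool and u v k
    let ?P = "if s then A else B" and ?h = "if s then a else b"
    show "wf_presentation ?P" "exp_invariant ?P" "?h \<in> words ?P" "exp_sum ?h \<noteq> 0"
      using assms by simp_all
    assume "u \<in> words ?P" "v \<in> words ?P"
    then show "(if s then cjA else cjB) u v \<longleftrightarrow> word_conj ?P u v"
      using cjA cjB by (cases s) simp_all
    assume "word_eq ?P (word_pow ?h k @ u @ word_pow ?h (- k)) v"
    then show "{k. word_eq ?P (word_pow ?h k @ u @ word_pow ?h (- k)) v} =
        {(if s then CA else CB) u v + k * int ((if s then NA else NB) u v) | k. True}"
      using CA(3) CB(3) \<open>u \<in> words ?P\<close> \<open>v \<in> words ?P\<close>
      by (cases s) (simp_all, blast+)
  qed (intro computable_if_bool cjA cjB CA CB)+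
  have G: "G = amalgam A B a b" by (simp add: G_def)
  have "computable (\<lambda>p. test (reduce (syllables (fst p))) (reduce (syllables (snd p))))"
    by (intro computable_intros)
  from recursive_word_relation[OF this] show ?thesis
    unfolding solvable_conjugacy_problem_def G[symmetric]
    using conj_decision conjugate_in_iff[OF wf_G] by fastforce
qed

end
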